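(* Fix $\lambda\in\mathbb{R}$ and consider the stochastic evolution equation $\mathrm{d}u=(L_\lambda u+B(u))\,\mathrm{d}t+\mathrm{d}W_t$ in the setting described in the context, where the nonlinearity is bilinear, $B(u)=B(u,u)$. Let $\mathcal{H}^{\mathfrak c}=\mathrm{span}\{e_1,\dots,e_m\}$, $m=\dim\mathcal{H}^{\mathfrak c}$, and $\mathcal{I}=\{1,\dots,m\}$. Assume that $\beta_n(\lambda)<0$ for all $n>m$, and that the following non-resonance conditions hold for all $(i_1,i_2)\in\mathcal{I}^2$ and all $n>m$: (a) if $\langle B(e_{i_1},e_{i_2}),e_n\rangle\neq 0$, then $\beta_{i_1}(\lambda)+\beta_{i_2}(\lambda)-\beta_n(\lambda)>0$; (b) if $\langle B(e_{i_1},e_{i_2}),e_n\rangle\neq 0$ and $\sigma_{i_1}\neq 0$, then $\beta_{i_2}(\lambda)-\beta_n(\lambda)>0$; (c) if $\langle B(e_{i_1},e_{i_2}),e_n\rangle\neq 0$ and $\sigma_{i_2}\neq 0$, then $\beta_{i_1}(\lambda)-\beta_n(\lambda)>0$. Let $u^{(1)}_{\mathfrak c}(\cdot,\omega;\xi)$ and $u^{(1)}_{\mathfrak s}[\xi](T,\theta_{-T}\omega;0)$ be the solutions of the backward-forward system defined in the context. Then the pullback limit of $u^{(1)}_{\mathfrak s}[\xi](T,\theta_{-T}\omega;0)$ as $T\to+\infty$ exists and is given, for all $\xi\in\mathcal{H}^{\mathfrak c}$ and all $\omega\in\Omega$, by $$h^{(1)}_\lambda(\xi,\omega)=\lim_{T\to+\infty}u_{\mathfrak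 s}^{(1)}[\xi](T,\theta_{-T}\omega;0)=\int_{-\infty}^{0}e^{-\tau L_\lambda^{\mathfrak s}}L_\lambda^{\mathfrak s}P_{\mathfrak s}W_\tau(\omega)\,\mathrm{d}\tau+\int_{-\infty}^{0}e^{-\tau L_\lambda^{\mathfrak s}}P_{\mathfrak s}B\big(u_{\mathfrak c}^{(1)}(\tau,\omega;\xi)\big)\,\mathrm{d}\tau ,$$ where $u_{\mathfrak c}^{(1)}(s,\omega;\xi)$, the solution of the first (backward) equation of the system, is $$u_{\mathfrak c}^{(1)}(s,\omega;\xi)=e^{sL_\lambda^{\mathfrak c}}\xi+P_{\mathfrak c}W_s(\omega)-\int_s^0 e^{(s-\tau)L_\lambda^{\mathfrak c}}L_\lambda^{\mathfrak c}P_{\mathfrak c}W_\tau(\omega)\,\mathrm{d}\tau .$$ Moreover, writing $\xi_i=\langle\xi,e_i\rangle$ for $i=1,\dots,m$, $h^{(1)}_\lambda$ has the analytic expression $$h^{(1)}_\lambda(\xi,\omega)=\sum_{n=m+1}^{N}Z_{n,\lambda}(\omega)e_n+\sum_{n=m+1}^{\infty}\sum_{i_1=1}^m\sum_{i_2=1}^m\Big(A_\lambda^{n,i_1,i_2}(\omega)+B_\lambda^{n,i_1,i_2}(\omega)\xi_{i_1}+C_\lambda^{n,i_1,i_2}(\omega)\xi_{i_2}+D_\lambda^{n,i_1,i_2}\xi_{i_1}\xi_{i_2}\Big)\langle B(e_{i_1},e_{i_2}),e_n\rangle e_n,$$ where $$Z_{n,\lambda}(\omega)=\sigma_n\beta_n(\lambda)\int_{-\infty}^0e^{-\tau\beta_n(\lambda)}W^n_\tau(\omega)\,\mathrm{d}\tau,\qquad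 A_\lambda^{n,i_1,i_2}=\sum_{j=1}^4M_{j,\lambda}^{n,i_1,i_2},\qquad B_\lambda^{n,i_1,i_2}=\sum_{j=5}^6M_{j,\lambda}^{n,i_1,i_2},\qquad C_\lambda^{n,i_1,i_2}=\sum_{j=7}^8M_{j,\lambda}^{n,i_1,i_2},$$ $$D_\lambda^{n,i_1,i_2}=\int_{-\infty}^0e^{(\beta_{i_1}(\lambda)+\beta_{i_2}(\lambda)-\beta_n(\lambda))\tau}\,\mathrm{d}\tau=\frac{1}{\beta_{i_1}(\lambda)+\beta_{i_2}(\lambda)-\beta_n(\lambda)},$$ and, writing $\beta_k=\beta_k(\lambda)$ and omitting $\omega$, $$M_{1,\lambda}^{n,i_1,i_2}=\sigma_{i_1}\sigma_{i_2}\int_{-\infty}^0e^{-\beta_n\tau}W_\tau^{i_1}W_\tau^{i_2}\,\mathrm{d}\tau,$$ $$M_{2,\lambda}^{n,i_1,i_2}=-\sigma_{i_1}\sigma_{i_2}\beta_{i_2}\int_{-\infty}^0\Big(e^{-\beta_n\tau}W_\tau^{i_1}\int_\tau^0e^{(\tau-\tau')\beta_{i_2}}W_{\tau'}^{i_2}\,\mathrm{d}\tau'\Big)\mathrm{d}\tau,$$ $$M_{3,\lambda}^{n,i_1,i_2}=-\sigma_{i_1}\sigma_{i_2}\beta_{i_1}\int_{-\infty}^0\Big(e^{-\beta_n\tau}W_\tau^{i_2}\int_\tau^0e^{(\tau-\tau')\beta_{i_1}}W_{\tau'}^{i_1}\,\mathrm{d}\tau'\Big)\mathrm{d}\tau,$$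 $$M_{4,\lambda}^{n,i_1,i_2}=\sigma_{i_1}\sigma_{i_2}\beta_{i_1}\beta_{i_2}\int_{-\infty}^0\Big(e^{-\beta_n\tau}\int_\tau^0e^{(\tau-\tau')\beta_{i_1}}W_{\tau'}^{i_1}\,\mathrm{d}\tau'\int_\tau^0e^{(\tau-\tau')\beta_{i_2}}W_{\tau'}^{i_2}\,\mathrm{d}\tau'\Big)\mathrm{d}\tau,$$ $$M_{5,\lambda}^{n,i_1,i_2}=\sigma_{i_2}\int_{-\infty}^0e^{(\beta_{i_1}-\beta_n)\tau}W_\tau^{i_2}\,\mathrm{d}\tau,\qquad M_{6,\lambda}^{n,i_1,i_2}=-\sigma_{i_2}\beta_{i_2}\int_{-\infty}^0\Big(e^{(\beta_{i_1}-\beta_n)\tau}\int_\tau^0e^{(\tau-\tau')\beta_{i_2}}W_{\tau'}^{i_2}\,\mathrm{d}\tau'\Big)\mathrm{d}\tau,$$ $$M_{7,\lambda}^{n,i_1,i_2}=\sigma_{i_1}\int_{-\infty}^0e^{(\beta_{i_2}-\beta_n)\tau}W_\tau^{i_1}\,\mathrm{d}\tau,\qquad M_{8,\lambda}^{n,i_1,i_2}=-\sigma_{i_1}\beta_{i_1}\int_{-\infty}^0\Big(e^{(\beta_{i_2}-\beta_n)\tau}\int_\tau^0e^{(\tau-\tau')\beta_{i_1}}W_{\tau'}^{i_1}\,\mathrm{d}\tau'\Big)\mathrm{d}\tau.$$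
   Context: **Spaces and operators.** $\mathcal{H}_1,\mathcal{H}$ are Hilbert spaces with $\mathcal{H}_1$ compactly and densely embedded in $\mathcal{H}$; $\langle\cdot,\cdot\rangle$ is the inner product of $\mathcal{H}$. $A:\mathcal{H}_1\to\mathcal{H}$ is a sectorial operator (in the sense of Henry) with $\mathrm{Re}\,\sigma(-A)<0$. For some fixed $\alpha\in[0,1)$, $\mathcal{H}_\alpha$ is the standard interpolated space between $\mathcal{H}_1$ and $\mathcal{H}$. $\{B_\lambda\}_{\lambda\in\mathbb{R}}$ is a family of bounded linear operators $\mathcal{H}_\alpha\to\mathcal{H}$ depending continuously on $\lambda$, and $L_\lambda:=-A+B_\lambda$, mapping $\mathcal{H}_1$ into $\mathcal{H}$. $L_\lambda$ is assumed self-adjoint, with an orthonormal basis of eigenfunctions $\{e_k\}_{k\in\mathbb{N}}$ ($\mathbb{N}=\{1,2,\dots\}$) in $\mathcal{H}$ and corresponding eigenvalues $\{\beta_k(\lambda)\}_{k\in\mathbb{N}}$. The nonlinearity $u\mapsto B(u)=B(u,u)$ is continuous from $\mathcal{H}_\alpha$ into $\mathcal{H}$. (The operators $B_\lambda$ and the coefficients $B_\lambda^{n,i_1,i_2}$ are unrelated to the bilinear map $B$.) **Noise.** $W_t(\omega)=\sum_{i=1}^N\sigma_iW^i_t(\omega)e_i$, $t\in\mathbb{R}$, with $\sigma_i>0$ for $1\le i\le N$ and $W^1,\dots,W^N$ mutually independent standard two-sided Brownian motions with paths in $C_0(\mathbb{R},\mathbb{R})$ (continuous paths vanishing at $0$),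 realized on $\Omega=C_0(\mathbb{R},\mathbb{R}^N)$ endowed with its Borel $\sigma$-algebra, its filtration and the Wiener measure $\mathbb{P}$; $\theta_t\omega=\omega(t+\cdot)-\omega(t)$ is the Wiener shift. Only the first $N$ modes are forced, so $\sigma_i=0$ is understood for $i>N$. **Well-posedness.** It is assumed that for every initial datum in $\mathcal{H}_\alpha$ the equation $\mathrm{d}u=(L_\lambda u+B(u))\,\mathrm{d}t+\mathrm{d}W_t$ has a unique global pathwise solution. **Splitting.** $\mathcal{H}^{\mathfrak c}=\mathrm{span}\{e_1,\dots,e_m\}$; $\mathcal{H}^{\mathfrak s}$ and $\mathcal{H}^{\mathfrak s}_\alpha$ are its topological complements in $\mathcal{H}$ and $\mathcal{H}_\alpha$ respectively; $P_{\mathfrak c},P_{\mathfrak s}$ are the canonical projectors associated with $\mathcal{H}^{\mathfrak c},\mathcal{H}^{\mathfrak s}$; $L^{\mathfrak c}_\lambda=P_{\mathfrak c}L_\lambda$, $L^{\mathfrak s}_\lambda=P_{\mathfrak s}L_\lambda$. **Backward-forward system.** For $T>0$, $\xi\in\mathcal{H}^{\mathfrak c}$, $\omega\in\Omega$: $$\mathrm{d}u^{(1)}_{\mathfrak c}=L^{\mathfrak c}_\lambda u^{(1)}_{\mathfrak c}\,\mathrm{d}s+\mathrm{d}P_{\mathfrak c}W_s,\quad s\in[-T,0],\qquad u^{(1)}_{\mathfrak c}(s,\omega)|_{s=0}=\xi,$$ $$\mathrm{d}u^{(1)}_{\mathfrak s}=\big(L^{\mathfrak s}_\lambda u^{(1)}_{\mathfrak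 s}+P_{\mathfrak s}B(u^{(1)}_{\mathfrak c}(s-T,\omega))\big)\mathrm{d}s+\mathrm{d}P_{\mathfrak s}W_{s-T},\quad s\in[0,T],\qquad u^{(1)}_{\mathfrak s}(s,\theta_{-T}\omega)|_{s=0}=0.$$ The first equation is solved backward from $\xi$ (prescribed in fiber $\omega$), and its solution $u^{(1)}_{\mathfrak c}(\cdot,\omega;\xi)$ forces the second equation, which is solved forward from $0$ (prescribed in fiber $\theta_{-T}\omega$). Solutions are given pathwise by the variation-of-constants formula followed by an integration by parts in the stochastic convolution terms. The value at $s=T$ of the solution of the second equation is denoted $u^{(1)}_{\mathfrak s}[\xi](T,\theta_{-T}\omega;0)$; explicitly, $$u_{\mathfrak s}^{(1)}[\xi](T,\theta_{-T}\omega;0)=-e^{TL_\lambda^{\mathfrak s}}P_{\mathfrak s}W_{-T}(\omega)+\int_{-T}^0e^{-\tau L_\lambda^{\mathfrak s}}L_\lambda^{\mathfrak s}P_{\mathfrak s}W_\tau(\omega)\,\mathrm{d}\tau+\int_{-T}^0e^{-\tau L_\lambda^{\mathfrak s}}P_{\mathfrak s}B(u^{(1)}_{\mathfrak c}(\tau,\omega;\xi))\,\mathrm{d}\tau .$$ **Conventions in the expansion.** A sum $\sum_{n=m+1}^N$ is zero if $N\le m$. Terms with $\langle B(e_{i_1},e_{i_2}),e_n\rangle=0$ are read as zero, and any $M_{j,\lambda}^{n,i_1,i_2}$ with a prefactor $\sigma_i=0$ is read as zero.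
   Formalization: "For all ω in Ω" is restricted to the continuous paths of sublinear growth, a shift-invariant set proved to have Wiener measure one; for faster paths, e.g. growing like exp(t²), the integrals and the pullback limit can diverge. *)

theory Defs
  imports "HOL-Probability.Probability"
begin

section \<open>Unbounded operators on a real Hilbert space\<close>

text \<open>An unbounded operator is a pair of a domain \<open>D\<close> and a total function, of which only the
  values on \<open>D\<close> matter.\<close>

definition linear_op :: "'a::real_vector set \<Rightarrow> ('a \<Rightarrow> 'b::real_vector) \<Rightarrow> bool" where
  "linear_op D A \<longleftrightarrow> subspace D \<and>
     (\<forall>x\<in>D. \<forall>y\<in>D. A (x + y) = A x + A y) \<and> (\<forall>c. \<forall>x\<in>D. A (c *\<^sub>R x) = c *\<^sub>R A x)"

definition closed_op :: "'a::real_normed_vector set \<Rightarrow> ('a \<Rightarrow> 'a) \<Rightarrow> bool" where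
  "closed_op D A \<longleftrightarrow> closed ((\<lambda>x. (x, A x)) ` D)"

text \<open>The second conjunct says that the graph of the operator is the graph of its adjoint.\<close>

definition self_adjoint_op :: "'a::real_inner set \<Rightarrow> ('a \<Rightarrow> 'a) \<Rightarrow> bool" where
  "self_adjoint_op D L \<longleftrightarrow> linear_op D L \<and> closure D = UNIV \<and>
     (\<forall>y z. (y \<in> D \<and> L y = z) \<longleftrightarrow> (\<forall>x\<in>D. inner (L x) y = inner x z))"

text \<open>The spectrum of an operator on a real Hilbert space is that of its complexification.
  The pair \<open>(x, y)\<close> stands for \<open>x + i y\<close>; the product norm is the Hilbert norm of the
  complexification, and \<open>complex_shift A z\<close> is \<open>z - A\<close>.\<close>

definition complex_shift ::
    "('a::real_vector \<Rightarrow> 'a) \<Rightarrow> complex \<Rightarrow> 'a \<times> 'a \<Rightarrow> 'a \<times> 'a" where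
  "complex_shift A z = (\<lambda>(x, y).
     (Re z *\<^sub>R x - Im z *\<^sub>R y - A x, Re z *\<^sub>R y + Im z *\<^sub>R x - A y))"

text \<open>\<open>z\<close> lies in the resolvent set and the resolvent at \<open>z\<close> has operator norm at most \<open>M\<close>.\<close>

definition resolvent_bounded_by ::
    "'a::real_inner set \<Rightarrow> ('a \<Rightarrow> 'a) \<Rightarrow> complex \<Rightarrow> real \<Rightarrow> bool" where
  "resolvent_bounded_by D A z M \<longleftrightarrow>
     bij_betw (complex_shift A z) (D \<times> D) UNIV \<and>
     (\<forall>p \<in> D \<times> D. norm p \<le> M * norm (complex_shift A z p))"

definition op_spectrum :: "'a::real_inner set \<Rightarrow> ('a \<Rightarrow> 'a) \<Rightarrow> complex set" where
  "op_spectrum D A = {z. \<nexists>M. resolvent_bounded_by D A z M}"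

definition sectorial :: "'a::real_inner set \<Rightarrow> ('a \<Rightarrow> 'a) \<Rightarrow> bool" where
  "sectorial D A \<longleftrightarrow> linear_op D A \<and> closure D = UNIV \<and> closed_op D A \<and>
     (\<exists>\<phi> M a. 0 < \<phi> \<and> \<phi> < pi / 2 \<and> 1 \<le> M \<and>
        (\<forall>z. z \<noteq> complex_of_real a \<and> \<phi> \<le> \<bar>Arg (z - complex_of_real a)\<bar> \<longrightarrow>
           resolvent_bounded_by D A z (M / cmod (z - complex_of_real a))))"

section \<open>Semigroups and fractional power spaces\<close>

definition C0_semigroup_on ::
    "'a::real_normed_vector set \<Rightarrow> (real \<Rightarrow> 'a \<Rightarrow> 'a) \<Rightarrow> bool" where
  "C0_semigroup_on X S \<longleftrightarrow>
     (\<forall>t\<ge>0. S t ` X \<subseteq> X \<and> linear_op X (S t) \<and> (\<exists>K. \<forall>x\<in>X. norm (S t x) \<le> K * norm x)) \<and>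
     (\<forall>x\<in>X. S 0 x = x) \<and>
     (\<forall>s\<ge>0. \<forall>t\<ge>0. \<forall>x\<in>X. S (s + t) x = S s (S t x)) \<and>
     (\<forall>x\<in>X. continuous_on {0..} (\<lambda>t. S t x))"

definition is_generator ::
    "'a::real_normed_vector set \<Rightarrow> (real \<Rightarrow> 'a \<Rightarrow> 'a) \<Rightarrow> 'a set \<Rightarrow> ('a \<Rightarrow> 'a) \<Rightarrow> bool" where
  "is_generator X S D L \<longleftrightarrow>
     D = {x\<in>X. \<exists>y. ((\<lambda>t. (S t x - x) /\<^sub>R t) \<longlongrightarrow> y) (at_right 0)} \<and>
     (\<forall>x\<in>D. ((\<lambda>t. (S t x - x) /\<^sub>R t) \<longlongrightarrow> L x) (at_right 0))"

text \<open>\<open>op_semigroup X D L t\<close> is \<open>e\<^bsup>tL\<^esup>\<close> for the operator \<open>L\<close> with domain \<open>D\<close> in the closed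
  subspace \<open>X\<close>. The last conjunct only fixes irrelevant values, so that the semigroup is unique
  as a total function.\<close>

definition op_semigroup ::
    "'a::real_normed_vector set \<Rightarrow> 'a set \<Rightarrow> ('a \<Rightarrow> 'a) \<Rightarrow> real \<Rightarrow> 'a \<Rightarrow> 'a" where
  "op_semigroup X D L = (THE S. C0_semigroup_on X S \<and> is_generator X S D L \<and>
     (\<forall>t x. t < 0 \<or> x \<notin> X \<longrightarrow> S t x = 0))"

text \<open>\<open>A\<^bsup>-\<alpha>\<^esup> = (1 / \<Gamma>(\<alpha>)) \<integral>\<^sub>0\<^sup>\<infinity> t\<^bsup>\<alpha>-1\<^esup> e\<^bsup>-tA\<^esup> dt\<close> for a sectorial operator whose spectrum lies in the
  open right half plane.\<close>

definition neg_frac_power ::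
    "'a::real_normed_vector set \<Rightarrow> ('a \<Rightarrow> 'a) \<Rightarrow> real \<Rightarrow> 'a \<Rightarrow> 'a" where
  "neg_frac_power D A \<alpha> x = (if \<alpha> = 0 then x else
     (1 / Gamma \<alpha>) *\<^sub>R
       integral {0<..} (\<lambda>t. (t powr (\<alpha> - 1)) *\<^sub>R op_semigroup UNIV D (\<lambda>y. - A y) t x))"

text \<open>The space \<open>D(A\<^sup>\<alpha>)\<close> with the norm of \<open>A\<^sup>\<alpha> x\<close>, where \<open>A\<^sup>\<alpha>\<close> is the inverse of \<open>A\<^bsup>-\<alpha>\<^esup>\<close>.\<close>

definition frac_space :: "'a::real_normed_vector set \<Rightarrow> ('a \<Rightarrow> 'a) \<Rightarrow> real \<Rightarrow> 'a set" where
  "frac_space D A \<alpha> = range (neg_frac_power D A \<alpha>)"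

definition frac_norm :: "'a::real_normed_vector set \<Rightarrow> ('a \<Rightarrow> 'a) \<Rightarrow> real \<Rightarrow> 'a \<Rightarrow> real" where
  "frac_norm D A \<alpha> x = norm (inv (neg_frac_power D A \<alpha>) x)"

section \<open>The deterministic setting\<close>

definition compact_dense_embedding ::
    "('k::real_normed_vector \<Rightarrow> 'h::real_normed_vector) \<Rightarrow> bool" where
  "compact_dense_embedding J \<longleftrightarrow> bounded_linear J \<and> inj J \<and>
     closure (range J) = UNIV \<and> compact (closure (J ` cball 0 1))"

text \<open>In the next three definitions \<open>X\<close> is a subspace of \<open>'h\<close> carrying a norm \<open>\<nu>\<close> of its own.\<close>

definition continuous_bounded_family ::
    "'h::real_normed_vector set \<Rightarrow> ('h \<Rightarrow> real) \<Rightarrow> (real \<Rightarrow> 'h \<Rightarrow> 'h) \<Rightarrow> bool" where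
  "continuous_bounded_family X \<nu> Bl \<longleftrightarrow>
     (\<forall>l. linear_op X (Bl l) \<and> (\<exists>K. \<forall>x\<in>X. norm (Bl l x) \<le> K * \<nu> x)) \<and>
     (\<forall>l. \<forall>\<epsilon>>0. \<exists>\<delta>>0. \<forall>l'. \<bar>l' - l\<bar> < \<delta> \<longrightarrow> (\<forall>x\<in>X. norm (Bl l' x - Bl l x) \<le> \<epsilon> * \<nu> x))"

definition continuous_bilinear_nonlinearity ::
    "'h::real_normed_vector set \<Rightarrow> ('h \<Rightarrow> real) \<Rightarrow> ('h \<Rightarrow> 'h \<Rightarrow> 'h) \<Rightarrow> bool" where
  "continuous_bilinear_nonlinearity X \<nu> B \<longleftrightarrow>
     (\<forall>x\<in>X. linear_op X (B x) \<and> linear_op X (\<lambda>y. B y x)) \<and>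
     (\<forall>u\<in>X. \<forall>\<epsilon>>0. \<exists>\<delta>>0. \<forall>v\<in>X. \<nu> (v - u) < \<delta> \<longrightarrow> norm (B v v - B u u) < \<epsilon>)"

definition continuous_path ::
    "'h::real_normed_vector set \<Rightarrow> ('h \<Rightarrow> real) \<Rightarrow> (real \<Rightarrow> 'h) \<Rightarrow> bool" where
  "continuous_path X \<nu> u \<longleftrightarrow> (\<forall>t\<ge>0. u t \<in> X) \<and>
     (\<forall>t\<ge>0. \<forall>\<epsilon>>0. \<exists>\<delta>>0. \<forall>s\<ge>0. \<bar>s - t\<bar> < \<delta> \<longrightarrow> \<nu> (u s - u t) < \<epsilon>)"

definition perturbed_op ::
    "('h::real_vector \<Rightarrow> 'h) \<Rightarrow> (real \<Rightarrow> 'h \<Rightarrow> 'h) \<Rightarrow> real \<Rightarrow> 'h \<Rightarrow> 'h" where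
  "perturbed_op A Bl lam x = - A x + Bl lam x"

text \<open>The index set is \<open>{1, 2, \<dots>}\<close>; the value \<open>e 0\<close> is irrelevant throughout.\<close>

definition orthonormal_basis :: "(nat \<Rightarrow> 'h::real_inner) \<Rightarrow> bool" where
  "orthonormal_basis e \<longleftrightarrow>
     (\<forall>j\<ge>1. \<forall>k\<ge>1. inner (e j) (e k) = (if j = k then 1 else 0)) \<and>
     closure (span (e ` {1..})) = UNIV"

section \<open>Noise\<close>

text \<open>\<open>\<real>\<^sup>N\<close> is rendered as the functions \<open>nat \<Rightarrow> real\<close> vanishing off \<open>{1..N}\<close>; \<open>\<omega> t i\<close> is the value
  \<open>W\<^sup>i\<^sub>t(\<omega>)\<close> of the coordinate process.\<close>

definition C0_paths :: "nat \<Rightarrow> (real \<Rightarrow> nat \<Rightarrow> real) set" where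
  "C0_paths N = {\<omega>. (\<forall>i. continuous_on UNIV (\<lambda>t. \<omega> t i)) \<and> (\<forall>i. \<omega> 0 i = 0) \<and>
     (\<forall>t i. i \<notin> {1..N} \<longrightarrow> \<omega> t i = 0)}"

text \<open>The Borel sets of the topology of uniform convergence on compact intervals.\<close>

definition C0_open :: "nat \<Rightarrow> (real \<Rightarrow> nat \<Rightarrow> real) set \<Rightarrow> bool" where
  "C0_open N U \<longleftrightarrow> U \<subseteq> C0_paths N \<and>
     (\<forall>\<omega>\<in>U. \<exists>T>0. \<exists>\<epsilon>>0. \<forall>\<omega>'\<in>C0_paths N.
        (\<forall>t\<in>{-T..T}. \<forall>i\<in>{1..N}. \<bar>\<omega>' t i - \<omega> t i\<bar> < \<epsilon>) \<longrightarrow> \<omega>' \<in> U)"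

definition C0_borel :: "nat \<Rightarrow> (real \<Rightarrow> nat \<Rightarrow> real) measure" where
  "C0_borel N = sigma (C0_paths N) {U. C0_open N U}"

definition two_sided_BM :: "'w measure \<Rightarrow> (real \<Rightarrow> 'w \<Rightarrow> real) \<Rightarrow> bool" where
  "two_sided_BM P X \<longleftrightarrow>
     (\<forall>t. X t \<in> borel_measurable P) \<and>
     (\<forall>w\<in>space P. X 0 w = 0 \<and> continuous_on UNIV (\<lambda>t. X t w)) \<and>
     (\<forall>s t. s < t \<longrightarrow>
        distributed P lborel (\<lambda>w. X t w - X s w) (normal_density 0 (sqrt (t - s)))) \<and>
     (\<forall>(\<tau>::nat \<Rightarrow> real) n. strict_mono \<tau> \<longrightarrow>
        prob_space.indep_vars P (\<lambda>_. borel) (\<lambda>k w. X (\<tau> (Suc k)) w - X (\<tau> k) w) {..<n})"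

definition wiener_measure :: "nat \<Rightarrow> (real \<Rightarrow> nat \<Rightarrow> real) measure \<Rightarrow> bool" where
  "wiener_measure N P \<longleftrightarrow> prob_space P \<and> space P = C0_paths N \<and> sets P = sets (C0_borel N) \<and>
     (\<forall>i\<in>{1..N}. two_sided_BM P (\<lambda>t \<omega>. \<omega> t i)) \<and>
     prob_space.indep_vars P (\<lambda>_. Pi\<^sub>M UNIV (\<lambda>_. borel)) (\<lambda>i \<omega> t. \<omega> t i) {1..N}"

definition wiener_shift :: "real \<Rightarrow> (real \<Rightarrow> nat \<Rightarrow> real) \<Rightarrow> (real \<Rightarrow> nat \<Rightarrow> real)" where
  "wiener_shift t \<omega> = (\<lambda>s i. \<omega> (t + s) i - \<omega> t i)"

text \<open>The improper integrals below diverge for some continuous paths (think of growth like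
  \<open>exp (t\<^sup>2)\<close>). As usual for random dynamical systems, the sample space is reduced to the
  shift-invariant set of full Wiener measure consisting of the paths of sublinear growth.\<close>

definition sublinear_paths :: "nat \<Rightarrow> (real \<Rightarrow> nat \<Rightarrow> real) set" where
  "sublinear_paths N = {\<omega>\<in>C0_paths N. \<forall>i\<in>{1..N}.
     ((\<lambda>t. \<omega> t i / t) \<longlongrightarrow> 0) at_top \<and> ((\<lambda>t. \<omega> t i / t) \<longlongrightarrow> 0) at_bot}"

definition noise_path ::
    "(nat \<Rightarrow> real) \<Rightarrow> (nat \<Rightarrow> 'h::real_vector) \<Rightarrow> nat \<Rightarrow> (real \<Rightarrow> nat \<Rightarrow> real) \<Rightarrow> real \<Rightarrow> 'h" where
  "noise_path \<sigma> e N \<omega> t = (\<Sum>i=1..N. (\<sigma> i * \<omega> t i) *\<^sub>R e i)"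

section \<open>Pathwise solutions\<close>

text \<open>Below, \<open>w\<close> is a path \<open>t \<mapsto> W\<^sub>t(\<omega>)\<close> of the noise with values in \<open>'h\<close>. A pathwise solution
  of \<open>du = (L u + B(u,u)) dt + dW\<close> satisfies the variation-of-constants formula in which the
  stochastic convolution has been integrated by parts.\<close>

definition global_solution ::
    "'h::{real_inner,banach} set \<Rightarrow> ('h \<Rightarrow> real) \<Rightarrow> 'h set \<Rightarrow> ('h \<Rightarrow> 'h) \<Rightarrow> ('h \<Rightarrow> 'h \<Rightarrow> 'h) \<Rightarrow>
     (real \<Rightarrow> 'h) \<Rightarrow> 'h \<Rightarrow> (real \<Rightarrow> 'h) \<Rightarrow> bool" where
  "global_solution X \<nu> D L B w u0 u \<longleftrightarrow> continuous_path X \<nu> u \<and>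
     (\<forall>t\<ge>0.
        (\<lambda>s. op_semigroup UNIV D L (t - s) (B (u s) (u s))) integrable_on {0..t} \<and>
        u t = op_semigroup UNIV D L t u0
            + integral {0..t} (\<lambda>s. op_semigroup UNIV D L (t - s) (B (u s) (u s)))
            + (w t - op_semigroup UNIV D L t (w 0)
               + integral {0..t} (\<lambda>s. op_semigroup UNIV D L (t - s) (L (w s)))))"

definition uniquely_solvable ::
    "'h::{real_inner,banach} set \<Rightarrow> ('h \<Rightarrow> real) \<Rightarrow> 'h set \<Rightarrow> ('h \<Rightarrow> 'h) \<Rightarrow> ('h \<Rightarrow> 'h \<Rightarrow> 'h) \<Rightarrow>
     (real \<Rightarrow> 'h) \<Rightarrow> bool" where
  "uniquely_solvable X \<nu> D L B w \<longleftrightarrow>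
     (\<forall>u0\<in>X. \<exists>u. global_solution X \<nu> D L B w u0 u \<and>
        (\<forall>v. global_solution X \<nu> D L B w u0 v \<longrightarrow> (\<forall>t\<ge>0. v t = u t)))"

definition Hc :: "(nat \<Rightarrow> 'h::real_vector) \<Rightarrow> nat \<Rightarrow> 'h set" where
  "Hc e m = span (e ` {1..m})"

definition Pc :: "(nat \<Rightarrow> 'h::real_inner) \<Rightarrow> nat \<Rightarrow> 'h \<Rightarrow> 'h" where
  "Pc e m x = (\<Sum>i=1..m. inner x (e i) *\<^sub>R e i)"

definition Ps :: "(nat \<Rightarrow> 'h::real_inner) \<Rightarrow> nat \<Rightarrow> 'h \<Rightarrow> 'h" where
  "Ps e m x = x - Pc e m x"

definition Hs :: "(nat \<Rightarrow> 'h::real_inner) \<Rightarrow> nat \<Rightarrow> 'h set" where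
  "Hs e m = range (Ps e m)"

definition Lc :: "('h \<Rightarrow> 'h) \<Rightarrow> (nat \<Rightarrow> 'h::real_inner) \<Rightarrow> nat \<Rightarrow> 'h \<Rightarrow> 'h" where
  "Lc L e m x = Pc e m (L x)"

definition Ls :: "('h \<Rightarrow> 'h) \<Rightarrow> (nat \<Rightarrow> 'h::real_inner) \<Rightarrow> nat \<Rightarrow> 'h \<Rightarrow> 'h" where
  "Ls L e m x = Ps e m (L x)"

text \<open>\<open>e\<^bsup>tL\<^sub>c\<^esup>\<close> on the finite-dimensional space \<open>Hc\<close>, for \<open>t\<close> of either sign.\<close>

definition exp_Lc ::
    "('h \<Rightarrow> 'h) \<Rightarrow> (nat \<Rightarrow> 'h::real_inner) \<Rightarrow> nat \<Rightarrow> real \<Rightarrow> 'h \<Rightarrow> 'h" where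
  "exp_Lc L e m t x = (\<Sum>k. (t ^ k / fact k) *\<^sub>R ((Lc L e m ^^ k) x))"

text \<open>\<open>e\<^bsup>tL\<^sub>s\<^esup>\<close> on \<open>Hs\<close>, for \<open>t \<ge> 0\<close>.\<close>

definition exp_Ls ::
    "'h set \<Rightarrow> ('h \<Rightarrow> 'h) \<Rightarrow> (nat \<Rightarrow> 'h::real_inner) \<Rightarrow> nat \<Rightarrow> real \<Rightarrow> 'h \<Rightarrow> 'h" where
  "exp_Ls D L e m = op_semigroup (Hs e m) (D \<inter> Hs e m) (Ls L e m)"

text \<open>Since the noise is additive, the first equation is an integral equation for each path:
  \<open>\<xi> - u(s) = \<integral>\<^sub>s\<^sup>0 L\<^sub>c u dr + P\<^sub>c W\<^sub>0 - P\<^sub>c W\<^sub>s\<close>.\<close>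

definition backward_solution ::
    "('h \<Rightarrow> 'h) \<Rightarrow> (nat \<Rightarrow> 'h::{real_inner,banach}) \<Rightarrow> nat \<Rightarrow> (real \<Rightarrow> 'h) \<Rightarrow> real \<Rightarrow> 'h \<Rightarrow>
     (real \<Rightarrow> 'h) \<Rightarrow> bool" where
  "backward_solution L e m w T \<xi> u \<longleftrightarrow>
     continuous_on {-T..0} u \<and> u ` {-T..0} \<subseteq> Hc e m \<and> u 0 = \<xi> \<and>
     (\<forall>s\<in>{-T..0}. \<xi> - u s =
        integral {s..0} (\<lambda>r. Lc L e m (u r)) + (Pc e m (w 0) - Pc e m (w s)))"

definition uc ::
    "('h \<Rightarrow> 'h) \<Rightarrow> (nat \<Rightarrow> 'h::{real_inner,banach}) \<Rightarrow> nat \<Rightarrow> (real \<Rightarrow> 'h) \<Rightarrow> 'h \<Rightarrow> real \<Rightarrow> 'h" where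
  "uc L e m w \<xi> s = exp_Lc L e m s \<xi> + Pc e m (w s)
     - integral {s..0} (\<lambda>\<tau>. exp_Lc L e m (s - \<tau>) (Lc L e m (Pc e m (w \<tau>))))"

text \<open>The solution at time \<open>s \<in> [0, T]\<close>, started from \<open>v0\<close> at \<open>s = 0\<close>, of the second equation
  driven by \<open>u\<close>. The noise is \<open>W\<^bsub>s-T\<^esub>(\<omega>)\<close>, whose increments are those of \<open>W\<^sub>s\<close> in the fiber
  \<open>\<theta>\<^bsub>-T\<^esub>\<omega>\<close>; the bracketed terms come from integrating the stochastic convolution by parts.\<close>

definition forward_solution ::
    "'h set \<Rightarrow> ('h \<Rightarrow> 'h) \<Rightarrow> (nat \<Rightarrow> 'h::{real_inner,banach}) \<Rightarrow> nat \<Rightarrow> ('h \<Rightarrow> 'h \<Rightarrow> 'h) \<Rightarrow>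
     (real \<Rightarrow> 'h) \<Rightarrow> real \<Rightarrow> (real \<Rightarrow> 'h) \<Rightarrow> 'h \<Rightarrow> real \<Rightarrow> 'h" where
  "forward_solution D L e m B w T u v0 s =
     exp_Ls D L e m s v0
     + (Ps e m (w (s - T)) - exp_Ls D L e m s (Ps e m (w (- T)))
        + integral {0..s} (\<lambda>r. exp_Ls D L e m (s - r) (Ls L e m (Ps e m (w (r - T))))))
     + integral {0..s} (\<lambda>r. exp_Ls D L e m (s - r) (Ps e m (B (u (r - T)) (u (r - T)))))"

definition us_at ::
    "'h set \<Rightarrow> ('h \<Rightarrow> 'h) \<Rightarrow> (nat \<Rightarrow> 'h::{real_inner,banach}) \<Rightarrow> nat \<Rightarrow> ('h \<Rightarrow> 'h \<Rightarrow> 'h) \<Rightarrow>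
     (real \<Rightarrow> 'h) \<Rightarrow> 'h \<Rightarrow> real \<Rightarrow> 'h" where
  "us_at D L e m B w \<xi> T = forward_solution D L e m B w T (uc L e m w \<xi>) 0 T"

definition h_noise_integrand ::
    "'h set \<Rightarrow> ('h \<Rightarrow> 'h) \<Rightarrow> (nat \<Rightarrow> 'h::{real_inner,banach}) \<Rightarrow> nat \<Rightarrow> (real \<Rightarrow> 'h) \<Rightarrow> real \<Rightarrow> 'h" where
  "h_noise_integrand D L e m w \<tau> = exp_Ls D L e m (- \<tau>) (Ls L e m (Ps e m (w \<tau>)))"

definition h_nonlinear_integrand ::
    "'h set \<Rightarrow> ('h \<Rightarrow> 'h) \<Rightarrow> (nat \<Rightarrow> 'h::{real_inner,banach}) \<Rightarrow> nat \<Rightarrow> ('h \<Rightarrow> 'h \<Rightarrow> 'h) \<Rightarrow>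
     (real \<Rightarrow> 'h) \<Rightarrow> 'h \<Rightarrow> real \<Rightarrow> 'h" where
  "h_nonlinear_integrand D L e m B w \<xi> \<tau> =
     exp_Ls D L e m (- \<tau>) (Ps e m (B (uc L e m w \<xi> \<tau>) (uc L e m w \<xi> \<tau>)))"

definition h1 ::
    "'h set \<Rightarrow> ('h \<Rightarrow> 'h) \<Rightarrow> (nat \<Rightarrow> 'h::{real_inner,banach}) \<Rightarrow> nat \<Rightarrow> ('h \<Rightarrow> 'h \<Rightarrow> 'h) \<Rightarrow>
     (real \<Rightarrow> 'h) \<Rightarrow> 'h \<Rightarrow> 'h" where
  "h1 D L e m B w \<xi> =
     integral {..0} (h_noise_integrand D L e m w) + integral {..0} (h_nonlinear_integrand D L e m B w \<xi>)"

section \<open>Coefficients of the expansion\<close>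

text \<open>Here \<open>b k\<close> is the eigenvalue \<open>\<beta>\<^sub>k(\<lambda>)\<close> at the fixed parameter.\<close>

definition Z_integrand :: "(nat \<Rightarrow> real) \<Rightarrow> (real \<Rightarrow> nat \<Rightarrow> real) \<Rightarrow> nat \<Rightarrow> real \<Rightarrow> real" where
  "Z_integrand b \<omega> n \<tau> = exp (- \<tau> * b n) * \<omega> \<tau> n"

definition Z_coeff ::
    "(nat \<Rightarrow> real) \<Rightarrow> (nat \<Rightarrow> real) \<Rightarrow> (real \<Rightarrow> nat \<Rightarrow> real) \<Rightarrow> nat \<Rightarrow> real" where
  "Z_coeff b \<sigma> \<omega> n = \<sigma> n * b n * integral {..0} (Z_integrand b \<omega> n)"

definition conv :: "(nat \<Rightarrow> real) \<Rightarrow> (real \<Rightarrow> nat \<Rightarrow> real) \<Rightarrow> nat \<Rightarrow> real \<Rightarrow> real" where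
  "conv b \<omega> i \<tau> = integral {\<tau>..0} (\<lambda>\<tau>'. exp ((\<tau> - \<tau>') * b i) * \<omega> \<tau>' i)"

definition M_prefactor ::
    "(nat \<Rightarrow> real) \<Rightarrow> (nat \<Rightarrow> real) \<Rightarrow> nat \<Rightarrow> nat \<Rightarrow> nat \<Rightarrow> real" where
  "M_prefactor b \<sigma> j i1 i2 =
    (if j = 1 then \<sigma> i1 * \<sigma> i2
     else if j = 2 then - \<sigma> i1 * \<sigma> i2 * b i2
     else if j = 3 then - \<sigma> i1 * \<sigma> i2 * b i1
     else if j = 4 then \<sigma> i1 * \<sigma> i2 * b i1 * b i2
     else if j = 5 then \<sigma> i2
     else if j = 6 then - \<sigma> i2 * b i2
     else if j = 7 then \<sigma> i1
     else if j = 8 then - \<sigma> i1 * b i1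
     else 0)"

definition M_integrand ::
    "(nat \<Rightarrow> real) \<Rightarrow> (real \<Rightarrow> nat \<Rightarrow> real) \<Rightarrow> nat \<Rightarrow> nat \<Rightarrow> nat \<Rightarrow> nat \<Rightarrow> real \<Rightarrow> real" where
  "M_integrand b \<omega> j n i1 i2 \<tau> =
    (if j = 1 then exp (- b n * \<tau>) * \<omega> \<tau> i1 * \<omega> \<tau> i2
     else if j = 2 then exp (- b n * \<tau>) * \<omega> \<tau> i1 * conv b \<omega> i2 \<tau>
     else if j = 3 then exp (- b n * \<tau>) * \<omega> \<tau> i2 * conv b \<omega> i1 \<tau>
     else if j = 4 then exp (- b n * \<tau>) * conv b \<omega> i1 \<tau> * conv b \<omega> i2 \<tau>
     else if j = 5 then exp ((b i1 - b n) * \<tau>) * \<omega> \<tau> i2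
     else if j = 6 then exp ((b i1 - b n) * \<tau>) * conv b \<omega> i2 \<tau>
     else if j = 7 then exp ((b i2 - b n) * \<tau>) * \<omega> \<tau> i1
     else if j = 8 then exp ((b i2 - b n) * \<tau>) * conv b \<omega> i1 \<tau>
     else 0)"

definition M_coeff ::
    "(nat \<Rightarrow> real) \<Rightarrow> (nat \<Rightarrow> real) \<Rightarrow> (real \<Rightarrow> nat \<Rightarrow> real) \<Rightarrow> nat \<Rightarrow> nat \<Rightarrow> nat \<Rightarrow> nat \<Rightarrow> real" where
  "M_coeff b \<sigma> \<omega> j n i1 i2 = M_prefactor b \<sigma> j i1 i2 * integral {..0} (M_integrand b \<omega> j n i1 i2)"

definition A_coeff ::
    "(nat \<Rightarrow> real) \<Rightarrow> (nat \<Rightarrow> real) \<Rightarrow> (real \<Rightarrow> nat \<Rightarrow> real) \<Rightarrow> nat \<Rightarrow> nat \<Rightarrow> nat \<Rightarrow> real" where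
  "A_coeff b \<sigma> \<omega> n i1 i2 = (\<Sum>j=1..4. M_coeff b \<sigma> \<omega> j n i1 i2)"

definition B_coeff ::
    "(nat \<Rightarrow> real) \<Rightarrow> (nat \<Rightarrow> real) \<Rightarrow> (real \<Rightarrow> nat \<Rightarrow> real) \<Rightarrow> nat \<Rightarrow> nat \<Rightarrow> nat \<Rightarrow> real" where
  "B_coeff b \<sigma> \<omega> n i1 i2 = (\<Sum>j=5..6. M_coeff b \<sigma> \<omega> j n i1 i2)"

definition C_coeff ::
    "(nat \<Rightarrow> real) \<Rightarrow> (nat \<Rightarrow> real) \<Rightarrow> (real \<Rightarrow> nat \<Rightarrow> real) \<Rightarrow> nat \<Rightarrow> nat \<Rightarrow> nat \<Rightarrow> real" where
  "C_coeff b \<sigma> \<omega> n i1 i2 = (\<Sum>j=7..8. M_coeff b \<sigma> \<omega> j n i1 i2)"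

definition D_integrand :: "(nat \<Rightarrow> real) \<Rightarrow> nat \<Rightarrow> nat \<Rightarrow> nat \<Rightarrow> real \<Rightarrow> real" where
  "D_integrand b n i1 i2 \<tau> = exp ((b i1 + b i2 - b n) * \<tau>)"

definition D_coeff :: "(nat \<Rightarrow> real) \<Rightarrow> nat \<Rightarrow> nat \<Rightarrow> nat \<Rightarrow> real" where
  "D_coeff b n i1 i2 = integral {..0} (D_integrand b n i1 i2)"

end

(* The noise enters only the finitely many modes 1..N and the first equation only the modes 1..m,
   so everything is read off coordinates in the eigenbasis: e^{tL_s} is the multiplier exp (t b n),
   and u_c is an explicit sum of exponentials, paths and convolutions. For a path of sublinear
   growth, each of the integrands of Z, D and M_1, ..., M_8 is exp (r tau) up to a subexponential
   factor as tau tends to minus infinity, with r > 0 by the non-resonance conditions, and the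
   eigenvalues accumulate only at minus infinity (the domain is compactly embedded), so the rate
   is uniform over the modes n > m. Hence both integrals over (-infinity, 0] converge absolutely,
   their truncations at -T are u_s[xi](T) up to a boundary term that vanishes in the limit, and the
   expansion is the Fourier series of the limit. Sublinear growth holds almost surely by a
   fourth-moment chaining argument over the blocks [0, 16^n]. *)

theory Submission
  imports Defs "HOL-Real_Asymp.Real_Asymp"
begin

section \<open>Orthonormal bases of Hilbert spaces\<close>

text \<open>\<open>exp_Ls\<close> is fixed by a definite description over all semigroups with the
  given generator. The multiplier formula can therefore be used only once it is known to be the
  unique such semigroup, and this is what the one-sided derivative argument on eigenvectors is for.
  The non-resonance conditions have their shape because a convolution with eigenvalue
  \<open>b i\<close> grows at rate \<open>min (b i) 0\<close>. Running through the signs of the two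
  critical eigenvalues, the rates of all integrands reduce to \<open>- b n\<close>,
  \<open>b i1 - b n\<close>, \<open>b i2 - b n\<close> and \<open>b i1 + b i2 - b n\<close>, which
  are positive by stability and by (c), (b), (a). The conditions speak only of modes that
  \<open>B (e i1) (e i2)\<close> really meets, and (b), (c) only of nonzero noise amplitudes. Hence
  the modes n > m cannot all be treated alike: terms with a vanishing coefficient have to be removed
  before integrating, since the integral attached to them may diverge.\<close>

locale hilbert_basis =
  fixes f :: "nat \<Rightarrow> 'h::{real_inner,banach}"
  assumes orth: "inner (f j) (f k) = (if j = k then 1 else 0)"
    and total: "closure (span (range f)) = UNIV"
begin

lemma inner_sum_basis:
  "finite I \<Longrightarrow> inner (\<Sum>k\<in>I. c k *\<^sub>R f k) (f j) = (if j \<in> I then c j else 0)"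
  by (simp add: inner_sum_left orth if_distrib cong: if_cong)

lemma norm_sum_basis:
  assumes "finite I"
  shows "(norm (\<Sum>k\<in>I. c k *\<^sub>R f k))\<^sup>2 = (\<Sum>k\<in>I. (c k)\<^sup>2)"
proof -
  have "(norm (\<Sum>k\<in>I. c k *\<^sub>R f k))\<^sup>2
      = (\<Sum>j\<in>I. inner (\<Sum>k\<in>I. c k *\<^sub>R f k) (c j *\<^sub>R f j))"
    by (simp add: power2_norm_eq_inner inner_sum_right)
  also have "\<dots> = (\<Sum>k\<in>I. (c k)\<^sup>2)"
    using assms by (intro sum.cong) (simp_all only: inner_scaleR_right inner_sum_basis, auto simp: power2_eq_square)
  finally show ?thesis .
qed

lemma bessel:
  assumes "finite I"
  shows "(\<Sum>k\<in>I. (inner x (f k))\<^sup>2) \<le> (norm x)\<^sup>2"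
proof -
  let ?y = "\<Sum>k\<in>I. inner x (f k) *\<^sub>R f k"
  have xy: "inner x ?y = (\<Sum>k\<in>I. (inner x (f k))\<^sup>2)"
    by (simp add: inner_sum_right power2_eq_square)
  have "0 \<le> inner (x - ?y) (x - ?y)" by simp
  also have "\<dots> = (norm x)\<^sup>2 - 2 * inner x ?y + (norm ?y)\<^sup>2"
    by (simp add: power2_norm_eq_inner inner_diff_left inner_diff_right inner_commute)
  also have "(norm ?y)\<^sup>2 = inner x ?y"
    using norm_sum_basis[OF assms] xy by simp
  finally show ?thesis using xy by simp
qed

lemma summable_coord: "summable (\<lambda>k. (inner x (f k))\<^sup>2)"
  by (intro summableI_nonneg_bounded[where x = "(norm x)\<^sup>2"] bessel) auto

text \<open>Orthonormality turns the squared norm of a block of the series into the block sum of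
  squares, so the Cauchy criterion carries over from the scalar series and completeness supplies the
  limit.\<close>

lemma riesz_fischer:
  assumes "summable (\<lambda>k. (c k)\<^sup>2)"
  shows "summable (\<lambda>k. c k *\<^sub>R f k)"
  unfolding summable_Cauchy
proof (intro allI impI)
  fix \<epsilon> :: real assume "0 < \<epsilon>"
  then have "0 < \<epsilon>\<^sup>2" by simp
  with assms obtain K where K: "\<And>j n. j \<ge> K \<Longrightarrow> norm (\<Sum>k=j..<n. (c k)\<^sup>2) < \<epsilon>\<^sup>2"
    unfolding summable_Cauchy by blast
  have "norm (\<Sum>k=j..<n. c k *\<^sub>R f k) < \<epsilon>" if "j \<ge> K" for j n
  proof -
    have "(norm (\<Sum>k=j..<n. c k *\<^sub>R f k))\<^sup>2 = (\<Sum>k=j..<n. (c k)\<^sup>2)"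
      by (simp add: norm_sum_basis)
    also have "\<dots> \<le> norm (\<Sum>k=j..<n. (c k)\<^sup>2)" by simp
    also have "\<dots> < \<epsilon>\<^sup>2" by (rule K[OF that])
    finally show ?thesis using \<open>0 < \<epsilon>\<close> by (simp add: power2_less_imp_less)
  qed
  then show "\<exists>K. \<forall>j\<ge>K. \<forall>n. norm (\<Sum>k=j..<n. c k *\<^sub>R f k) < \<epsilon>" by blast
qed

lemma inner_suminf_basis:
  assumes "summable (\<lambda>k. (c k)\<^sup>2)"
  shows "inner (\<Sum>k. c k *\<^sub>R f k) (f j) = c j"
proof -
  have "(\<lambda>k. inner (c k *\<^sub>R f k) (f j)) sums inner (\<Sum>k. c k *\<^sub>R f k) (f j)"
    using riesz_fischer[OF assms]
    by (intro bounded_linear.sums[OF bounded_linear_inner_left]) (simp add: summable_sums)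
  moreover have "(\<lambda>k. inner (c k *\<^sub>R f k) (f j)) sums (\<Sum>k\<in>{j}. inner (c k *\<^sub>R f k) (f j))"
    by (rule sums_finite) (auto simp: orth)
  ultimately show ?thesis
    using sums_unique2 by (force simp: orth)
qed

text \<open>The vectors orthogonal to x - y form a closed subspace containing the basis, hence the
  whole space, and in particular x - y itself.\<close>

lemma vec_eqI:
  assumes "\<And>k. inner x (f k) = inner y (f k)"
  shows "x = y"
proof -
  let ?S = "{v. inner (x - y) v = 0}"
  have "subspace ?S"
    by (auto simp: subspace_def inner_add_right)
  then have "span (range f) \<subseteq> ?S"
    using assms by (intro span_minimal) (auto simp: inner_diff_left)
  moreover have "closed ?S"
    by (intro closed_Collect_eq continuous_intros)
  ultimately have "closure (span (range f)) \<subseteq> ?S"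
    by (rule closure_minimal)
  then have "x - y \<in> ?S"
    using total by blast
  then have "inner (x - y) (x - y) = 0"
    by blast
  then show ?thesis by simp
qed

lemma fourier: "(\<lambda>k. inner x (f k) *\<^sub>R f k) sums x"
proof -
  have "(\<Sum>k. inner x (f k) *\<^sub>R f k) = x"
    by (rule vec_eqI) (simp add: inner_suminf_basis summable_coord)
  then show ?thesis
    using summable_sums[OF riesz_fischer[OF summable_coord[of x]]] by simp
qed

lemma parseval2: "(\<lambda>k. inner x (f k) * inner y (f k)) sums inner x y"
  using bounded_linear.sums[OF bounded_linear_inner_left fourier, of x y]
  by (simp add: inner_commute)

lemma parseval: "(\<lambda>k. (inner x (f k))\<^sup>2) sums (norm x)\<^sup>2"
  using parseval2[of x x] by (simp add: power2_eq_square power2_norm_eq_inner flip: power2_eq_square)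

text \<open>Parseval reduces a norm estimate to one uniform bound on multipliers. It yields both the
  contractivity of the stable semigroup and its decay rate on a restricted set of modes.\<close>

lemma norm_le_coord:
  assumes "\<And>k. \<bar>inner y (f k)\<bar> \<le> K * \<bar>inner z (f k)\<bar>" "0 \<le> K"
  shows "norm y \<le> K * norm z"
proof -
  have "(norm y)\<^sup>2 \<le> K\<^sup>2 * (norm z)\<^sup>2"
  proof (rule sums_le[OF _ parseval sums_mult[OF parseval]])
    fix k
    have "(\<bar>inner y (f k)\<bar>)\<^sup>2 \<le> (K * \<bar>inner z (f k)\<bar>)\<^sup>2"
      by (intro power_mono assms) auto
    then show "(inner y (f k))\<^sup>2 \<le> K\<^sup>2 * (inner z (f k))\<^sup>2"
      by (simp add: power_mult_distrib)
  qed
  then show ?thesis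
    using \<open>0 \<le> K\<close> by (auto simp flip: power_mult_distrib intro: power2_le_imp_le)
qed

lemma coord_tendsto_0: "(\<lambda>k. inner x (f k)) \<longlonglongrightarrow> 0"
  using summable_LIMSEQ_zero[OF summable_coord[of x]] by simp

text \<open>Dominated convergence in coordinates: Parseval writes the squared distance to the limit
  as a series, and Tannery's theorem exchanges limit and sum. Strong continuity and
  differentiability of the semigroup can thus be checked mode by mode.\<close>

lemma dominated_tendsto:
  fixes y :: "'b \<Rightarrow> 'h"
  assumes lim: "\<And>k. ((\<lambda>t. inner (y t) (f k)) \<longlongrightarrow> inner l (f k)) F"
    and bound: "\<forall>\<^sub>F t in F. \<forall>k. \<bar>inner (y t - l) (f k)\<bar> \<le> K * \<bar>inner z (f k)\<bar>"
  shows "(y \<longlongrightarrow> l) F"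
proof (cases "F = bot")
  case False
  let ?a = "\<lambda>k t. (inner (y t - l) (f k))\<^sup>2"
  have "((\<lambda>t. suminf (\<lambda>k. ?a k t)) \<longlongrightarrow> suminf (\<lambda>_. 0)) F"
  proof (rule tannerys_theorem[THEN conjunct2, THEN conjunct2])
    show "((\<lambda>t. ?a k t) \<longlongrightarrow> 0) F" for k
    proof -
      have "((\<lambda>t. (inner (y t) (f k) - inner l (f k))\<^sup>2) \<longlongrightarrow> (inner l (f k) - inner l (f k))\<^sup>2) F"
        by (intro tendsto_intros lim)
      then show ?thesis by (simp add: inner_diff_left)
    qed
    show "summable (\<lambda>k. K\<^sup>2 * (inner z (f k))\<^sup>2)"
      by (intro summable_mult summable_coord)
    have "\<forall>\<^sub>F t in F. \<forall>k. norm (?a k t) \<le> K\<^sup>2 * (inner z (f k))\<^sup>2"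
      using bound
    proof eventually_elim
      case (elim t)
      show ?case
      proof
        fix k
        have "(\<bar>inner (y t - l) (f k)\<bar>)\<^sup>2 \<le> (K * \<bar>inner z (f k)\<bar>)\<^sup>2"
          by (intro power_mono elim[rule_format]) auto
        then show "norm (?a k t) \<le> K\<^sup>2 * (inner z (f k))\<^sup>2"
          by (simp add: power_mult_distrib)
      qed
    qed
    then show "\<forall>\<^sub>F (k, t) in at_top \<times>\<^sub>F F. norm (?a k t) \<le> K\<^sup>2 * (inner z (f k))\<^sup>2"
      unfolding eventually_prod_filter
      by (intro exI[of _ "\<lambda>_. True"] exI[of _ "\<lambda>t. \<forall>k. norm (?a k t) \<le> K\<^sup>2 * (inner z (f k))\<^sup>2"]) auto
  qed (use False in auto)
  moreover have "suminf (\<lambda>k. ?a k t) = (norm (y t - l))\<^sup>2" for t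
    using parseval by (rule sums_unique[symmetric])
  ultimately have "((\<lambda>t. (norm (y t - l))\<^sup>2) \<longlongrightarrow> 0) F" by simp
  then have "((\<lambda>t. sqrt ((norm (y t - l))\<^sup>2)) \<longlongrightarrow> sqrt 0) F"
    by (intro tendsto_real_sqrt)
  then have "((\<lambda>t. norm (y t - l)) \<longlongrightarrow> 0) F" by simp
  then show ?thesis
    using LIM_zero_cancel tendsto_norm_zero_iff by blast
qed simp

end

section \<open>Self-adjoint operators with an eigenbasis\<close>

text \<open>A generator controls difference quotients from the right only, so the two-sided mean
  value theorem does not apply. Continuous induction shows for each \<epsilon> > 0 that
  \<open>g\<close> moves by at most \<epsilon> t up to time t.\<close>

lemma right_derivative_zero_constant:
  fixes g :: "real \<Rightarrow> 'a::real_normed_vector"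
  assumes cont: "continuous_on {0..} g"
    and deriv: "\<And>t. 0 \<le> t \<Longrightarrow> ((\<lambda>h. (g (t + h) - g t) /\<^sub>R h) \<longlongrightarrow> 0) (at_right 0)"
    and "0 \<le> t"
  shows "g t = g 0"
proof -
  have le: "norm (g t - g 0) \<le> \<epsilon> * t" if "0 < \<epsilon>" for \<epsilon>
  proof -
    define U where "U = {s\<in>{0..t}. \<forall>r\<in>{0..s}. norm (g r - g 0) \<le> \<epsilon> * r}"
    define c where "c = Sup U"
    have U0: "0 \<in> U" using \<open>0 \<le> t\<close> by (simp add: U_def)
    have bdd: "bdd_above U" by (auto simp: U_def bdd_above_def)
    have c0: "0 \<le> c" unfolding c_def by (rule cSup_upper[OF U0 bdd])
    have ct: "c \<le> t" unfolding c_def using U0 by (intro cSup_least) (auto simp: U_def)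
    have below: "norm (g r - g 0) \<le> \<epsilon> * r" if r: "0 \<le> r" "r < c" for r
    proof -
      obtain s where "s \<in> U" "r < s"
        using r(2) less_cSup_iff[OF _ bdd] U0 unfolding c_def by blast
      then show ?thesis using r(1) by (auto simp: U_def)
    qed
    have at_c: "norm (g c - g 0) \<le> \<epsilon> * c"
    proof (cases "c = 0")
      case False
      then have "0 < c" using c0 by simp
      have "continuous_on {0..c} g"
        using cont by (rule continuous_on_subset) auto
      then have "(g \<longlongrightarrow> g c) (at_left c)"
        using \<open>0 < c\<close> by (simp add: continuous_on_Icc_at_leftD)
      then have "((\<lambda>r. norm (g r - g 0)) \<longlongrightarrow> norm (g c - g 0)) (at_left c)"
        by (intro tendsto_intros)
      moreover have "((\<lambda>r. \<epsilon> * r) \<longlongrightarrow> \<epsilon> * c) (at_left c)"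
        by (intro tendsto_intros)
      moreover have "\<forall>\<^sub>F r in at_left c. norm (g r - g 0) \<le> \<epsilon> * r"
        using eventually_at_left_real[OF \<open>0 < c\<close>] by eventually_elim (auto intro: below)
      ultimately show ?thesis
        by (intro tendsto_le[of "at_left c"]) auto
    qed simp
    \<comment> \<open>Continuity has carried the estimate up to the supremum \<open>c\<close>. If
      \<open>c\<close> were smaller than \<open>t\<close>, the right derivative at \<open>c\<close>
      would carry it a little further.\<close>
    have "c = t"
    proof (rule ccontr)
      assume "c \<noteq> t"
      then have "c < t" using ct by simp
      have "\<forall>\<^sub>F h in at_right 0. norm ((g (c + h) - g c) /\<^sub>R h) < \<epsilon>"
        using tendstoD[OF deriv[OF c0] \<open>0 < \<epsilon>\<close>] by simp
      then obtain d where d: "0 < d" "\<And>h. 0 < h \<Longrightarrow> h < d \<Longrightarrow> norm ((g (c + h) - g c) /\<^sub>R h) < \<epsilon>"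
        unfolding eventually_at_right_field by auto
      define s where "s = c + min (d / 2) (t - c)"
      have s: "c < s" "s \<le> t" "s < c + d"
        using d(1) \<open>c < t\<close> by (auto simp: s_def min_def)
      have "norm (g r - g 0) \<le> \<epsilon> * r" if r: "r \<in> {0..s}" for r
      proof -
        consider "r < c" | "r = c" | "c < r" by linarith
        then show ?thesis
        proof cases
          case 3
          have "norm ((g (c + (r - c)) - g c) /\<^sub>R (r - c)) < \<epsilon>"
            using 3 r s by (intro d(2)) auto
          then have "norm (g r - g c) / (r - c) < \<epsilon>"
            using 3 by (simp add: divide_inverse_commute)
          then have "norm (g r - g c) \<le> \<epsilon> * (r - c)"
            using 3 by (simp add: pos_divide_less_eq)
          then have "norm (g r - g 0) \<le> \<epsilon> * (r - c) + \<epsilon> * c"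
            using at_c norm_triangle_ineq[of "g r - g c" "g c - g 0"] by simp
          then show ?thesis by (simp add: algebra_simps)
        qed (use r below at_c in auto)
      qed
      then have "s \<in> U" using s c0 by (auto simp: U_def)
      then have "s \<le> c" unfolding c_def by (rule cSup_upper[OF _ bdd])
      then show False using s by simp
    qed
    then show ?thesis using at_c by simp
  qed
  have "norm (g t - g 0) \<le> 0"
  proof (cases "t = 0")
    case False
    then have "0 < t" using \<open>0 \<le> t\<close> by simp
    show ?thesis
    proof (rule field_le_epsilon)
      fix \<epsilon> :: real assume "0 < \<epsilon>"
      then show "norm (g t - g 0) \<le> 0 + \<epsilon>"
        using le[of "\<epsilon> / t"] \<open>0 < t\<close> by simp
    qed
  qed simp
  then show ?thesis by simp
qed

lemma linear_op_sum:
  assumes "linear_op X A" "finite I" "\<And>i. i \<in> I \<Longrightarrow> v i \<in> X"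
  shows "A (\<Sum>i\<in>I. c i *\<^sub>R v i) = (\<Sum>i\<in>I. c i *\<^sub>R A (v i))"
  using assms(2,3)
proof (induction I rule: finite_induct)
  case empty
  have "0 \<in> X" using assms(1) by (simp add: linear_op_def subspace_0)
  then have "A (0 *\<^sub>R 0) = 0 *\<^sub>R A 0"
    using assms(1) unfolding linear_op_def by blast
  then show ?case by simp
next
  case (insert i I)
  have X: "subspace X" using assms(1) by (simp add: linear_op_def)
  have "(\<Sum>i\<in>I. c i *\<^sub>R v i) \<in> X" "c i *\<^sub>R v i \<in> X" "v i \<in> X"
    using insert.prems by (auto intro!: subspace_sum[OF X] subspace_scale[OF X])
  then show ?case
    using assms(1) insert unfolding linear_op_def by simp
qed

locale spectral_op =
  fixes e :: "nat \<Rightarrow> 'h::{real_inner,banach}" and D :: "'h set" and L :: "'h \<Rightarrow> 'h"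
    and b :: "nat \<Rightarrow> real"
  assumes basis: "orthonormal_basis e"
    and self_adjoint: "self_adjoint_op D L"
    and eigen: "\<And>k. 1 \<le> k \<Longrightarrow> e k \<in> D \<and> L (e k) = b k *\<^sub>R e k"
begin

text \<open>Eigenvectors are numbered from 1 and the abstract basis from 0; the shift keeps the
  meaningless vector \<open>e 0\<close> out of every series.\<close>

sublocale hilbert_basis "\<lambda>k. e (Suc k)"
proof
  show "inner (e (Suc j)) (e (Suc k)) = (if j = k then 1 else 0)" for j k
    using basis by (simp add: orthonormal_basis_def)
  have "range (\<lambda>k. e (Suc k)) = e ` {1..}"
    by (auto simp: image_iff) (metis Suc_pred' le_numeral_extra(4) less_eq_Suc_le One_nat_def atLeast_iff not_less_eq_eq)
  then show "closure (span (range (\<lambda>k. e (Suc k)))) = UNIV"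
    using basis by (simp add: orthonormal_basis_def)
qed

lemma orth1: "1 \<le> j \<Longrightarrow> 1 \<le> k \<Longrightarrow> inner (e j) (e k) = (if j = k then 1 else 0)"
  using basis by (simp add: orthonormal_basis_def)

lemma norm_e: "1 \<le> k \<Longrightarrow> norm (e k) = 1"
  by (simp add: norm_eq_sqrt_inner orth1)

lemma vec_eqI1: "(\<And>n. 1 \<le> n \<Longrightarrow> inner x (e n) = inner y (e n)) \<Longrightarrow> x = y"
  by (rule vec_eqI) simp

lemma linear_L: "linear_op D L"
  using self_adjoint by (simp add: self_adjoint_op_def)

lemma subspace_D: "subspace D"
  using linear_L by (simp add: linear_op_def)

text \<open>Symmetry tested against eigenvectors gives one direction. For the other, Parseval
  verifies the adjoint relation against every x in \<open>D\<close>, and self-adjointness then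
  places y in \<open>D\<close>. The domain is thereby described by coordinates alone, which later
  yields domain membership without any regularity argument.\<close>

lemma graph_iff: "y \<in> D \<and> L y = z \<longleftrightarrow> (\<forall>n\<ge>1. inner z (e n) = b n * inner y (e n))"
proof
  assume "y \<in> D \<and> L y = z"
  then have "\<forall>x\<in>D. inner (L x) y = inner x z"
    using self_adjoint by (auto simp: self_adjoint_op_def)
  then show "\<forall>n\<ge>1. inner z (e n) = b n * inner y (e n)"
    using eigen by (metis inner_commute inner_scaleR_left)
next
  assume z: "\<forall>n\<ge>1. inner z (e n) = b n * inner y (e n)"
  have "inner (L x) y = inner x z" if "x \<in> D" for x
  proof -
    have Lx: "inner (L x) (e n) = b n * inner x (e n)" if "1 \<le> n" for n
    proof -
      have "inner (L (e n)) x = inner (e n) (L x)"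
        using self_adjoint \<open>x \<in> D\<close> eigen[OF that] unfolding self_adjoint_op_def by blast
      then show ?thesis using eigen[OF that] by (simp add: inner_commute)
    qed
    have "(\<lambda>k. inner (L x) (e (Suc k)) * inner y (e (Suc k))) sums inner x z"
      using parseval2[of x z] z by (simp add: Lx mult_ac)
    then show ?thesis using parseval2 sums_unique2 by blast
  qed
  then show "y \<in> D \<and> L y = z"
    using self_adjoint by (simp add: self_adjoint_op_def)
qed

lemma inner_L: "x \<in> D \<Longrightarrow> 1 \<le> n \<Longrightarrow> inner (L x) (e n) = b n * inner x (e n)"
  using graph_iff by blast

lemma inner_Pc: "1 \<le> n \<Longrightarrow> inner (Pc e m x) (e n) = (if n \<le> m then inner x (e n) else 0)"
  by (simp add: Pc_def inner_sum_left orth1 if_distrib cong: if_cong)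

lemma inner_Ps: "1 \<le> n \<Longrightarrow> inner (Ps e m x) (e n) = (if n \<le> m then 0 else inner x (e n))"
  by (simp add: Ps_def inner_diff_left inner_Pc)

lemma mem_Hs: "x \<in> Hs e m \<longleftrightarrow> (\<forall>n\<in>{1..m}. inner x (e n) = 0)"
proof
  assume "\<forall>n\<in>{1..m}. inner x (e n) = 0"
  then have "Ps e m x = x"
    by (intro vec_eqI1) (simp add: inner_Ps)
  then show "x \<in> Hs e m" unfolding Hs_def by (metis rangeI)
qed (auto simp: Hs_def inner_Ps)

lemma Ps_Hs: "x \<in> Hs e m \<Longrightarrow> Ps e m x = x"
  by (intro vec_eqI1) (simp add: inner_Ps mem_Hs)

lemma subspace_Hs: "subspace (Hs e m)"
  by (auto simp: subspace_def mem_Hs inner_add_left)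

lemma mem_Hc: "x \<in> Hc e m \<longleftrightarrow> (\<forall>n>m. inner x (e n) = 0)"
proof
  assume "x \<in> Hc e m"
  have "subspace {v. \<forall>n>m. inner v (e n) = 0}"
    by (auto simp: subspace_def inner_add_left)
  then have "Hc e m \<subseteq> {v. \<forall>n>m. inner v (e n) = 0}"
    unfolding Hc_def by (intro span_minimal) (auto simp: orth1)
  then show "\<forall>n>m. inner x (e n) = 0" using \<open>x \<in> Hc e m\<close> by blast
next
  assume "\<forall>n>m. inner x (e n) = 0"
  then have "Pc e m x = x"
    by (intro vec_eqI1) (simp add: inner_Pc)
  moreover have "Pc e m x \<in> Hc e m"
    unfolding Pc_def Hc_def by (intro span_sum span_scale span_base) auto
  ultimately show "x \<in> Hc e m" by simp
qed

lemma Hc_subset_D: "Hc e m \<subseteq> D"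
  unfolding Hc_def by (intro span_minimal subspace_D) (auto simp: eigen)

text \<open>At each of the finitely many points of an \<epsilon>/2-net the coordinates tend to 0 by
  Bessel's inequality, and moving to another point of \<open>K\<close> changes a coordinate by less
  than \<epsilon>/2.\<close>

lemma compact_coord_uniform:
  assumes "compact K" "0 < \<epsilon>"
  shows "\<forall>\<^sub>F n in sequentially. \<forall>x\<in>K. \<bar>inner x (e n)\<bar> \<le> \<epsilon>"
proof -
  obtain F where F: "finite F" "K \<subseteq> (\<Union>p\<in>F. ball p (\<epsilon> / 2))"
    using assms compact_eq_totally_bounded[of K] by (metis half_gt_zero)
  have "\<forall>\<^sub>F n in sequentially. \<bar>inner p (e n)\<bar> < \<epsilon> / 2" for p
  proof -
    have "\<forall>\<^sub>F n in sequentially. \<bar>inner p (e (Suc n))\<bar> < \<epsilon> / 2"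
      using tendstoD[OF coord_tendsto_0[of p], of "\<epsilon> / 2"] \<open>0 < \<epsilon>\<close> by simp
    then show ?thesis
      using eventually_sequentially_Suc[of "\<lambda>n. \<bar>inner p (e n)\<bar> < \<epsilon> / 2"] by simp
  qed
  then have "\<forall>\<^sub>F n in sequentially. \<forall>p\<in>F. \<bar>inner p (e n)\<bar> < \<epsilon> / 2"
    using F(1) by (simp add: eventually_ball_finite)
  then show ?thesis
    using eventually_ge_at_top[of 1]
  proof eventually_elim
    case (elim n)
    show ?case
    proof
      fix x assume "x \<in> K"
      then obtain p where p: "p \<in> F" "norm (x - p) < \<epsilon> / 2"
        using F(2) by (force simp: dist_norm norm_minus_commute)
      have "\<bar>inner (x - p) (e n)\<bar> \<le> norm (x - p)"
        using Cauchy_Schwarz_ineq2[of "x - p" "e n"] elim(2) by (simp add: norm_e)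
      moreover have "inner x (e n) = inner p (e n) + inner (x - p) (e n)"
        by (simp add: inner_diff_left)
      ultimately show "\<bar>inner x (e n)\<bar> \<le> \<epsilon>"
        using p elim(1) by fastforce
    qed
  qed
qed

text \<open>If infinitely many eigenvalues were bounded, then sparse series in the corresponding
  eigenvectors would lie in the domain, although their coefficients decay too slowly for a
  multiple of the compact image of the unit ball.\<close>

lemma eigenvalues_discrete:
  fixes J :: "'k::real_normed_vector \<Rightarrow> 'h"
  assumes J: "compact_dense_embedding J" and D: "D = range J"
  shows "finite {n. 1 \<le> n \<and> \<bar>b n\<bar> \<le> C}"
proof (rule ccontr)
  define I where "I = {n. 1 \<le> n \<and> \<bar>b n\<bar> \<le> C}"
  assume "infinite {n. 1 \<le> n \<and> \<bar>b n\<bar> \<le> C}"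
  then have inf: "infinite I" by (simp add: I_def)
  define K where "K = closure (J ` cball 0 1)"
  have "compact K" using J by (simp add: compact_dense_embedding_def K_def)
  \<comment> \<open>The subsequence is made so sparse that points of \<open>K\<close> have
    coordinates at most 4^-k along it, to be played off against a vector with coordinates
    2^-k.\<close>
  have ex: "\<exists>n. n > a \<and> n \<in> I \<and> (\<forall>x\<in>K. \<bar>inner x (e n)\<bar> \<le> (1/4) ^ k)" for a k
  proof -
    obtain M where "\<forall>n\<ge>M. \<forall>x\<in>K. \<bar>inner x (e n)\<bar> \<le> (1/4) ^ k"
      using compact_coord_uniform[OF \<open>compact K\<close>, of "(1/4) ^ k"]
      by (auto simp: eventually_sequentially)
    moreover obtain n where "n \<in> I" "n > max a M"
      using inf by (metis infinite_nat_iff_unbounded)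
    ultimately show ?thesis by (intro exI[of _ n]) auto
  qed
  have "\<exists>r. \<forall>k. (r k \<in> I \<and> (\<forall>x\<in>K. \<bar>inner x (e (r k))\<bar> \<le> (1/4) ^ k)) \<and> r k < r (Suc k)"
  proof (rule dependent_nat_choice)
    show "\<exists>n. n \<in> I \<and> (\<forall>x\<in>K. \<bar>inner x (e n)\<bar> \<le> (1/4) ^ 0)"
      using ex[of 0 0] by blast
    show "\<exists>n'. (n' \<in> I \<and> (\<forall>x\<in>K. \<bar>inner x (e n')\<bar> \<le> (1/4) ^ Suc k)) \<and> n < n'" for n k
      using ex[of n "Suc k"] by blast
  qed
  then obtain r where r: "\<And>k. r k \<in> I" "\<And>k x. x \<in> K \<Longrightarrow> \<bar>inner x (e (r k))\<bar> \<le> (1/4) ^ k"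
      "\<And>k. r k < r (Suc k)"
    by blast
  have "strict_mono r" using r(3) by (simp add: strict_mono_Suc_iff)
  then have inj: "r j = r k \<longleftrightarrow> j = k" for j k by (simp add: strict_mono_eq)
  have r1: "1 \<le> r k" and rC: "\<bar>b (r k)\<bar> \<le> C" for k using r(1)[of k] by (auto simp: I_def)
  have "0 \<le> C" using rC[of 0] by linarith
  let ?x = "\<Sum>k. (1/2) ^ k *\<^sub>R e (r k)"
  let ?z = "\<Sum>k. ((1/2) ^ k * b (r k)) *\<^sub>R e (r k)"
  have sx: "summable (\<lambda>k. (1/2::real) ^ k *\<^sub>R e (r k))"
    by (rule summable_norm_cancel) (simp add: norm_e[OF r1])
  have sz: "summable (\<lambda>k. ((1/2) ^ k * b (r k)) *\<^sub>R e (r k))"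
  proof (rule summable_comparison_test')
    show "summable (\<lambda>k. C * (1/2) ^ k)" by (intro summable_mult) simp
    show "norm (((1/2) ^ k * b (r k)) *\<^sub>R e (r k)) \<le> C * (1/2) ^ k" for k
      using rC[of k] by (simp add: norm_e[OF r1] abs_mult mult_ac)
  qed
  have ix: "(\<lambda>k. (1/2) ^ k * inner (e (r k)) (e n)) sums inner ?x (e n)" for n
    using bounded_linear.sums[OF bounded_linear_inner_left summable_sums[OF sx]] by simp
  have iz: "(\<lambda>k. (1/2) ^ k * b (r k) * inner (e (r k)) (e n)) sums inner ?z (e n)" for n
    using bounded_linear.sums[OF bounded_linear_inner_left summable_sums[OF sz]] by simp
  \<comment> \<open>Boundedness of the eigenvalues along the subsequence made the series
    \<open>?z\<close> converge; termwise comparison identifies it as the image of \<open>?x\<close>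
    under \<open>L\<close>, so \<open>?x\<close> lies in the domain.\<close>
  have "inner ?z (e n) = b n * inner ?x (e n)" if "1 \<le> n" for n
  proof (rule sums_unique2[OF iz])
    have "(\<lambda>k. b n * ((1/2) ^ k * inner (e (r k)) (e n))) sums (b n * inner ?x (e n))"
      by (intro sums_mult ix)
    then show "(\<lambda>k. (1/2) ^ k * b (r k) * inner (e (r k)) (e n)) sums (b n * inner ?x (e n))"
      by (rule sums_cong[THEN iffD1, rotated]) (simp add: orth1[OF r1 that])
  qed
  then have "?x \<in> D" using graph_iff[of ?x ?z] by blast
  then obtain y where y: "?x = J y" using D by auto
  \<comment> \<open>Dividing by \<open>c\<close> brings \<open>y\<close> into the unit ball, and the
    summand 1 keeps \<open>c\<close> positive.\<close>
  define c where "c = norm y + 1"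
  have "0 < c" by (simp add: c_def add_nonneg_pos)
  have bl: "bounded_linear J" using J by (simp add: compact_dense_embedding_def)
  have "J (y /\<^sub>R c) \<in> K"
    unfolding K_def using \<open>0 < c\<close>
    by (intro subsetD[OF closure_subset] imageI) (simp add: c_def field_simps)
  moreover have "J (y /\<^sub>R c) = ?x /\<^sub>R c"
    using y bl by (simp add: linear_simps)
  ultimately have small: "\<bar>inner (?x /\<^sub>R c) (e (r k))\<bar> \<le> (1/4) ^ k" for k
    using r(2) by metis
  have val: "inner ?x (e (r j)) = (1/2) ^ j" for j
  proof (rule sums_unique2[OF ix])
    have "(\<lambda>k. (1/2) ^ k * inner (e (r k)) (e (r j))) sums
        (\<Sum>k\<in>{j}. (1/2) ^ k * inner (e (r k)) (e (r j)))"
      by (rule sums_finite) (auto simp: orth1[OF r1 r1] inj)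
    then show "(\<lambda>k. (1/2) ^ k * inner (e (r k)) (e (r j))) sums ((1/2) ^ j)"
      by (simp add: orth1[OF r1 r1])
  qed
  \<comment> \<open>The scaled vector has coordinate 2^-k / c but lies in \<open>K\<close>, so this
    is at most 4^-k.\<close>
  have "2 ^ k \<le> c" for k :: nat
  proof -
    have "inner (?x /\<^sub>R c) (e (r k)) = inverse c * (1/2) ^ k"
      by (simp only: inner_scaleR_left val)
    then have "inverse c * (1/2) ^ k \<le> (1/4) ^ k"
      using small[of k] by linarith
    then have "c * (inverse c * (1/2) ^ k) * 4 ^ k \<le> c * (1/4) ^ k * 4 ^ k"
      using \<open>0 < c\<close> by (intro mult_right_mono mult_left_mono) auto
    moreover have "c * (inverse c * (1/2) ^ k) * 4 ^ k = 2 ^ k" "c * (1/4) ^ k * 4 ^ k = c"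
      using \<open>0 < c\<close> by (simp_all add: power_mult_distrib[symmetric] mult.assoc[symmetric] mult.assoc[of c])
    ultimately show ?thesis by simp
  qed
  moreover obtain k :: nat where "c < 2 ^ k"
    using real_arch_pow[of 2 c] by auto
  ultimately show False by (metis not_le)
qed

end

section \<open>The stable semigroup as a multiplier in the eigenbasis\<close>

lemma exp_quotient_tendsto: "((\<lambda>t::real. (exp (t * a) - 1) / t) \<longlongrightarrow> a) (at_right 0)"
proof -
  have "((\<lambda>t. exp (t * a)) has_real_derivative a) (at 0)"
    by (auto intro!: derivative_eq_intros)
  then have "((\<lambda>t. (exp (t * a) - 1) / t) \<longlongrightarrow> a) (at 0)"
    by (simp add: has_field_derivative_iff)
  then show ?thesis
    by (rule filterlim_mono[OF _ order_refl at_le]) simp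
qed

text \<open>From 1 + t a \<le> exp (t a) \<le> 1. This makes the coordinates of \<open>L x\<close> a
  majorant for those of the difference quotients.\<close>

lemma exp_quotient_bound:
  fixes a t :: real
  assumes "a \<le> 0" "0 < t"
  shows "\<bar>(exp (t * a) - 1) / t\<bar> \<le> \<bar>a\<bar>"
proof -
  have "exp (t * a) \<le> 1" using assms by (simp add: mult_nonneg_nonpos)
  moreover have "1 + t * a \<le> exp (t * a)" by (rule exp_ge_add_one_self)
  moreover have "t * \<bar>a\<bar> = - (t * a)" using assms by simp
  ultimately have "\<bar>exp (t * a) - 1\<bar> \<le> t * \<bar>a\<bar>" by linarith
  then show ?thesis using assms by (simp add: field_simps)
qed

locale stable_op = spectral_op +
  fixes m :: nat
  assumes stable: "\<And>n. m < n \<Longrightarrow> b n < 0"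
begin

text \<open>The value 0 outside the meaningful range agrees with the convention in
  \<open>op_semigroup\<close>, so that equality of total functions can be proved. Modes up to
  \<open>m\<close> may stay in the series: their coordinates vanish on
  \<open>Hs e m\<close>.\<close>

definition spectral_semigroup :: "real \<Rightarrow> 'a \<Rightarrow> 'a" where
  "spectral_semigroup t x = (if t < 0 \<or> x \<notin> Hs e m then 0
     else (\<Sum>k. (exp (t * b (Suc k)) * inner x (e (Suc k))) *\<^sub>R e (Suc k)))"

text \<open>The coefficients are square summable because the multipliers are at most 1 on the modes
  above \<open>m\<close>, where \<open>b n\<close> is negative, and the remaining coordinates of
  \<open>x\<close> are 0.\<close>

lemma inner_semigroup:
  assumes "0 \<le> t" "x \<in> Hs e m" "1 \<le> n"
  shows "inner (spectral_semigroup t x) (e n) = exp (t * b n) * inner x (e n)"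
proof -
  have "summable (\<lambda>k. (exp (t * b (Suc k)) * inner x (e (Suc k)))\<^sup>2)"
  proof (rule summable_comparison_test'[OF summable_coord[of x]])
    fix k
    show "norm ((exp (t * b (Suc k)) * inner x (e (Suc k)))\<^sup>2) \<le> (inner x (e (Suc k)))\<^sup>2"
    proof (cases "Suc k \<le> m")
      case True
      then have "inner x (e (Suc k)) = 0" using assms(2) by (auto simp: mem_Hs)
      then show ?thesis by simp
    next
      case False
      then have "t * b (Suc k) \<le> 0"
        using stable[of "Suc k"] assms(1) by (simp add: mult_nonneg_nonpos)
      then have "(exp (t * b (Suc k)))\<^sup>2 \<le> 1" by (simp add: power_le_one)
      then show ?thesis
        by (simp add: power_mult_distrib mult_left_le_one_le)
    qed
  qed
  from inner_suminf_basis[OF this, of "n - 1"] show ?thesis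
    using assms by (simp add: spectral_semigroup_def)
qed

lemma Hs_coord_0: "x \<in> Hs e m \<Longrightarrow> 1 \<le> n \<Longrightarrow> n \<le> m \<Longrightarrow> inner x (e n) = 0"
  by (simp add: mem_Hs)

lemma semigroup_in_Hs: "0 \<le> t \<Longrightarrow> x \<in> Hs e m \<Longrightarrow> spectral_semigroup t x \<in> Hs e m"
  by (auto simp: mem_Hs inner_semigroup)

lemma exp_coord_bound:
  assumes "x \<in> Hs e m" "1 \<le> n" "0 \<le> t"
  shows "\<bar>exp (t * b n) * inner x (e n)\<bar> \<le> \<bar>inner x (e n)\<bar>"
proof (cases "n \<le> m")
  case False
  then have "t * b n \<le> 0" using stable[of n] assms(3) by (simp add: mult_nonneg_nonpos)
  then show ?thesis by (simp add: abs_mult mult_left_le_one_le)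
qed (use assms Hs_coord_0 in simp)

lemma norm_semigroup_le:
  assumes "0 \<le> t" "x \<in> Hs e m"
  shows "norm (spectral_semigroup t x) \<le> norm x"
  using norm_le_coord[of "spectral_semigroup t x" 1 x] exp_coord_bound[OF assms(2) _ assms(1)] assms
  by (simp add: inner_semigroup)

lemma linear_op_semigroup: "0 \<le> t \<Longrightarrow> linear_op (Hs e m) (spectral_semigroup t)"
  unfolding linear_op_def using subspace_Hs
  by (auto intro!: vec_eqI1 simp: inner_semigroup subspace_add subspace_scale inner_add_left distrib_left)

lemma continuous_semigroup:
  assumes x: "x \<in> Hs e m"
  shows "continuous_on {0..} (\<lambda>t. spectral_semigroup t x)"
  unfolding continuous_on_def
proof
  fix s :: real assume s: "s \<in> {0..}"
  show "((\<lambda>t. spectral_semigroup t x) \<longlongrightarrow> spectral_semigroup s x) (at s within {0..})"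
  \<comment> \<open>Each of the two subtracted coordinates is bounded by that of \<open>x\<close>,
    whence the factor 2.\<close>
  proof (rule dominated_tendsto[where K = 2 and z = x])
    fix k
    have "((\<lambda>t. exp (t * b (Suc k)) * inner x (e (Suc k))) \<longlongrightarrow>
        exp (s * b (Suc k)) * inner x (e (Suc k))) (at s within {0..})"
      by (intro tendsto_intros)
    then show "((\<lambda>t. inner (spectral_semigroup t x) (e (Suc k))) \<longlongrightarrow>
        inner (spectral_semigroup s x) (e (Suc k))) (at s within {0..})"
      using s x by (subst (asm) Lim_cong_within[OF refl refl refl]) (auto simp: inner_semigroup)
  next
    show "\<forall>\<^sub>F t in at s within {0..}. \<forall>k.
        \<bar>inner (spectral_semigroup t x - spectral_semigroup s x) (e (Suc k))\<bar> \<le> 2 * \<bar>inner x (e (Suc k))\<bar>"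
      unfolding eventually_at_filter
    proof (intro always_eventually allI impI)
      fix t k assume "t \<in> {0::real..}"
      then show "\<bar>inner (spectral_semigroup t x - spectral_semigroup s x) (e (Suc k))\<bar> \<le> 2 * \<bar>inner x (e (Suc k))\<bar>"
        using exp_coord_bound[OF x, of "Suc k" t] exp_coord_bound[OF x, of "Suc k" s] s x
        by (simp add: inner_diff_left inner_semigroup)
    qed
  qed
qed

lemma C0_semigroup: "C0_semigroup_on (Hs e m) spectral_semigroup"
  unfolding C0_semigroup_on_def
proof (intro conjI allI impI ballI)
  show "\<exists>K. \<forall>x\<in>Hs e m. norm (spectral_semigroup t x) \<le> K * norm x" if "0 \<le> t" for t
    using norm_semigroup_le[OF that] by (intro exI[of _ 1]) simp
  show "spectral_semigroup 0 x = x" if "x \<in> Hs e m" for x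
    using that by (intro vec_eqI1) (simp add: inner_semigroup)
  show "spectral_semigroup (s + t) x = spectral_semigroup s (spectral_semigroup t x)"
    if "0 \<le> s" "0 \<le> t" "x \<in> Hs e m" for s t x
    using that by (intro vec_eqI1) (simp add: inner_semigroup semigroup_in_Hs distrib_right exp_add)
qed (auto intro: semigroup_in_Hs linear_op_semigroup continuous_semigroup)

text \<open>Each mode is differentiated separately. The coordinates of \<open>L x\<close> dominate
  the quotients, and they are square summable precisely because \<open>x\<close> lies in the
  domain.\<close>

lemma semigroup_quotient_tendsto:
  assumes "x \<in> D" "x \<in> Hs e m"
  shows "((\<lambda>t. (spectral_semigroup t x - x) /\<^sub>R t) \<longlongrightarrow> L x) (at_right 0)"
proof (rule dominated_tendsto[where K = 2 and z = "L x"])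
  have coord: "inner ((spectral_semigroup t x - x) /\<^sub>R t) (e n) = (exp (t * b n) - 1) / t * inner x (e n)"
    if "0 < t" "1 \<le> n" for t n
    using that assms(2) by (simp add: inner_diff_left inner_semigroup field_simps)
  show "((\<lambda>t. inner ((spectral_semigroup t x - x) /\<^sub>R t) (e (Suc k))) \<longlongrightarrow> inner (L x) (e (Suc k))) (at_right 0)" for k
  proof (rule Lim_transform_eventually)
    show "((\<lambda>t. (exp (t * b (Suc k)) - 1) / t * inner x (e (Suc k))) \<longlongrightarrow> inner (L x) (e (Suc k))) (at_right 0)"
      unfolding inner_L[OF assms(1) le_add1[of 1 k, unfolded plus_1_eq_Suc]]
      by (intro tendsto_intros exp_quotient_tendsto)
    show "\<forall>\<^sub>F t in at_right 0. (exp (t * b (Suc k)) - 1) / t * inner x (e (Suc k)) =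
        inner ((spectral_semigroup t x - x) /\<^sub>R t) (e (Suc k))"
      using eventually_at_right_less[of 0] by eventually_elim (rule coord[symmetric]; simp)
  qed
  show "\<forall>\<^sub>F t in at_right 0. \<forall>k. \<bar>inner ((spectral_semigroup t x - x) /\<^sub>R t - L x) (e (Suc k))\<bar> \<le>
      2 * \<bar>inner (L x) (e (Suc k))\<bar>"
    using eventually_at_right_less[of 0]
  proof eventually_elim
    case (elim t)
    show ?case
    proof
      fix k
      show "\<bar>inner ((spectral_semigroup t x - x) /\<^sub>R t - L x) (e (Suc k))\<bar> \<le> 2 * \<bar>inner (L x) (e (Suc k))\<bar>"
      proof (cases "Suc k \<le> m")
        case True
        then have "inner x (e (Suc k)) = 0" using assms(2) by (simp add: Hs_coord_0)
        then show ?thesis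
          using elim coord[of t "Suc k"] by (simp add: inner_diff_left inner_L[OF assms(1)])
      next
        case False
        then have "\<bar>(exp (t * b (Suc k)) - 1) / t\<bar> \<le> \<bar>b (Suc k)\<bar>"
          using stable[of "Suc k"] elim by (intro exp_quotient_bound) auto
        then have "\<bar>(exp (t * b (Suc k)) - 1) / t * inner x (e (Suc k))\<bar> \<le> \<bar>inner (L x) (e (Suc k))\<bar>"
          by (simp only: abs_mult inner_L[OF assms(1)] mult_right_mono abs_ge_zero Suc_le_eq zero_less_Suc One_nat_def)
        moreover have "inner ((spectral_semigroup t x - x) /\<^sub>R t - L x) (e (Suc k)) =
            (exp (t * b (Suc k)) - 1) / t * inner x (e (Suc k)) - inner (L x) (e (Suc k))"
          unfolding inner_diff_left[of _ "L x"] using coord[of t "Suc k"] elim by simp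
        ultimately show ?thesis by linarith
      qed
    qed
  qed
qed

lemma L_in_Hs: "x \<in> D \<Longrightarrow> x \<in> Hs e m \<Longrightarrow> L x \<in> Hs e m"
  by (simp add: mem_Hs inner_L)

lemma Ls_eq: "x \<in> D \<Longrightarrow> x \<in> Hs e m \<Longrightarrow> Ls L e m x = L x"
  by (simp add: Ls_def Ps_Hs L_in_Hs)

text \<open>The delicate inclusion is that differentiability at 0 forces membership in
  \<open>D\<close>: the limit y of the quotients has coordinates \<open>b n * inner x (e n)\<close>,
  which is the coordinate description of the graph of \<open>L\<close>.\<close>

lemma generator: "is_generator (Hs e m) spectral_semigroup (D \<inter> Hs e m) (Ls L e m)"
  unfolding is_generator_def
proof (intro conjI ballI)
  show "((\<lambda>t. (spectral_semigroup t x - x) /\<^sub>R t) \<longlongrightarrow> Ls L e m x) (at_right 0)"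
    if "x \<in> D \<inter> Hs e m" for x
    using that semigroup_quotient_tendsto[of x] by (simp add: Ls_eq)
  have "x \<in> D" if x: "x \<in> Hs e m"
    and y: "((\<lambda>t. (spectral_semigroup t x - x) /\<^sub>R t) \<longlongrightarrow> y) (at_right 0)" for x y
  proof -
    have "inner y (e n) = b n * inner x (e n)" if n: "1 \<le> n" for n
    proof (rule tendsto_unique)
      show "((\<lambda>t. inner ((spectral_semigroup t x - x) /\<^sub>R t) (e n)) \<longlongrightarrow> inner y (e n)) (at_right 0)"
        by (intro tendsto_intros y)
      show "((\<lambda>t. inner ((spectral_semigroup t x - x) /\<^sub>R t) (e n)) \<longlongrightarrow> b n * inner x (e n)) (at_right 0)"
      proof (rule Lim_transform_eventually)
        show "((\<lambda>t. (exp (t * b n) - 1) / t * inner x (e n)) \<longlongrightarrow> b n * inner x (e n)) (at_right 0)"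
          by (intro tendsto_intros exp_quotient_tendsto)
        show "\<forall>\<^sub>F t in at_right 0. (exp (t * b n) - 1) / t * inner x (e n) =
            inner ((spectral_semigroup t x - x) /\<^sub>R t) (e n)"
          using eventually_at_right_less[of 0]
          by eventually_elim (use x n in \<open>simp add: inner_diff_left inner_semigroup field_simps\<close>)
      qed
    qed simp
    then show "x \<in> D" using graph_iff by blast
  qed
  then show "D \<inter> Hs e m = {x \<in> Hs e m. \<exists>y. ((\<lambda>t. (spectral_semigroup t x - x) /\<^sub>R t) \<longlongrightarrow> y) (at_right 0)}"
    using semigroup_quotient_tendsto by blast
qed

text \<open>Any competitor acts on an eigenvector as the exponential factor, hence agrees on finite
  combinations by linearity, and on all of \<open>Hs e m\<close> by boundedness and density.\<close>

lemma semigroup_unique: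
  assumes T: "C0_semigroup_on (Hs e m) T"
    and gen: "is_generator (Hs e m) T (D \<inter> Hs e m) (Ls L e m)"
    and t: "0 \<le> t" and x: "x \<in> Hs e m"
  shows "T t x = spectral_semigroup t x"
proof -
  have eigvec: "T t (e n) = exp (t * b n) *\<^sub>R e n" if n: "m < n" for n
  proof -
    have enX: "e n \<in> Hs e m" using n by (simp add: mem_Hs orth1)
    have lin: "linear_op (Hs e m) (T s)" and bdd: "\<exists>K. \<forall>x\<in>Hs e m. norm (T s x) \<le> K * norm x"
      and inX: "\<And>x. x \<in> Hs e m \<Longrightarrow> T s x \<in> Hs e m" if "0 \<le> s" for s
      using T[unfolded C0_semigroup_on_def, THEN conjunct1, rule_format, OF that] by blast+
    have T0: "T 0 (e n) = e n" using T enX by (simp add: C0_semigroup_on_def)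
    \<comment> \<open>Multiplying by the inverse of the expected factor turns the claim into the
      constancy of \<open>g\<close>.\<close>
    define g where "g s = exp (- (s * b n)) *\<^sub>R T s (e n)" for s
    have "g t = g 0"
    proof (rule right_derivative_zero_constant[OF _ _ t])
      show "continuous_on {0..} g"
        unfolding g_def using T enX by (auto intro!: continuous_intros simp: C0_semigroup_on_def)
      fix s :: real assume s: "0 \<le> s"
      \<comment> \<open>The difference quotient of \<open>g\<close> at 0. The semigroup law writes
        the quotient at \<open>s\<close> as a fixed bounded operator applied to \<open>v h\<close>,
        so convergence at 0 suffices.\<close>
      define v where "v h = (exp (- (h * b n)) *\<^sub>R T h (e n) - e n) /\<^sub>R h" for h
      obtain K where K: "\<And>x. x \<in> Hs e m \<Longrightarrow> norm (T s x) \<le> K * norm x"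
        using bdd[OF s] by blast
      have vX: "v h \<in> Hs e m" if "0 \<le> h" for h
        unfolding v_def using enX inX[OF that enX]
        by (intro subspace_scale[OF subspace_Hs] subspace_diff[OF subspace_Hs])
      have 1: "((\<lambda>h. (T h (e n) - e n) /\<^sub>R h) \<longlongrightarrow> b n *\<^sub>R e n) (at_right 0)"
      proof -
        have "e n \<in> D \<inter> Hs e m" "Ls L e m (e n) = b n *\<^sub>R e n"
          using enX eigen[of n] n by (simp_all add: Ls_eq)
        then show ?thesis
          using gen[unfolded is_generator_def, THEN conjunct2, rule_format, of "e n"] by (simp only:)
      qed
      have 2: "((\<lambda>h. (exp (h * (- b n)) - 1) / h) \<longlongrightarrow> - b n) (at_right 0)"
        by (rule exp_quotient_tendsto)
      have 3: "((\<lambda>h::real. exp (h * (- b n))) \<longlongrightarrow> exp (0 * (- b n))) (at_right 0)"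
        by (intro tendsto_intros)
      have "((\<lambda>h. exp (h * (- b n)) *\<^sub>R ((T h (e n) - e n) /\<^sub>R h)
          + ((exp (h * (- b n)) - 1) / h) *\<^sub>R e n) \<longlongrightarrow>
          exp (0 * (- b n)) *\<^sub>R (b n *\<^sub>R e n) + (- b n) *\<^sub>R e n) (at_right 0)"
        by (rule tendsto_add[OF tendsto_scaleR[OF 3 1] tendsto_scaleR[OF 2 tendsto_const]])
      then have v0: "(v \<longlongrightarrow> 0) (at_right 0)"
        unfolding v_def by (simp add: algebra_simps divide_inverse)
      have quot: "(g (s + h) - g s) /\<^sub>R h = exp (- (s * b n)) *\<^sub>R T s (v h)" if "0 < h" for h
      proof -
        have A: "T (s + h) (e n) = T s (T h (e n))"
          using T[unfolded C0_semigroup_on_def] s that enX less_imp_le by blast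
        have B: "T s (v h) = (exp (- (h * b n)) *\<^sub>R T s (T h (e n)) - T s (e n)) /\<^sub>R h"
        proof -
          \<comment> \<open>A linear combination of two vectors, written as a sum over a two-element
            index set so that \<open>linear_op_sum\<close> applies.\<close>
          have "T s (\<Sum>i\<in>{True, False}. (if i then exp (- (h * b n)) / h else - 1 / h) *\<^sub>R (if i then T h (e n) else e n))
            = (\<Sum>i\<in>{True, False}. (if i then exp (- (h * b n)) / h else - 1 / h) *\<^sub>R T s (if i then T h (e n) else e n))"
            using that inX[of h] enX by (intro linear_op_sum[OF lin[OF s]]) auto
          then show ?thesis
            by (simp add: v_def algebra_simps divide_inverse)
        qed
        have "exp (- ((s + h) * b n)) = exp (- (s * b n)) * exp (- (h * b n))"
          by (simp only: exp_add[symmetric] distrib_right minus_add_distrib)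
        then show ?thesis
          by (simp only: g_def A B scaleR_diff_right scaleR_scaleR mult_ac)
      qed
      have "((\<lambda>h. T s (v h)) \<longlongrightarrow> 0) (at_right 0)"
      proof (rule tendsto_0_le[OF v0, of _ K])
        show "\<forall>\<^sub>F h in at_right 0. norm (T s (v h)) \<le> norm (v h) * K"
          using eventually_at_right_less[of 0]
          by eventually_elim (use K vX in \<open>simp add: mult.commute\<close>)
      qed
      then have "((\<lambda>h. exp (- (s * b n)) *\<^sub>R T s (v h)) \<longlongrightarrow> exp (- (s * b n)) *\<^sub>R 0) (at_right 0)"
        by (intro tendsto_intros)
      then have "((\<lambda>h. exp (- (s * b n)) *\<^sub>R T s (v h)) \<longlongrightarrow> 0) (at_right 0)" by simp
      then show "((\<lambda>h. (g (s + h) - g s) /\<^sub>R h) \<longlongrightarrow> 0) (at_right 0)"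
        by (rule Lim_transform_eventually)
          (use eventually_at_right_less[of 0] in \<open>eventually_elim, simp add: quot\<close>)
    qed
    then have "exp (- (t * b n)) *\<^sub>R T t (e n) = e n" by (simp add: g_def T0)
    then have "exp (t * b n) *\<^sub>R e n = exp (t * b n) *\<^sub>R exp (- (t * b n)) *\<^sub>R T t (e n)" by simp
    then show ?thesis by (simp add: exp_minus)
  qed
  note bounded_ops = T[unfolded C0_semigroup_on_def, THEN conjunct1, rule_format, OF t]
  have lin: "linear_op (Hs e m) (T t)"
    using bounded_ops by blast
  obtain K where K: "\<And>x. x \<in> Hs e m \<Longrightarrow> norm (T t x) \<le> K * norm x"
    using bounded_ops by blast
  \<comment> \<open>Fourier partial sums without the modes up to \<open>m\<close>. Their
    coefficients are zero, but their eigenvectors lie outside \<open>Hs e m\<close>, where nothing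
    is known about \<open>T\<close>.\<close>
  define p where "p k = (\<Sum>i\<in>{i. i < k \<and> m < Suc i}. inner x (e (Suc i)) *\<^sub>R e (Suc i))" for k
  have p_eq: "p k = (\<Sum>i<k. inner x (e (Suc i)) *\<^sub>R e (Suc i))" for k
  proof -
    have "inner x (e (Suc i)) = 0" if "\<not> m < Suc i" for i
      using Hs_coord_0[OF x, of "Suc i"] that by simp
    then show ?thesis
      unfolding p_def by (intro sum.mono_neutral_left) auto
  qed
  have pX: "p k \<in> Hs e m" for k
    unfolding p_def by (intro subspace_sum[OF subspace_Hs] subspace_scale[OF subspace_Hs]) (auto simp: mem_Hs orth1)
  have p_lim: "p \<longlonglongrightarrow> x"
    using fourier[of x] unfolding sums_def p_eq .
  have same: "T t (p k) = spectral_semigroup t (p k)" for k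
  proof -
    have eX: "e (Suc i) \<in> Hs e m" if "m < Suc i" for i using that by (simp add: mem_Hs orth1)
    have S: "spectral_semigroup t (e (Suc i)) = exp (t * b (Suc i)) *\<^sub>R e (Suc i)" if "m < Suc i" for i
      using t eX[OF that] by (intro vec_eqI1) (auto simp: inner_semigroup orth1)
    have "T t (p k) = (\<Sum>i\<in>{i. i < k \<and> m < Suc i}. inner x (e (Suc i)) *\<^sub>R T t (e (Suc i)))"
      unfolding p_def by (rule linear_op_sum[OF lin]) (auto intro: eX)
    also have "\<dots> = (\<Sum>i\<in>{i. i < k \<and> m < Suc i}. inner x (e (Suc i)) *\<^sub>R spectral_semigroup t (e (Suc i)))"
      by (intro sum.cong) (auto simp: eigvec S)
    also have "\<dots> = spectral_semigroup t (p k)"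
      unfolding p_def by (rule linear_op_sum[OF linear_op_semigroup[OF t], symmetric]) (auto intro: eX)
    finally show ?thesis .
  qed
  have lim: "(\<lambda>k. A (p k)) \<longlonglongrightarrow> A x" if A: "linear_op (Hs e m) A" "\<And>x. x \<in> Hs e m \<Longrightarrow> norm (A x) \<le> C * norm x" for A C
  proof (rule LIM_zero_cancel, rule tendsto_0_le[where K = C])
    show "(\<lambda>k. p k - x) \<longlonglongrightarrow> 0" using p_lim by (rule LIM_zero)
    have "A (p k) - A x = A (p k - x)" for k
    proof -
      have "A (\<Sum>i\<in>{True, False}. (if i then 1 else - 1) *\<^sub>R (if i then p k else x))
          = (\<Sum>i\<in>{True, False}. (if i then 1 else - 1) *\<^sub>R A (if i then p k else x))"
        using pX x by (intro linear_op_sum[OF A(1)]) auto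
      then show ?thesis by simp
    qed
    then show "\<forall>\<^sub>F k in sequentially. norm (A (p k) - A x) \<le> norm (p k - x) * C"
      using A(2) pX x by (simp add: subspace_diff[OF subspace_Hs] mult.commute)
  qed
  have "(\<lambda>k. T t (p k)) \<longlonglongrightarrow> T t x"
    by (rule lim[OF lin K])
  moreover have "(\<lambda>k. spectral_semigroup t (p k)) \<longlonglongrightarrow> spectral_semigroup t x"
    using norm_semigroup_le[OF t] by (intro lim[of _ 1] linear_op_semigroup t) auto
  ultimately show ?thesis
    unfolding same by (rule LIMSEQ_unique)
qed

lemma exp_Ls_eq: "exp_Ls D L e m = spectral_semigroup"
  unfolding exp_Ls_def op_semigroup_def
proof (rule the_equality)
  show "C0_semigroup_on (Hs e m) spectral_semigroup \<and>
      is_generator (Hs e m) spectral_semigroup (D \<inter> Hs e m) (Ls L e m) \<and>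
      (\<forall>t x. t < 0 \<or> x \<notin> Hs e m \<longrightarrow> spectral_semigroup t x = 0)"
    using C0_semigroup generator by (simp add: spectral_semigroup_def)
next
  fix T :: "real \<Rightarrow> 'a \<Rightarrow> 'a"
  assume T: "C0_semigroup_on (Hs e m) T \<and> is_generator (Hs e m) T (D \<inter> Hs e m) (Ls L e m) \<and>
      (\<forall>t x. t < 0 \<or> x \<notin> Hs e m \<longrightarrow> T t x = 0)"
  show "T = spectral_semigroup"
  proof (intro ext)
    fix t x
    show "T t x = spectral_semigroup t x"
    proof (cases "0 \<le> t \<and> x \<in> Hs e m")
      case True
      then show ?thesis using T semigroup_unique by blast
    next
      case False
      then have "t < 0 \<or> x \<notin> Hs e m" by auto
      then show ?thesis using T by (auto simp: spectral_semigroup_def)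
    qed
  qed
qed

end

section \<open>Exponentially decaying integrands\<close>

lemma continuous_on_atMost:
  fixes g :: "real \<Rightarrow> 'a::topological_space"
  assumes "\<And>a. a \<le> c \<Longrightarrow> continuous_on {a..c} g"
  shows "continuous_on {..c} g"
  unfolding continuous_on_eq_continuous_within
proof
  fix x assume x: "x \<in> {..c}"
  have "continuous (at x within {x - 1..c}) g"
    using assms[of "x - 1"] x by (simp add: continuous_on_eq_continuous_within)
  moreover have "at x within {x - 1..c} = at x within {..c}"
    by (rule at_within_nhd[where S = "{x - 1<..}"]) auto
  ultimately show "continuous (at x within {..c}) g" by simp
qed

text \<open>The gauge integral over an unbounded set is tested on boxes containing a large ball.
  Such a box meets the half line in an interval \<open>{a..0}\<close> with \<open>a\<close> far to
  the left, so convergence of the truncated integrals is enough.\<close>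

lemma has_integral_atMost_limit:
  fixes f :: "real \<Rightarrow> 'a::banach"
  assumes int: "\<And>a. a \<le> 0 \<Longrightarrow> f integrable_on {a..0}"
    and lim: "((\<lambda>a. integral {a..0} f) \<longlongrightarrow> I) at_bot"
  shows "(f has_integral I) {..0}"
  unfolding has_integral'[of f I]
proof (intro allI impI)
  fix \<epsilon> :: real assume "0 < \<epsilon>"
  then have "\<forall>\<^sub>F a in at_bot. dist (integral {a..0} f) I < \<epsilon>"
    by (rule tendstoD[OF lim])
  then obtain M where M: "\<And>a. a \<le> M \<Longrightarrow> dist (integral {a..0} f) I < \<epsilon>"
    by (auto simp: eventually_at_bot_linorder)
  \<comment> \<open>A positive radius for which the left end of any box containing the ball is at
    most \<open>M\<close>.\<close>
  define B where "B = max 1 (- M)"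
  have "\<exists>z. ((\<lambda>x. if x \<in> {..0} then f x else 0) has_integral z) (cbox a b) \<and> norm (z - I) < \<epsilon>"
    if ab: "ball 0 B \<subseteq> cbox a b" for a b
  proof -
    have "closure (ball 0 B) \<subseteq> cbox a b"
      using ab by (intro closure_minimal) auto
    then have "cball 0 B \<subseteq> cbox a b"
      by (simp add: B_def)
    moreover have "- B \<in> cball 0 B" "B \<in> cball 0 B" by (auto simp: B_def)
    ultimately have "- B \<in> cbox a b" "B \<in> cbox a b" by blast+
    then have aM: "a \<le> M" "a \<le> 0" "0 \<le> b" by (auto simp: B_def)
    have "(f has_integral integral {a..0} f) {a..0}"
      using int[OF aM(2)] by (rule integrable_integral)
    then have "((\<lambda>x. if x \<in> {a..0} then f x else 0) has_integral integral {a..0} f) {a..b}"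
      by (rule has_integral_on_superset[OF has_integral_eq[rotated]]) (use aM in auto)
    then have "((\<lambda>x. if x \<in> {..0} then f x else 0) has_integral integral {a..0} f) {a..b}"
      by (rule has_integral_eq[rotated]) auto
    then show ?thesis
      using M[OF aM(1)] by (intro exI[of _ "integral {a..0} f"]) (auto simp: dist_norm)
  qed
  then show "\<exists>B>0. \<forall>a b. ball 0 B \<subseteq> cbox a b \<longrightarrow>
      (\<exists>z. ((\<lambda>x. if x \<in> {..0} then f x else 0) has_integral z) (cbox a b) \<and> norm (z - I) < \<epsilon>)"
    by (intro exI[of _ B]) (auto simp: B_def)
qed

lemma integral_exp_bound:
  fixes f :: "real \<Rightarrow> 'a::banach"
  assumes "f integrable_on {a..c}" "a \<le> c" "0 < \<delta>" "0 \<le> C"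
    and "\<And>t. t \<in> {a..c} \<Longrightarrow> norm (f t) \<le> C * exp (\<delta> * t)"
  shows "norm (integral {a..c} f) \<le> C / \<delta> * exp (\<delta> * c)"
proof -
  have "((\<lambda>t. C * exp (\<delta> * t)) has_integral C / \<delta> * exp (\<delta> * c) - C / \<delta> * exp (\<delta> * a)) {a..c}"
    using \<open>a \<le> c\<close> \<open>0 < \<delta>\<close>
    by (intro fundamental_theorem_of_calculus)
      (auto intro!: derivative_eq_intros simp: has_real_derivative_iff_has_vector_derivative[symmetric])
  then have "norm (integral {a..c} f) \<le> C / \<delta> * exp (\<delta> * c) - C / \<delta> * exp (\<delta> * a)"
    using integral_norm_bound_integral[OF assms(1) has_integral_integrable assms(5)]
    by (metis integral_unique)
  then show ?thesis
    using assms(3,4) by (smt (verit) divide_nonneg_pos exp_ge_zero mult_nonneg_nonneg)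
qed

text \<open>The piece of the integral to the left of \<open>a\<close> is at most
  \<open>C / \<delta> * exp (\<delta> * a)\<close>, so the truncations are Cauchy in the Banach
  space. Their limit is recorded as well, because the forward solution at time T contains the
  truncation at - T.\<close>

lemma exp_dominated_integral:
  fixes f :: "real \<Rightarrow> 'a::banach"
  assumes cont: "continuous_on {..0} f"
    and bound: "\<And>t. t \<le> 0 \<Longrightarrow> norm (f t) \<le> C * exp (\<delta> * t)" and "0 < \<delta>"
  shows "f integrable_on {..0}" "((\<lambda>a. integral {a..0} f) \<longlongrightarrow> integral {..0} f) at_bot"
proof -
  have "0 \<le> C" using bound[of 0] norm_ge_zero[of "f 0"] by (simp del: norm_ge_zero)
  have int: "f integrable_on {a..c}" if "c \<le> 0" for a c
    using that by (intro integrable_continuous_interval continuous_on_subset[OF cont]) auto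
  have diff: "norm (integral {a'..0} f - integral {a..0} f) \<le> C / \<delta> * exp (\<delta> * a)"
    if "a' \<le> a" "a \<le> 0" for a a'
  proof -
    have "integral {a'..a} f + integral {a..0} f = integral {a'..0} f"
      using that by (intro Henstock_Kurzweil_Integration.integral_combine int) auto
    then have "integral {a'..0} f - integral {a..0} f = integral {a'..a} f"
      by (simp add: algebra_simps)
    also have "norm \<dots> \<le> C / \<delta> * exp (\<delta> * a)"
      using that \<open>0 \<le> C\<close> \<open>0 < \<delta>\<close> by (intro integral_exp_bound int bound) auto
    finally show ?thesis .
  qed
  have zero: "((\<lambda>a. C / \<delta> * exp (\<delta> * a)) \<longlongrightarrow> C / \<delta> * 0) at_bot"
    using \<open>0 < \<delta>\<close> by (intro tendsto_intros filterlim_compose[OF exp_at_bot]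
      filterlim_tendsto_pos_mult_at_bot[OF tendsto_const]) (auto intro: filterlim_ident)
  \<comment> \<open>Completeness is applied along the integers; passing to the limit in
    \<open>diff\<close> then recovers all real truncation points with the same error bound.\<close>
  define X where "X n = integral {- real n..0} f" for n
  have "Cauchy X"
  proof (rule metric_CauchyI)
    fix \<epsilon> :: real assume "0 < \<epsilon>"
    then have "\<forall>\<^sub>F a in at_bot. C / \<delta> * exp (\<delta> * a) < \<epsilon> / 2"
      using order_tendstoD(2)[OF zero, of "\<epsilon> / 2"] by simp
    then obtain M where M: "\<And>a. a \<le> M \<Longrightarrow> C / \<delta> * exp (\<delta> * a) < \<epsilon> / 2"
      by (auto simp: eventually_at_bot_linorder)
    define K where "K = nat \<lceil>- M\<rceil>"
    have K: "- real K \<le> M" unfolding K_def by linarith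
    have "dist (X k) (X K) < \<epsilon> / 2" if "K \<le> k" for k
      using order.strict_trans1[OF diff[of "- real k" "- real K"] M[OF K]] that by (simp add: X_def dist_norm)
    then have "\<forall>j\<ge>K. \<forall>k\<ge>K. dist (X j) (X k) < \<epsilon>"
      by (meson dist_triangle_half_l)
    then show "\<exists>M. \<forall>j\<ge>M. \<forall>k\<ge>M. dist (X j) (X k) < \<epsilon>" by blast
  qed
  then obtain I where I: "X \<longlonglongrightarrow> I"
    using Cauchy_convergent convergent_def by blast
  have near: "norm (integral {a..0} f - I) \<le> C / \<delta> * exp (\<delta> * a)" if "a \<le> 0" for a
  proof (rule tendsto_upperbound)
    show "(\<lambda>n. norm (integral {a..0} f - X n)) \<longlonglongrightarrow> norm (integral {a..0} f - I)"
      by (intro tendsto_intros I)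
    have "\<forall>\<^sub>F n in sequentially. - a \<le> real n"
      using filterlim_real_sequentially by (simp add: filterlim_at_top)
    then show "\<forall>\<^sub>F n in sequentially. norm (integral {a..0} f - X n) \<le> C / \<delta> * exp (\<delta> * a)"
    proof eventually_elim
      case (elim n)
      then show ?case
        using diff[of "- real n" a] that by (simp add: X_def norm_minus_commute)
    qed
  qed simp
  have lim: "((\<lambda>a. integral {a..0} f) \<longlongrightarrow> I) at_bot"
  proof (rule LIM_zero_cancel, rule Lim_null_comparison)
    show "\<forall>\<^sub>F a in at_bot. norm (integral {a..0} f - I) \<le> C / \<delta> * exp (\<delta> * a)"
      using eventually_le_at_bot[of 0] by eventually_elim (rule near)
    show "((\<lambda>a. C / \<delta> * exp (\<delta> * a)) \<longlongrightarrow> 0) at_bot" using zero by simp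
  qed
  have "(f has_integral I) {..0}"
    by (rule has_integral_atMost_limit[OF int lim]) simp
  then show "f integrable_on {..0}" "((\<lambda>a. integral {a..0} f) \<longlongrightarrow> integral {..0} f) at_bot"
    using lim by (auto simp: has_integral_integrable_integral)
qed

section \<open>Decay and growth rates at minus infinity\<close>

definition exp_decaying :: "(real \<Rightarrow> real) \<Rightarrow> bool" where
  "exp_decaying g \<longleftrightarrow> (\<exists>C \<delta>. 0 < \<delta> \<and> (\<forall>\<tau>\<le>0. \<bar>g \<tau>\<bar> \<le> C * exp (\<delta> * \<tau>)))"

lemma exp_decaying_add:
  assumes "exp_decaying g" "exp_decaying h"
  shows "exp_decaying (\<lambda>\<tau>. g \<tau> + h \<tau>)"
proof -
  obtain C \<delta> C' \<delta>' where g: "0 < \<delta>" "\<And>\<tau>. \<tau> \<le> 0 \<Longrightarrow> \<bar>g \<tau>\<bar> \<le> C * exp (\<delta> * \<tau>)"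
    and h: "0 < \<delta>'" "\<And>\<tau>. \<tau> \<le> 0 \<Longrightarrow> \<bar>h \<tau>\<bar> \<le> C' * exp (\<delta>' * \<tau>)"
    using assms unfolding exp_decaying_def by metis
  have C: "0 \<le> C" "0 \<le> C'" using g(2)[of 0] h(2)[of 0] by auto
  have "\<bar>g \<tau> + h \<tau>\<bar> \<le> (C + C') * exp (min \<delta> \<delta>' * \<tau>)" if "\<tau> \<le> 0" for \<tau>
  proof -
    have "C * exp (\<delta> * \<tau>) \<le> C * exp (min \<delta> \<delta>' * \<tau>)" "C' * exp (\<delta>' * \<tau>) \<le> C' * exp (min \<delta> \<delta>' * \<tau>)"
      using that C by (auto intro!: mult_left_mono mult_right_mono_neg)
    then show ?thesis using g(2)[OF that] h(2)[OF that] by (simp add: distrib_right)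
  qed
  then show ?thesis
    unfolding exp_decaying_def using g(1) h(1) by (intro exI[of _ "C + C'"] exI[of _ "min \<delta> \<delta>'"]) auto
qed

text \<open>Decay is demanded only for a nonzero factor. This carries the convention that a term
  with vanishing prefactor is zero even when its integral diverges.\<close>

lemma exp_decaying_cmult:
  assumes "c \<noteq> 0 \<Longrightarrow> exp_decaying g"
  shows "exp_decaying (\<lambda>\<tau>. c * g \<tau>)"
proof (cases "c = 0")
  case True
  then show ?thesis unfolding exp_decaying_def by (intro exI[of _ 0] exI[of _ 1]) auto
next
  case False
  then obtain C \<delta> where "0 < \<delta>" "\<And>\<tau>. \<tau> \<le> 0 \<Longrightarrow> \<bar>g \<tau>\<bar> \<le> C * exp (\<delta> * \<tau>)"
    using assms unfolding exp_decaying_def by blast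
  then show ?thesis
    unfolding exp_decaying_def
    by (intro exI[of _ "\<bar>c\<bar> * C"] exI[of _ \<delta>]) (auto simp: abs_mult mult.assoc intro!: mult_left_mono)
qed

lemma exp_decaying_sum:
  assumes "finite I" "\<And>i. i \<in> I \<Longrightarrow> exp_decaying (g i)"
  shows "exp_decaying (\<lambda>\<tau>. \<Sum>i\<in>I. g i \<tau>)"
  using assms
proof (induction I rule: finite_induct)
  case empty
  then show ?case using exp_decaying_cmult[of 0 "\<lambda>_. 0"] by simp
qed (simp add: exp_decaying_add)

lemma exp_decaying_integrable:
  "continuous_on {..0} g \<Longrightarrow> exp_decaying g \<Longrightarrow> g integrable_on {..0}"
  unfolding exp_decaying_def using exp_dominated_integral(1)[of g] by auto

lemma exp_decaying_tendsto_0: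
  assumes "exp_decaying g"
  shows "(g \<longlongrightarrow> 0) at_bot"
proof -
  obtain C \<delta> where "0 < \<delta>" and C: "\<And>\<tau>. \<tau> \<le> 0 \<Longrightarrow> \<bar>g \<tau>\<bar> \<le> C * exp (\<delta> * \<tau>)"
    using assms unfolding exp_decaying_def by blast
  show ?thesis
  proof (rule Lim_null_comparison)
    show "\<forall>\<^sub>F \<tau> in at_bot. norm (g \<tau>) \<le> C * exp (\<delta> * \<tau>)"
      using eventually_le_at_bot[of 0] by eventually_elim (simp add: C)
    show "((\<lambda>\<tau>. C * exp (\<delta> * \<tau>)) \<longlongrightarrow> 0) at_bot"
      using \<open>0 < \<delta>\<close> by real_asymp
  qed
qed

text \<open>An exponential rate up to an arbitrarily small loss. The loss absorbs subexponential
  factors, so sublinear paths have rate 0, rates add under products, and a positive rate still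
  leaves genuine decay.\<close>

definition growth_rate :: "real \<Rightarrow> (real \<Rightarrow> real) \<Rightarrow> bool" where
  "growth_rate r g \<longleftrightarrow> (\<forall>\<epsilon>>0. \<exists>C. \<forall>\<tau>\<le>0. \<bar>g \<tau>\<bar> \<le> C * exp ((r - \<epsilon>) * \<tau>))"

lemma growth_rate_decaying:
  assumes "growth_rate r g" "0 < r"
  shows "exp_decaying g"
proof -
  obtain C where "\<forall>\<tau>\<le>0. \<bar>g \<tau>\<bar> \<le> C * exp ((r - r / 2) * \<tau>)"
    using assms unfolding growth_rate_def by (meson half_gt_zero)
  then show ?thesis
    unfolding exp_decaying_def using assms(2) by (intro exI[of _ C] exI[of _ "r - r / 2"]) auto
qed

lemma growth_rate_exp: "growth_rate r (\<lambda>\<tau>. exp (r * \<tau>))"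
  unfolding growth_rate_def
proof (intro allI impI exI[of _ 1])
  fix \<epsilon> \<tau> :: real assume "0 < \<epsilon>" "\<tau> \<le> 0"
  then have "\<epsilon> * \<tau> \<le> 0" by (simp add: mult_nonneg_nonpos)
  then show "\<bar>exp (r * \<tau>)\<bar> \<le> 1 * exp ((r - \<epsilon>) * \<tau>)" by (simp add: left_diff_distrib)
qed

lemma growth_rate_mult:
  assumes "growth_rate r g" "growth_rate s h"
  shows "growth_rate (r + s) (\<lambda>\<tau>. g \<tau> * h \<tau>)"
  unfolding growth_rate_def
proof (intro allI impI)
  fix \<epsilon> :: real assume "0 < \<epsilon>"
  then have "0 < \<epsilon> / 2" by simp
  then obtain C C' where g: "\<And>\<tau>. \<tau> \<le> 0 \<Longrightarrow> \<bar>g \<tau>\<bar> \<le> C * exp ((r - \<epsilon> / 2) * \<tau>)"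
    and h: "\<And>\<tau>. \<tau> \<le> 0 \<Longrightarrow> \<bar>h \<tau>\<bar> \<le> C' * exp ((s - \<epsilon> / 2) * \<tau>)"
    using assms unfolding growth_rate_def by metis
  have "\<bar>g \<tau> * h \<tau>\<bar> \<le> (C * C') * exp ((r + s - \<epsilon>) * \<tau>)" if "\<tau> \<le> 0" for \<tau>
  proof -
    have "\<bar>g \<tau>\<bar> * \<bar>h \<tau>\<bar> \<le> (C * exp ((r - \<epsilon> / 2) * \<tau>)) * (C' * exp ((s - \<epsilon> / 2) * \<tau>))"
      using order_trans[OF abs_ge_zero g[OF that]]
      by (intro mult_mono g h that) auto
    also have "\<dots> = (C * C') * (exp ((r - \<epsilon> / 2) * \<tau>) * exp ((s - \<epsilon> / 2) * \<tau>))" by simp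
    also have "exp ((r - \<epsilon> / 2) * \<tau>) * exp ((s - \<epsilon> / 2) * \<tau>) = exp ((r + s - \<epsilon>) * \<tau>)"
      unfolding exp_add[symmetric] by (simp add: field_simps)
    finally show ?thesis by (simp add: abs_mult)
  qed
  then show "\<exists>C. \<forall>\<tau>\<le>0. \<bar>g \<tau> * h \<tau>\<bar> \<le> C * exp ((r + s - \<epsilon>) * \<tau>)" by blast
qed

lemma abs_le_exp:
  fixes \<epsilon> \<tau> :: real
  assumes "0 < \<epsilon>" "\<tau> \<le> 0"
  shows "\<bar>\<tau>\<bar> \<le> (1 / \<epsilon>) * exp (- \<epsilon> * \<tau>)"
proof -
  have "- \<epsilon> * \<tau> \<le> exp (- \<epsilon> * \<tau>)"
    using exp_ge_add_one_self[of "- \<epsilon> * \<tau>"] by linarith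
  then show ?thesis using assms by (simp add: field_simps)
qed

text \<open>Far to the left the function is bounded by the modulus of its argument, on the remaining
  compact interval by a constant, and both are dominated by an exponential of arbitrarily small
  rate.\<close>

lemma growth_rate_sublinear:
  assumes cont: "continuous_on UNIV g" and lim: "((\<lambda>t. g t / t) \<longlongrightarrow> 0) at_bot"
  shows "growth_rate 0 g"
  unfolding growth_rate_def
proof (intro allI impI)
  fix \<epsilon> :: real assume "0 < \<epsilon>"
  have "\<forall>\<^sub>F t in at_bot. \<bar>g t / t\<bar> < 1" using tendstoD[OF lim, of 1] by simp
  then obtain M where M: "\<And>t. t \<le> M \<Longrightarrow> \<bar>g t / t\<bar> < 1"
    by (auto simp: eventually_at_bot_linorder)
  have "compact (g ` {M..0})"
    by (intro compact_continuous_image continuous_on_subset[OF cont]) auto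
  then obtain K where K: "\<And>t. t \<in> {M..0} \<Longrightarrow> \<bar>g t\<bar> \<le> K"
    using compact_imp_bounded bounded_iff[of "g ` {M..0}"] by (metis imageI real_norm_def)
  \<comment> \<open>The summand \<open>\<bar>g 0\<bar>\<close> covers \<tau> = 0, where the quotient
    says nothing and where \<open>{M..0}\<close> may be empty.\<close>
  have "\<bar>g \<tau>\<bar> \<le> (\<bar>K\<bar> + \<bar>g 0\<bar> + 1 / \<epsilon>) * exp ((0 - \<epsilon>) * \<tau>)" if "\<tau> \<le> 0" for \<tau>
  proof -
    have "\<bar>g \<tau>\<bar> \<le> \<bar>K\<bar> + \<bar>g 0\<bar> + \<bar>\<tau>\<bar>"
    proof (cases "\<tau> \<le> M \<and> \<tau> \<noteq> 0")
      case True
      then show ?thesis using M[of \<tau>] by (simp add: abs_divide divide_less_eq)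
    next
      case False
      then show ?thesis using K[of \<tau>] that by (cases "\<tau> = 0") auto
    qed
    also have "\<bar>K\<bar> + \<bar>g 0\<bar> \<le> (\<bar>K\<bar> + \<bar>g 0\<bar>) * exp (- \<epsilon> * \<tau>)"
      using \<open>0 < \<epsilon>\<close> that mult_left_mono[of 1 "exp (- \<epsilon> * \<tau>)" "\<bar>K\<bar> + \<bar>g 0\<bar>"]
      by (simp add: mult_nonneg_nonpos)
    finally show ?thesis using abs_le_exp[OF \<open>0 < \<epsilon>\<close> that] by (simp add: distrib_right)
  qed
  then show "\<exists>C. \<forall>\<tau>\<le>0. \<bar>g \<tau>\<bar> \<le> C * exp ((0 - \<epsilon>) * \<tau>)" by blast
qed

lemma conv_integrand_continuous:
  fixes \<omega> :: "real \<Rightarrow> nat \<Rightarrow> real"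
  assumes "continuous_on UNIV (\<lambda>t. \<omega> t i)"
  shows "continuous_on X (\<lambda>\<tau>'. exp ((\<tau> - \<tau>') * b i) * \<omega> \<tau>' i)"
  by (intro continuous_intros continuous_on_subset[OF assms]) auto

text \<open>Removes \<tau> from the integrand, so that continuity in \<tau> is that of an indefinite
  integral.\<close>

lemma conv_factor: "conv b \<omega> i \<tau> = exp (\<tau> * b i) * integral {\<tau>..0} (\<lambda>\<tau>'. exp (- \<tau>' * b i) * \<omega> \<tau>' i)"
  unfolding conv_def integral_mult_right[symmetric] mult.assoc[symmetric] exp_add[symmetric]
  by (simp add: left_diff_distrib)

lemma continuous_conv:
  assumes "continuous_on UNIV (\<lambda>t. \<omega> t i)"
  shows "continuous_on {..0} (conv b \<omega> i)"
  unfolding conv_factor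
proof (intro continuous_on_mult continuous_on_atMost continuous_intros)
  fix a :: real assume "a \<le> 0"
  have "(\<lambda>\<tau>'. exp (- \<tau>' * b i) * \<omega> \<tau>' i) integrable_on {a..0}"
    by (intro integrable_continuous_interval continuous_intros continuous_on_subset[OF assms]) auto
  then show "continuous_on {a..0} (\<lambda>\<tau>. integral {\<tau>..0} (\<lambda>\<tau>'. exp (- \<tau>' * b i) * \<omega> \<tau>' i))"
    by (rule indefinite_integral_continuous_1')
qed

text \<open>On the domain of integration the kernel is at most 1 if \<open>b i\<close> is
  nonnegative and at most \<open>exp (b i * \<tau>)\<close> otherwise, whence the minimum. Half of
  the permitted loss pays for the path, the other half for the length of the interval.\<close>

lemma growth_rate_conv:
  assumes cont: "continuous_on UNIV (\<lambda>t. \<omega> t i)" and growth: "growth_rate 0 (\<lambda>t. \<omega> t i)"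
  shows "growth_rate (min (b i) 0) (conv b \<omega> i)"
  unfolding growth_rate_def
proof (intro allI impI)
  fix \<epsilon> :: real assume "0 < \<epsilon>"
  then have \<epsilon>2: "0 < \<epsilon> / 2" by simp
  then obtain C where C: "\<And>\<tau>. \<tau> \<le> 0 \<Longrightarrow> \<bar>\<omega> \<tau> i\<bar> \<le> C * exp (- (\<epsilon> / 2) * \<tau>)"
    using growth unfolding growth_rate_def by (metis diff_0)
  have "0 \<le> C" using C[of 0] by auto
  have "\<bar>conv b \<omega> i \<tau>\<bar> \<le> (C * (1 / (\<epsilon> / 2))) * exp ((min (b i) 0 - \<epsilon>) * \<tau>)" if "\<tau> \<le> 0" for \<tau>
  proof -
    define E where "E = C * exp (min (b i) 0 * \<tau>) * exp (- (\<epsilon> / 2) * \<tau>)"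
    have "norm (integral {\<tau>..0} (\<lambda>\<tau>'. exp ((\<tau> - \<tau>') * b i) * \<omega> \<tau>' i)) \<le> E * (0 - \<tau>)"
    proof (rule integral_bound[OF that conv_integrand_continuous[where \<omega> = \<omega> and i = i, OF cont]])
      fix t assume t: "t \<in> {\<tau>..0}"
      have "(\<tau> - t) * b i \<le> min (b i) 0 * \<tau>"
      proof (cases "0 \<le> b i")
        case True
        then show ?thesis using t by (simp add: mult_nonpos_nonneg min_def)
      next
        case False
        then have "0 \<le> t * b i" using t by (simp add: mult_nonpos_nonpos)
        then show ?thesis using False by (simp add: min_def algebra_simps)
      qed
      then have "exp ((\<tau> - t) * b i) \<le> exp (min (b i) 0 * \<tau>)" by simp
      moreover have "\<bar>\<omega> t i\<bar> \<le> C * exp (- (\<epsilon> / 2) * \<tau>)"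
      proof -
        have "- (\<epsilon> / 2) * t \<le> - (\<epsilon> / 2) * \<tau>" using t \<open>0 < \<epsilon>\<close> by simp
        then have "C * exp (- (\<epsilon> / 2) * t) \<le> C * exp (- (\<epsilon> / 2) * \<tau>)"
          using \<open>0 \<le> C\<close> by (intro mult_left_mono) auto
        then show ?thesis using C[of t] t by auto
      qed
      ultimately have "exp ((\<tau> - t) * b i) * \<bar>\<omega> t i\<bar> \<le> exp (min (b i) 0 * \<tau>) * (C * exp (- (\<epsilon> / 2) * \<tau>))"
        by (intro mult_mono) auto
      then show "norm (exp ((\<tau> - t) * b i) * \<omega> t i) \<le> E" by (simp add: E_def abs_mult mult_ac)
    qed
    then have "\<bar>conv b \<omega> i \<tau>\<bar> \<le> E * \<bar>\<tau>\<bar>" using that by (simp add: conv_def)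
    also have "\<dots> \<le> E * ((1 / (\<epsilon> / 2)) * exp (- (\<epsilon> / 2) * \<tau>))"
      using abs_le_exp[OF \<epsilon>2 that] \<open>0 \<le> C\<close> unfolding E_def by (intro mult_left_mono) auto
    also have "\<dots> = (C * (1 / (\<epsilon> / 2))) *
        (exp (min (b i) 0 * \<tau>) * exp (- (\<epsilon> / 2) * \<tau>) * exp (- (\<epsilon> / 2) * \<tau>))"
      by (simp add: E_def)
    also have "exp (min (b i) 0 * \<tau>) * exp (- (\<epsilon> / 2) * \<tau>) * exp (- (\<epsilon> / 2) * \<tau>) =
        exp ((min (b i) 0 - \<epsilon>) * \<tau>)"
      unfolding exp_add[symmetric] by (simp add: algebra_simps)
    finally show ?thesis .
  qed
  then show "\<exists>C. \<forall>\<tau>\<le>0. \<bar>conv b \<omega> i \<tau>\<bar> \<le> C * exp ((min (b i) 0 - \<epsilon>) * \<tau>)" by blast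
qed

section \<open>The coefficients of the expansion along a fixed path\<close>

locale driving_path =
  fixes \<omega> :: "real \<Rightarrow> nat \<Rightarrow> real" and b \<sigma> :: "nat \<Rightarrow> real"
  assumes path_continuous: "continuous_on UNIV (\<lambda>t. \<omega> t i)"
    and path_growth: "growth_rate 0 (\<lambda>t. \<omega> t i)"
begin

lemma path_continuous': "continuous_on X (\<lambda>t. \<omega> t i)"
  by (rule continuous_on_subset[OF path_continuous]) simp

lemmas conv_continuous = continuous_conv[OF path_continuous]

lemma continuous_M_integrand: "continuous_on {..0} (M_integrand b \<omega> j n i1 i2)"
proof -
  consider "j = 1" | "j = 2" | "j = 3" | "j = 4" | "j = 5" | "j = 6" | "j = 7" | "j = 8" | "j \<notin> {1, 2, 3, 4, 5, 6, 7, 8}"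
    by auto
  then show ?thesis
    by cases (auto simp: M_integrand_def[abs_def] intro!: continuous_intros path_continuous' conv_continuous)
qed

text \<open>The rates are left unsimplified because each summand is the rate of one factor: the
  exponential, then 0 for a path or a minimum for a convolution.\<close>

lemma growth_M_integrand:
  "growth_rate (- b n + 0 + 0) (M_integrand b \<omega> 1 n i1 i2)"
  "growth_rate (- b n + 0 + min (b i2) 0) (M_integrand b \<omega> 2 n i1 i2)"
  "growth_rate (- b n + 0 + min (b i1) 0) (M_integrand b \<omega> 3 n i1 i2)"
  "growth_rate (- b n + min (b i1) 0 + min (b i2) 0) (M_integrand b \<omega> 4 n i1 i2)"
  "growth_rate (b i1 - b n + 0) (M_integrand b \<omega> 5 n i1 i2)"
  "growth_rate (b i1 - b n + min (b i2) 0) (M_integrand b \<omega> 6 n i1 i2)"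
  "growth_rate (b i2 - b n + 0) (M_integrand b \<omega> 7 n i1 i2)"
  "growth_rate (b i2 - b n + min (b i1) 0) (M_integrand b \<omega> 8 n i1 i2)"
  unfolding M_integrand_def
  by (simp_all only: if_True if_False refl num.distinct numeral_eq_iff one_eq_numeral_iff
      numeral_eq_one_iff num.inject)
    (intro growth_rate_mult growth_rate_exp path_growth growth_rate_conv path_continuous)+

text \<open>Once the minima are resolved by sign, every rate is one of the four quantities assumed
  positive. A nonzero prefactor guarantees the noise amplitudes under which the conditional ones are
  available.\<close>

lemma M_integrand_decaying:
  assumes pre: "M_prefactor b \<sigma> j i1 i2 \<noteq> 0" and "b n < 0" and "0 < b i1 + b i2 - b n"
    and "\<sigma> i1 \<noteq> 0 \<Longrightarrow> 0 < b i2 - b n" and "\<sigma> i2 \<noteq> 0 \<Longrightarrow> 0 < b i1 - b n"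
  shows "exp_decaying (M_integrand b \<omega> j n i1 i2)"
proof -
  have "j \<in> {1, 2, 3, 4, 5, 6, 7, 8}"
    using pre by (auto simp: M_prefactor_def split: if_splits)
  then consider "j = 1" | "j = 2" | "j = 3" | "j = 4" | "j = 5" | "j = 6" | "j = 7" | "j = 8" by auto
  then show ?thesis
  proof cases
    case 1
    have "growth_rate (- b n) (M_integrand b \<omega> j n i1 i2)"
      using growth_M_integrand(1) 1 by simp
    then show ?thesis using assms(2) by (auto intro: growth_rate_decaying)
  next
    case 2
    show ?thesis unfolding 2
      by (rule growth_rate_decaying[OF growth_M_integrand(2)])
        (use assms 2 in \<open>auto simp: M_prefactor_def min_def\<close>)
  next
    case 3
    show ?thesis unfolding 3
      by (rule growth_rate_decaying[OF growth_M_integrand(3)])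
        (use assms 3 in \<open>auto simp: M_prefactor_def min_def\<close>)
  next
    case 4
    show ?thesis unfolding 4
      by (rule growth_rate_decaying[OF growth_M_integrand(4)])
        (use assms 4 in \<open>auto simp: M_prefactor_def min_def\<close>)
  next
    case 5
    show ?thesis unfolding 5
      by (rule growth_rate_decaying[OF growth_M_integrand(5)])
        (use assms 5 in \<open>auto simp: M_prefactor_def min_def\<close>)
  next
    case 6
    show ?thesis unfolding 6
      by (rule growth_rate_decaying[OF growth_M_integrand(6)])
        (use assms 6 in \<open>auto simp: M_prefactor_def min_def\<close>)
  next
    case 7
    show ?thesis unfolding 7
      by (rule growth_rate_decaying[OF growth_M_integrand(7)])
        (use assms 7 in \<open>auto simp: M_prefactor_def min_def\<close>)
  next
    case 8
    show ?thesis unfolding 8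
      by (rule growth_rate_decaying[OF growth_M_integrand(8)])
        (use assms 8 in \<open>auto simp: M_prefactor_def min_def\<close>)
  qed
qed

text \<open>The i-th coordinate of the backward solution whose final value has i-th coordinate
  \<open>x\<close>.\<close>

definition center_coord :: "real \<Rightarrow> nat \<Rightarrow> real \<Rightarrow> real" where
  "center_coord x i \<tau> = exp (\<tau> * b i) * x + \<sigma> i * \<omega> \<tau> i - \<sigma> i * b i * conv b \<omega> i \<tau>"

lemma continuous_center_coord: "continuous_on {..0} (center_coord x i)"
  unfolding center_coord_def
  by (intro continuous_intros path_continuous' conv_continuous)

text \<open>The origin of all coefficients: each coordinate has three terms, and of the nine
  products the four without initial data give \<open>A_coeff\<close>, the four with one initial
  coordinate give \<open>B_coeff\<close> and \<open>C_coeff\<close>, and the last gives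
  \<open>D_coeff\<close>.\<close>

lemma center_coord_product:
  "exp (- \<tau> * b n) * (center_coord x i1 \<tau> * center_coord y i2 \<tau>) =
    (\<Sum>j=1..4. M_prefactor b \<sigma> j i1 i2 * M_integrand b \<omega> j n i1 i2 \<tau>)
    + (\<Sum>j=5..6. M_prefactor b \<sigma> j i1 i2 * M_integrand b \<omega> j n i1 i2 \<tau>) * x
    + (\<Sum>j=7..8. M_prefactor b \<sigma> j i1 i2 * M_integrand b \<omega> j n i1 i2 \<tau>) * y
    + D_integrand b n i1 i2 \<tau> * x * y"
proof -
  define E E1 E2 where "E = exp (- \<tau> * b n)" and "E1 = exp (\<tau> * b i1)" and "E2 = exp (\<tau> * b i2)"
  have exps: "exp (- b n * \<tau>) = E" "exp ((b i1 - b n) * \<tau>) = E * E1" "exp ((b i2 - b n) * \<tau>) = E * E2"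
    "exp ((b i1 + b i2 - b n) * \<tau>) = E * E1 * E2"
    unfolding E_def E1_def E2_def exp_add[symmetric] by (simp_all add: algebra_simps)
  have sums: "(\<Sum>j=1..4. F j) = F 1 + F 2 + F 3 + F 4" "(\<Sum>j=5..6. F j) = F 5 + F 6"
    "(\<Sum>j=7..8. F j) = F 7 + F 8" for F :: "nat \<Rightarrow> real"
    by (simp_all add: eval_nat_numeral)
  show ?thesis
    unfolding center_coord_def sums M_prefactor_def M_integrand_def D_integrand_def exps
    unfolding E_def[symmetric] E1_def[symmetric] E2_def[symmetric]
    by (simp add: algebra_simps)
qed

lemma D_integrand_decaying: "0 < b i1 + b i2 - b n \<Longrightarrow> exp_decaying (D_integrand b n i1 i2)"
  unfolding D_integrand_def by (rule growth_rate_decaying[OF growth_rate_exp])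

lemma continuous_D_integrand: "continuous_on X (D_integrand b n i1 i2)"
  unfolding D_integrand_def by (intro continuous_intros)

lemma center_coord_product_decaying:
  assumes "b n < 0" and "0 < b i1 + b i2 - b n"
    and "\<sigma> i1 \<noteq> 0 \<Longrightarrow> 0 < b i2 - b n" and "\<sigma> i2 \<noteq> 0 \<Longrightarrow> 0 < b i1 - b n"
  shows "exp_decaying (\<lambda>\<tau>. exp (- \<tau> * b n) * (center_coord x i1 \<tau> * center_coord y i2 \<tau>))"
proof -
  have "exp_decaying (\<lambda>\<tau>. \<Sum>j\<in>I. M_prefactor b \<sigma> j i1 i2 * M_integrand b \<omega> j n i1 i2 \<tau>)" if "finite I" for I
    using that by (intro exp_decaying_sum exp_decaying_cmult M_integrand_decaying assms)
  from this[of "{1..4}"] exp_decaying_cmult[OF this[of "{5..6}"], of x]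
    exp_decaying_cmult[OF this[of "{7..8}"], of y]
    exp_decaying_cmult[OF D_integrand_decaying[OF assms(2)], of "x * y"]
  show ?thesis
    unfolding center_coord_product by (auto intro!: exp_decaying_add simp: mult_ac)
qed

lemma has_integral_center_coord_product:
  assumes "b n < 0" and "0 < b i1 + b i2 - b n"
    and "\<sigma> i1 \<noteq> 0 \<Longrightarrow> 0 < b i2 - b n" and "\<sigma> i2 \<noteq> 0 \<Longrightarrow> 0 < b i1 - b n"
  shows "((\<lambda>\<tau>. exp (- \<tau> * b n) * (center_coord x i1 \<tau> * center_coord y i2 \<tau>)) has_integral
    A_coeff b \<sigma> \<omega> n i1 i2 + B_coeff b \<sigma> \<omega> n i1 i2 * x + C_coeff b \<sigma> \<omega> n i1 i2 * y
      + D_coeff b n i1 i2 * x * y) {..0}"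
proof -
  have "((\<lambda>\<tau>. M_prefactor b \<sigma> j i1 i2 * M_integrand b \<omega> j n i1 i2 \<tau>) has_integral M_coeff b \<sigma> \<omega> j n i1 i2) {..0}" for j
  \<comment> \<open>With a zero prefactor no decay is available, but integrand and coefficient are
    both zero.\<close>
  proof (cases "M_prefactor b \<sigma> j i1 i2 = 0")
    case False
    then show ?thesis
      unfolding M_coeff_def
      by (intro has_integral_mult_right integrable_integral exp_decaying_integrable
        continuous_M_integrand M_integrand_decaying assms)
  qed (simp add: M_coeff_def)
  then have "((\<lambda>\<tau>. \<Sum>j\<in>I. M_prefactor b \<sigma> j i1 i2 * M_integrand b \<omega> j n i1 i2 \<tau>) has_integral
      (\<Sum>j\<in>I. M_coeff b \<sigma> \<omega> j n i1 i2)) {..0}" if "finite I" for I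
    using that by (intro has_integral_sum)
  moreover have "(D_integrand b n i1 i2 has_integral D_coeff b n i1 i2) {..0}"
    unfolding D_coeff_def
    by (intro integrable_integral exp_decaying_integrable continuous_D_integrand D_integrand_decaying assms)
  ultimately show ?thesis
    unfolding center_coord_product A_coeff_def B_coeff_def C_coeff_def
    by (intro has_integral_add has_integral_mult_left) auto
qed

end

lemma D_coeff_eq:
  assumes "0 < b i1 + b i2 - b n"
  shows "D_coeff b n i1 i2 = 1 / (b i1 + b i2 - b n)"
proof -
  define a where "a = b i1 + b i2 - b n"
  have "0 < a" using assms by (simp add: a_def)
  have int: "((\<lambda>\<tau>. exp (a * \<tau>)) has_integral (1 - exp (a * c)) / a) {c..0}" if "c \<le> 0" for c
  proof -
    have "((\<lambda>\<tau>. exp (a * \<tau>) / a) has_real_derivative exp (a * x)) (at x within {c..0})" for x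
      using \<open>0 < a\<close> by (auto intro!: derivative_eq_intros)
    then have "((\<lambda>\<tau>. exp (a * \<tau>)) has_integral exp (a * 0) / a - exp (a * c) / a) {c..0}"
      using that by (intro fundamental_theorem_of_calculus)
        (auto simp: has_real_derivative_iff_has_vector_derivative[symmetric])
    then show ?thesis by (simp add: diff_divide_distrib)
  qed
  have "((\<lambda>\<tau>. exp (a * \<tau>)) has_integral (1 - 0) / a) {..0}"
  proof (rule has_integral_atMost_limit)
    have "((\<lambda>c. (1 - exp (a * c)) / a) \<longlongrightarrow> (1 - 0) / a) at_bot"
      using \<open>0 < a\<close> by (intro tendsto_intros filterlim_compose[OF exp_at_bot]
        filterlim_tendsto_pos_mult_at_bot[OF tendsto_const]) (auto intro: filterlim_ident)
    then show "((\<lambda>c. integral {c..0} (\<lambda>\<tau>. exp (a * \<tau>))) \<longlongrightarrow> (1 - 0) / a) at_bot"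
      by (rule Lim_transform_eventually)
        (use eventually_le_at_bot[of 0] in eventually_elim, simp add: integral_unique[OF int])
  qed (use int in blast)
  then show ?thesis
    by (simp add: D_coeff_def D_integrand_def[abs_def] integral_unique flip: a_def)
qed

section \<open>Sublinear growth of Brownian paths\<close>

text \<open>A dyadic point of level j + 1 either belongs to level j or is one step to the right of
  such a point. Passing through the levels costs a geometric sum, and continuity extends the bound
  to all of the unit interval.\<close>

lemma dyadic_chaining:
  fixes f :: "real \<Rightarrow> real"
  assumes cont: "continuous_on {0..1} f" and "f 0 = 0" and q: "0 \<le> q" "q < 1" and "0 \<le> c"
    and inc: "\<And>j k. k < 2 ^ j \<Longrightarrow> \<bar>f (real (Suc k) / 2 ^ j) - f (real k / 2 ^ j)\<bar> \<le> c * q ^ j"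
    and s: "s \<in> {0..1}"
  shows "\<bar>f s\<bar> \<le> c / (1 - q)"
proof -
  have grid: "\<bar>f (real k / 2 ^ j)\<bar> \<le> c * (\<Sum>i\<le>j. q ^ i)" if "k \<le> 2 ^ j" for j k
    using that
  proof (induction j arbitrary: k)
    case 0
    then have "k = 0 \<or> k = 1" by auto
    then show ?case using inc[of 0 0] \<open>f 0 = 0\<close> \<open>0 \<le> c\<close> by auto
  next
    case (Suc j)
    show ?case
    proof (cases "even k")
      case True
      then obtain l where l: "k = 2 * l" by blast
      then have "\<bar>f (real k / 2 ^ Suc j)\<bar> \<le> c * (\<Sum>i\<le>j. q ^ i)"
        using Suc.IH[of l] Suc.prems by simp
      also have "\<dots> \<le> c * (\<Sum>i\<le>Suc j. q ^ i)"
        using \<open>0 \<le> c\<close> q by (intro mult_left_mono) auto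
      finally show ?thesis .
    next
      case False
      then obtain l where l: "k = Suc (2 * l)" by (auto elim: oddE)
      then have "\<bar>f (real (2 * l) / 2 ^ Suc j)\<bar> \<le> c * (\<Sum>i\<le>j. q ^ i)"
        using Suc.IH[of l] Suc.prems by simp
      moreover have "\<bar>f (real k / 2 ^ Suc j) - f (real (2 * l) / 2 ^ Suc j)\<bar> \<le> c * q ^ Suc j"
        unfolding l using Suc.prems l by (intro inc) simp
      ultimately show ?thesis by (simp add: distrib_left)
    qed
  qed
  \<comment> \<open>The largest level-j dyadic point not exceeding \<open>s\<close>.\<close>
  define u where "u j = real (nat \<lfloor>2 ^ j * s\<rfloor>) / 2 ^ j" for j :: nat
  have u: "s - (1/2) ^ j \<le> u j" "u j \<le> s" "0 \<le> u j" for j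
  proof -
    have "0 \<le> 2 ^ j * s" using s by simp
    then have fl: "real (nat \<lfloor>2 ^ j * s\<rfloor>) \<le> 2 ^ j * s" "2 ^ j * s - 1 \<le> real (nat \<lfloor>2 ^ j * s\<rfloor>)"
      by linarith+
    have "(2 ^ j * s - 1) / 2 ^ j \<le> u j"
      unfolding u_def by (rule divide_right_mono[OF fl(2)]) simp
    then show "s - (1/2) ^ j \<le> u j" by (simp add: diff_divide_distrib power_divide)
    show "u j \<le> s" "0 \<le> u j"
      using fl(1) by (simp_all add: u_def divide_le_eq mult.commute)
  qed
  have u_lim: "u \<longlonglongrightarrow> s"
  proof (rule tendsto_sandwich)
    have "(\<lambda>j. s - (1/2) ^ j) \<longlonglongrightarrow> s - 0"
      by (intro tendsto_intros LIMSEQ_power_zero) auto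
    then show "(\<lambda>j. s - (1/2) ^ j) \<longlonglongrightarrow> s" by simp
  qed (use u in auto)
  have "(\<lambda>j. f (u j)) \<longlonglongrightarrow> f s"
    using continuous_on_tendsto_compose[OF cont u_lim s] u s
    by (smt (verit, best) atLeastAtMost_iff always_eventually)
  then have "(\<lambda>j. \<bar>f (u j)\<bar>) \<longlonglongrightarrow> \<bar>f s\<bar>" by (rule tendsto_rabs)
  moreover have "\<bar>f (u j)\<bar> \<le> c / (1 - q)" for j
  proof -
    have "2 ^ j * s \<le> 2 ^ j" using s by (simp add: mult_left_le)
    then have "\<lfloor>2 ^ j * s\<rfloor> \<le> \<lfloor>(2::real) ^ j\<rfloor>" by (rule floor_mono)
    also have "\<lfloor>(2::real) ^ j\<rfloor> = 2 ^ j" by (metis floor_of_int of_int_numeral of_int_power)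
    finally have "nat \<lfloor>2 ^ j * s\<rfloor> \<le> 2 ^ j" by (simp add: nat_le_iff)
    then have "\<bar>f (u j)\<bar> \<le> c * (\<Sum>i\<le>j. q ^ i)" unfolding u_def by (rule grid)
    also have "(\<Sum>i\<le>j. q ^ i) \<le> (\<Sum>i. q ^ i)"
      using q by (intro sum_le_suminf) auto
    also have "\<dots> = 1 / (1 - q)" using q by (simp add: suminf_geometric)
    finally show ?thesis using \<open>0 \<le> c\<close> by (simp add: mult_left_mono)
  qed
  ultimately show ?thesis
    by (intro LIMSEQ_le_const2) auto
qed

text \<open>On the block between 16^l and 16^(l+1) the quotient is at most 8 C / 2^l, because
  8^(l+1) / 16^l = 8 / 2^l.\<close>

lemma block_growth_sublinear:
  fixes f :: "real \<Rightarrow> real"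
  assumes bound: "\<And>n t. 0 \<le> t \<Longrightarrow> t \<le> 16 ^ n \<Longrightarrow> \<bar>f t\<bar> \<le> C * 8 ^ n" and "0 \<le> C"
  shows "((\<lambda>t. f t / t) \<longlongrightarrow> 0) at_top"
proof (rule tendstoI)
  fix \<epsilon> :: real assume "0 < \<epsilon>"
  obtain n0 where n0: "16 * C / \<epsilon> < 2 ^ n0"
    using real_arch_pow[of 2 "16 * C / \<epsilon>"] by auto
  have "\<bar>f t / t\<bar> < \<epsilon>" if t: "16 ^ n0 \<le> t" for t
  proof -
    have "0 < t" using t by (smt (verit) zero_less_power)
    obtain k where "t < 16 ^ k" using real_arch_pow[of 16 t] by auto
    define n where "n = (LEAST k. t < 16 ^ k)"
    have n1: "t < 16 ^ n" unfolding n_def by (rule LeastI) fact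
    have "n0 < n"
    proof (rule ccontr)
      assume "\<not> n0 < n"
      then have "(16::real) ^ n \<le> 16 ^ n0" by (intro power_increasing) auto
      then show False using n1 t by linarith
    qed
    then obtain l where l: "n = Suc l" "n0 \<le> l" by (cases n) auto
    have "\<not> t < 16 ^ l" using not_less_Least[of l "\<lambda>k. t < 16 ^ k"] l n_def by auto
    then have tl: "16 ^ l \<le> t" by simp
    have "C * 16 < \<epsilon> * 2 ^ n0" using n0 \<open>0 < \<epsilon>\<close> by (simp add: field_simps)
    also have "\<dots> \<le> \<epsilon> * 2 ^ l" using l \<open>0 < \<epsilon>\<close> by (intro mult_left_mono power_increasing) auto
    finally have "C * 16 * 8 ^ l < \<epsilon> * 2 ^ l * 8 ^ l" by simp
    also have "\<epsilon> * 2 ^ l * 8 ^ l = \<epsilon> * 16 ^ l" by (simp flip: power_mult_distrib)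
    also have "\<dots> \<le> \<epsilon> * t" using tl \<open>0 < \<epsilon>\<close> by simp
    finally have "C * 16 * 8 ^ l < \<epsilon> * t" .
    moreover have "\<bar>f t\<bar> \<le> C * 8 ^ n" using n1 \<open>0 < t\<close> by (intro bound) auto
    moreover have "C * 8 ^ n \<le> C * 16 * 8 ^ l" using l \<open>0 \<le> C\<close> by simp
    ultimately have "\<bar>f t\<bar> < \<epsilon> * t" by linarith
    then show ?thesis using \<open>0 < t\<close> by (simp add: field_simps)
  qed
  then show "\<forall>\<^sub>F t in at_top. dist (f t / t) 0 < \<epsilon>"
    unfolding eventually_at_top_linorder by auto
qed

text \<open>A fourth-moment bound on the increments makes the weighted sum over all blocks
  \<open>[0, 16\<^sup>n]\<close> and all dyadic levels \<open>j\<close> integrable, hence finite almost surely; chaining then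
  bounds the path by a random multiple of \<open>8\<^sup>n\<close> on the \<open>n\<close>-th block.\<close>

lemma (in prob_space) AE_sublinear:
  fixes X :: "real \<Rightarrow> 'a \<Rightarrow> real"
  assumes meas [measurable]: "\<And>t. X t \<in> borel_measurable M"
    and zero: "\<And>w. w \<in> space M \<Longrightarrow> X 0 w = 0"
    and cont: "\<And>w. w \<in> space M \<Longrightarrow> continuous_on {0..} (\<lambda>t. X t w)"
    and moment: "\<And>s t. 0 \<le> s \<Longrightarrow> s < t \<Longrightarrow>
      (\<integral>\<^sup>+w. ennreal ((X t w - X s w) ^ 4) \<partial>M) \<le> ennreal (K * (t - s)\<^sup>2)"
    and "0 \<le> K"
  shows "AE w in M. ((\<lambda>t. X t w / t) \<longlongrightarrow> 0) at_top"
proof -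
  \<comment> \<open>Chaining needs q < 1. The 2^j increments of level j, each with moment of order
    4^-j and weight q^(-4j), sum to a multiple of (1 / (2 q^4))^j, so 2 q^4 > 1 is needed
    too.\<close>
  define q :: real where "q = 7 / 8"
  define \<Delta> where "\<Delta> n j k w = X (16 ^ n * (real (Suc k) / 2 ^ j)) w - X (16 ^ n * (real k / 2 ^ j)) w" for n j k w
  \<comment> \<open>The fourth power of the intended increment bound \<open>8 ^ n * q ^ j\<close>.
    Against the moment factor 16^(2n) it leaves the summable 16^-n.\<close>
  define a where "a n j = 16 ^ (3 * n) * q ^ (4 * j)" for n j :: nat
  have a_pos: "0 < a n j" for n j by (simp add: a_def q_def)
  define V where "V w = (\<Sum>n. \<Sum>j. \<Sum>k<2 ^ j. ennreal (\<Delta> n j k w ^ 4 / a n j))" for w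
  have [measurable]: "\<Delta> n j k \<in> borel_measurable M" for n j k
    unfolding \<Delta>_def by measurable
  have V_meas [measurable]: "V \<in> borel_measurable M"
    unfolding V_def by measurable
  have moment_term: "(\<integral>\<^sup>+w. ennreal (\<Delta> n j k w ^ 4 / a n j) \<partial>M) \<le> ennreal (K * (16 ^ n / 2 ^ j)\<^sup>2 / a n j)" for n j k
  proof -
    have eq: "16 ^ n * (real (Suc k) / 2 ^ j) - 16 ^ n * (real k / 2 ^ j) = 16 ^ n / 2 ^ j"
      by (simp add: field_simps)
    have "(\<integral>\<^sup>+w. ennreal (\<Delta> n j k w ^ 4 / a n j) \<partial>M) = (\<integral>\<^sup>+w. ennreal (1 / a n j) * ennreal (\<Delta> n j k w ^ 4) \<partial>M)"
      using a_pos[of n j] by (intro nn_integral_cong) (simp flip: ennreal_mult')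
    also have "\<dots> = ennreal (1 / a n j) * (\<integral>\<^sup>+w. ennreal (\<Delta> n j k w ^ 4) \<partial>M)"
      by (rule nn_integral_cmult) measurable
    also have "\<dots> \<le> ennreal (1 / a n j) * ennreal (K * (16 ^ n / 2 ^ j)\<^sup>2)"
      unfolding \<Delta>_def eq[symmetric] by (intro mult_left_mono moment) (auto simp: field_simps)
    also have "\<dots> = ennreal (K * (16 ^ n / 2 ^ j)\<^sup>2 / a n j)"
      using a_pos[of n j] \<open>0 \<le> K\<close> by (simp flip: ennreal_mult)
    finally show ?thesis .
  qed
  define r where "r = 1 / (2 * q ^ 4)"
  have r: "0 \<le> r" "r < 1" by (simp_all add: r_def q_def eval_nat_numeral)
  have level: "(\<Sum>k<(2::nat) ^ j. ennreal (K * (16 ^ n / 2 ^ j)\<^sup>2 / a n j)) = ennreal (K * (1/16) ^ n * r ^ j)" for n j :: nat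
  proof -
    have "(\<Sum>k<(2::nat) ^ j. K * (16 ^ n / 2 ^ j)\<^sup>2 / a n j) = K * (1/16) ^ n * r ^ j"
    proof -
      have "(\<Sum>k<(2::nat) ^ j. K * (16 ^ n / 2 ^ j)\<^sup>2 / a n j) = 2 ^ j * (K * (16 ^ n / 2 ^ j)\<^sup>2 / a n j)"
        by simp
      also have "\<dots> = K * ((16 ^ n)\<^sup>2 / 16 ^ (3 * n)) * (2 ^ j / (2 ^ j)\<^sup>2 / q ^ (4 * j))"
        by (simp add: a_def power_divide mult_ac)
      also have "(16 ^ n)\<^sup>2 / 16 ^ (3 * n) = (1/16 :: real) ^ n"
      proof -
        have "(16::real) ^ (3 * n) = (16 ^ n) ^ 3" by (simp only: power_mult mult.commute[of 3])
        then show ?thesis by (simp add: power_divide power2_eq_square power3_eq_cube)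
      qed
      also have "2 ^ j / (2 ^ j)\<^sup>2 / q ^ (4 * j) = r ^ j"
        unfolding r_def power_mult by (simp add: power_divide power_mult_distrib power2_eq_square)
      finally show ?thesis .
    qed
    moreover have "0 \<le> K * (16 ^ n / 2 ^ j)\<^sup>2 / a n j" using \<open>0 \<le> K\<close> a_pos[of n j] by simp
    ultimately show ?thesis by (simp only: sum_ennreal)
  qed
  have "(\<integral>\<^sup>+w. V w \<partial>M) = (\<Sum>n. \<Sum>j. \<Sum>k<2 ^ j. \<integral>\<^sup>+w. ennreal (\<Delta> n j k w ^ 4 / a n j) \<partial>M)"
    unfolding V_def by (simp add: nn_integral_suminf nn_integral_sum)
  also have "\<dots> \<le> (\<Sum>n. \<Sum>j. \<Sum>k<(2::nat) ^ j. ennreal (K * (16 ^ n / 2 ^ j)\<^sup>2 / a n j))"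
    by (intro suminf_le sum_mono moment_term summableI)
  also have "\<dots> = (\<Sum>n. \<Sum>j. ennreal (K * (1/16) ^ n * r ^ j))"
    by (simp only: level)
  also have "\<dots> = (\<Sum>n. ennreal (K * (1/16) ^ n * (1 / (1 - r))))"
  proof (intro suminf_cong suminf_ennreal_eq)
    fix n
    show "(\<lambda>j. K * (1/16) ^ n * r ^ j) sums (K * (1/16) ^ n * (1 / (1 - r)))"
      using r by (intro sums_mult geometric_sums) simp
  qed (use r \<open>0 \<le> K\<close> in simp)
  also have "\<dots> = ennreal (K * (1 / (1 - 1/16)) * (1 / (1 - r)))"
  proof (intro suminf_ennreal_eq)
    show "(\<lambda>n. K * (1/16) ^ n * (1 / (1 - r))) sums (K * (1 / (1 - 1/16)) * (1 / (1 - r)))"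
      by (intro sums_mult2 sums_mult geometric_sums) simp
  qed (use r \<open>0 \<le> K\<close> in simp)
  finally have "(\<integral>\<^sup>+w. V w \<partial>M) \<noteq> \<infinity>" by (auto simp: top_unique)
  then have "AE w in M. V w \<noteq> \<infinity>" by (intro nn_integral_PInf_AE) auto
  then show ?thesis
    using AE_space
  proof eventually_elim
    case (elim w)
    define v where "v = enn2real (V w)"
    have v: "V w = ennreal v" "0 \<le> v" using elim(1) by (auto simp: v_def less_top)
    \<comment> \<open>Being at least 1, \<open>U\<close> satisfies v \<le> U^4, so fourth roots can
      be compared without extracting one of \<open>v\<close>.\<close>
    define U where "U = max 1 v"
    have term_le: "\<Delta> n j k w ^ 4 \<le> v * a n j" if "k < 2 ^ j" for n j k
    proof -
      have "ennreal (\<Delta> n j k w ^ 4 / a n j) \<le> (\<Sum>k<2 ^ j. ennreal (\<Delta> n j k w ^ 4 / a n j))"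
        using that by (intro member_le_sum) auto
      also have "\<dots> \<le> (\<Sum>j. \<Sum>k<2 ^ j. ennreal (\<Delta> n j k w ^ 4 / a n j))"
        using sum_le_suminf[OF summableI, of "{j}" "\<lambda>j. \<Sum>k<2 ^ j. ennreal (\<Delta> n j k w ^ 4 / a n j)"] by simp
      also have "\<dots> \<le> V w"
        unfolding V_def
        using sum_le_suminf[OF summableI, of "{n}" "\<lambda>n. \<Sum>j. \<Sum>k<2 ^ j. ennreal (\<Delta> n j k w ^ 4 / a n j)"] by simp
      finally have "\<Delta> n j k w ^ 4 / a n j \<le> v" using v by simp
      then show ?thesis using a_pos[of n j] by (simp add: pos_divide_le_eq)
    qed
    have inc: "\<bar>\<Delta> n j k w\<bar> \<le> (U * 8 ^ n) * q ^ j" if "k < 2 ^ j" for n j k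
    proof -
      have "v \<le> U ^ 4"
      proof -
        have "v \<le> U ^ 1" by (simp add: U_def)
        also have "\<dots> \<le> U ^ 4" by (rule power_increasing) (auto simp: U_def)
        finally show ?thesis .
      qed
      then have "\<Delta> n j k w ^ 4 \<le> U ^ 4 * a n j"
        using term_le[OF that, of n] a_pos[of n j] by (meson less_imp_le mult_right_mono order_trans)
      also have "a n j = (8 ^ n * q ^ j) ^ 4"
      proof -
        have "((8::real) ^ n) ^ 4 = (8 ^ 4) ^ n" by (simp only: power_mult[symmetric] mult.commute)
        then have "(16::real) ^ (3 * n) = (8 ^ n) ^ 4" by (simp add: power_mult)
        moreover have "q ^ (4 * j) = (q ^ j) ^ 4" by (simp only: power_mult[symmetric] mult.commute)
        ultimately show ?thesis by (simp only: a_def power_mult_distrib)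
      qed
      finally have "\<bar>\<Delta> n j k w\<bar> ^ 4 \<le> ((U * 8 ^ n) * q ^ j) ^ 4"
        by (simp add: power_mult_distrib power_even_abs mult_ac)
      then show ?thesis
        by (rule power_le_imp_le_base[of _ 3, simplified]) (auto simp: U_def q_def)
    qed
    show ?case
    proof (rule block_growth_sublinear[where C = "U * 8"])
      fix n :: nat and t :: real assume t: "0 \<le> t" "t \<le> 16 ^ n"
      \<comment> \<open>Chaining is applied to the path rescaled from the block to the unit
        interval; 1 / (1 - q) = 8 explains the constant \<open>U * 8\<close>.\<close>
      have "\<bar>X (16 ^ n * (t / 16 ^ n)) w\<bar> \<le> (U * 8 ^ n) / (1 - q)"
      proof (rule dyadic_chaining[where f = "\<lambda>s. X (16 ^ n * s) w"])
        show "continuous_on {0..1} (\<lambda>s. X (16 ^ n * s) w)"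
          using elim(2) by (intro continuous_on_compose2[OF cont] continuous_intros) auto
        show "\<bar>X (16 ^ n * (real (Suc k) / 2 ^ j)) w - X (16 ^ n * (real k / 2 ^ j)) w\<bar> \<le> U * 8 ^ n * q ^ j"
          if "k < 2 ^ j" for j k
          using inc[OF that, of n] by (simp add: \<Delta>_def)
      qed (use t elim(2) in \<open>auto simp: zero q_def U_def\<close>)
      then show "\<bar>X t w\<bar> \<le> U * 8 * 8 ^ n" by (simp add: q_def)
    qed (simp add: U_def)
  qed
qed

lemma normal_fourth_moment:
  assumes D: "distributed M lborel Y (normal_density 0 (sqrt v))" and "0 < v"
  shows "(\<integral>\<^sup>+w. ennreal (Y w ^ 4) \<partial>M) = ennreal (3 * v\<^sup>2)"
proof -
  have hb: "has_bochner_integral lborel (\<lambda>x. normal_density 0 (sqrt v) x * x ^ 4) (3 * v\<^sup>2)"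
  proof -
    \<comment> \<open>The general even-moment formula for a centred normal variable, at order
      4.\<close>
    have eq: "fact (2 * 2) / ((2 / (sqrt v)\<^sup>2)\<^sup>2 * fact 2) = 3 * v\<^sup>2"
      using \<open>0 < v\<close> by (simp add: fact_numeral power_divide)
    have "(\<lambda>x. normal_density 0 (sqrt v) x * (x - 0) ^ (2 * 2)) = (\<lambda>x. normal_density 0 (sqrt v) x * x ^ 4)"
      by simp
    then show ?thesis
      using normal_moment_even[of "sqrt v" 0 2] \<open>0 < v\<close> unfolding eq by (simp only: real_sqrt_gt_zero)
  qed
  have "(\<integral>\<^sup>+w. ennreal (Y w ^ 4) \<partial>M) = (\<integral>\<^sup>+x. normal_density 0 (sqrt v) x * ennreal (x ^ 4) \<partial>lborel)"
    by (rule distributed_nn_integral[OF D, symmetric]) measurable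
  also have "\<dots> = (\<integral>\<^sup>+x. ennreal (normal_density 0 (sqrt v) x * x ^ 4) \<partial>lborel)"
    by (intro nn_integral_cong) (simp add: ennreal_mult')
  also have "\<dots> = ennreal (3 * v\<^sup>2)"
    using hb by (subst nn_integral_eq_integral) (auto simp: has_bochner_integral_iff)
  finally show ?thesis .
qed

text \<open>Negative times are treated by reflection: reversing time only changes the sign of an
  increment, which the fourth power does not see.\<close>

lemma two_sided_BM_sublinear:
  assumes "prob_space P" and BM: "two_sided_BM P X"
  shows "AE w in P. ((\<lambda>t. X t w / t) \<longlongrightarrow> 0) at_top \<and> ((\<lambda>t. X t w / t) \<longlongrightarrow> 0) at_bot"
proof -
  interpret prob_space P by fact
  have meas: "X t \<in> borel_measurable P" for t using BM by (simp add: two_sided_BM_def)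
  have zero: "X 0 w = 0" and cont: "continuous_on UNIV (\<lambda>t. X t w)" if "w \<in> space P" for w
    using BM that by (auto simp: two_sided_BM_def)
  have moment: "(\<integral>\<^sup>+w. ennreal ((X t w - X s w) ^ 4) \<partial>P) = ennreal (3 * (t - s)\<^sup>2)" if "s < t" for s t
    using BM that by (intro normal_fourth_moment) (auto simp: two_sided_BM_def)
  have "AE w in P. ((\<lambda>t. X t w / t) \<longlongrightarrow> 0) at_top"
    by (rule AE_sublinear[where K = 3]) (auto simp: meas zero moment intro: continuous_on_subset[OF cont])
  moreover have "AE w in P. ((\<lambda>t. X (- t) w / t) \<longlongrightarrow> 0) at_top"
  proof (rule AE_sublinear[where K = 3])
    show "(\<integral>\<^sup>+w. ennreal ((X (- t) w - X (- s) w) ^ 4) \<partial>P) \<le> ennreal (3 * (t - s)\<^sup>2)"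
      if "0 \<le> s" "s < t" for s t
      using moment[of "- t" "- s"] that power_even_abs[of 4 "X (- t) _ - X (- s) _"]
      by (simp add: power4_eq_xxxx algebra_simps power2_commute)
    show "continuous_on {0..} (\<lambda>t. X (- t) w)" if "w \<in> space P" for w
      using that by (intro continuous_on_compose2[OF cont] continuous_intros) auto
  qed (auto simp: meas zero)
  ultimately show ?thesis
  proof eventually_elim
    case (elim w)
    have "((\<lambda>t. - (X (- t) w / t)) \<longlongrightarrow> - 0) at_top"
      using elim(2) by (rule tendsto_minus)
    then have "((\<lambda>t. X t w / t) \<longlongrightarrow> 0) at_bot"
      by (simp add: filterlim_at_bot_mirror)
    then show ?case using elim(1) by simp
  qed
qed

text \<open>Expresses the limit by countably many conditions, as measurability of the set of
  sublinear paths requires. A violation at a real point would, by continuity, persist at a nearby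
  rational.\<close>

lemma tendsto_at_top_rational_iff:
  fixes g :: "real \<Rightarrow> real"
  assumes cont: "continuous_on {0<..} g"
  shows "(g \<longlongrightarrow> 0) at_top \<longleftrightarrow>
    (\<forall>k::nat. \<exists>n::nat. \<forall>r::rat. real n < of_rat r \<longrightarrow> \<bar>g (of_rat r)\<bar> \<le> 1 / real (Suc k))"
proof
  assume lim: "(g \<longlongrightarrow> 0) at_top"
  show "\<forall>k::nat. \<exists>n::nat. \<forall>r::rat. real n < of_rat r \<longrightarrow> \<bar>g (of_rat r)\<bar> \<le> 1 / real (Suc k)"
  proof
    fix k
    have "\<forall>\<^sub>F t in at_top. \<bar>g t\<bar> < 1 / real (Suc k)"
      using tendstoD[OF lim, of "1 / real (Suc k)"] by simp
    then obtain T where T: "\<And>t. T \<le> t \<Longrightarrow> \<bar>g t\<bar> < 1 / real (Suc k)"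
      by (auto simp: eventually_at_top_linorder)
    obtain n :: nat where "T < real n" using reals_Archimedean2 by blast
    then show "\<exists>n::nat. \<forall>r::rat. real n < of_rat r \<longrightarrow> \<bar>g (of_rat r)\<bar> \<le> 1 / real (Suc k)"
      using T by (intro exI[of _ n]) (auto intro!: less_imp_le)
  qed
next
  assume bound: "\<forall>k::nat. \<exists>n::nat. \<forall>r::rat. real n < of_rat r \<longrightarrow> \<bar>g (of_rat r)\<bar> \<le> 1 / real (Suc k)"
  show "(g \<longlongrightarrow> 0) at_top"
  proof (rule tendstoI)
    fix \<epsilon> :: real assume "0 < \<epsilon>"
    then obtain k where k: "1 / real (Suc k) < \<epsilon>"
      using nat_approx_posE by metis
    obtain n :: nat where n: "\<And>r::rat. real n < of_rat r \<Longrightarrow> \<bar>g (of_rat r)\<bar> \<le> 1 / real (Suc k)"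
      using bound by blast
    have "\<bar>g t\<bar> \<le> 1 / real (Suc k)" if t: "real n < t" for t
    proof (rule ccontr)
      assume "\<not> ?thesis"
      then have "1 / real (Suc k) < \<bar>g t\<bar>" by simp
      moreover have "isCont g t"
        using cont t by (intro continuous_on_interior[OF cont]) (auto simp: interior_open)
      then have "((\<lambda>s. \<bar>g s\<bar>) \<longlongrightarrow> \<bar>g t\<bar>) (nhds t)"
        by (intro tendsto_rabs) (simp add: isCont_def tendsto_at_iff_tendsto_nhds)
      ultimately have "\<forall>\<^sub>F s in nhds t. 1 / real (Suc k) < \<bar>g s\<bar>"
        by (rule order_tendstoD(1)[rotated])
      then obtain d where d: "0 < d" "\<And>s. dist s t < d \<Longrightarrow> 1 / real (Suc k) < \<bar>g s\<bar>"
        by (auto simp: eventually_nhds_metric)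
      obtain x where x: "x \<in> \<rat>" "t < x" "x < t + d"
        using Rats_dense_in_real[of t "t + d"] d(1) by auto
      then obtain r where "x = of_rat r" by (auto elim: Rats_cases)
      then show False using n[of r] d(2)[of x] x t by (auto simp: dist_real_def)
    qed
    then show "\<forall>\<^sub>F t in at_top. dist (g t) 0 < \<epsilon>"
      using k unfolding eventually_at_top_dense by (intro exI[of _ "real n"]) force
  qed
qed

section \<open>The sublinear paths as a measurable, shift-invariant set of full measure\<close>

lemma C0_paths_continuous: "\<omega> \<in> C0_paths N \<Longrightarrow> continuous_on X (\<lambda>t. \<omega> t i)"
  by (rule continuous_on_subset[of UNIV]) (auto simp: C0_paths_def)

lemma sublinear_paths_rational:
  "sublinear_paths N = {\<omega>\<in>C0_paths N. \<forall>i\<in>{1..N}.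
    (\<forall>k::nat. \<exists>n::nat. \<forall>r::rat. real n < of_rat r \<longrightarrow> \<bar>\<omega> (of_rat r) i / of_rat r\<bar> \<le> 1 / real (Suc k)) \<and>
    (\<forall>k::nat. \<exists>n::nat. \<forall>r::rat. real n < of_rat r \<longrightarrow> \<bar>\<omega> (- of_rat r) i / - of_rat r\<bar> \<le> 1 / real (Suc k))}"
proof -
  have "((\<lambda>t. \<omega> t i / t) \<longlongrightarrow> 0) at_top \<longleftrightarrow>
      (\<forall>k::nat. \<exists>n::nat. \<forall>r::rat. real n < of_rat r \<longrightarrow> \<bar>\<omega> (of_rat r) i / of_rat r\<bar> \<le> 1 / real (Suc k))"
    "((\<lambda>t. \<omega> t i / t) \<longlongrightarrow> 0) at_bot \<longleftrightarrow>
      (\<forall>k::nat. \<exists>n::nat. \<forall>r::rat. real n < of_rat r \<longrightarrow> \<bar>\<omega> (- of_rat r) i / - of_rat r\<bar> \<le> 1 / real (Suc k))"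
    if "\<omega> \<in> C0_paths N" for \<omega> i
    unfolding filterlim_at_bot_mirror using C0_paths_continuous[OF that]
    by (intro tendsto_at_top_rational_iff continuous_intros
        continuous_on_compose2[OF C0_paths_continuous[OF that]]; auto)+
  then show ?thesis unfolding sublinear_paths_def by blast
qed

lemma sublinear_paths_full_measure:
  assumes W: "wiener_measure N P"
  shows "sublinear_paths N \<in> sets P" "measure P (sublinear_paths N) = 1"
proof -
  interpret prob_space P using W by (simp add: wiener_measure_def)
  have space: "space P = C0_paths N" using W by (simp add: wiener_measure_def)
  have BM: "two_sided_BM P (\<lambda>t \<omega>. \<omega> t i)" if "i \<in> {1..N}" for i
    using W that by (simp add: wiener_measure_def)
  then have [measurable]: "(\<lambda>\<omega>. \<omega> t i) \<in> borel_measurable P" if "i \<in> {1..N}" for t i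
    using that by (simp add: two_sided_BM_def)
  show sets: "sublinear_paths N \<in> sets P"
    unfolding sublinear_paths_rational space[symmetric] by measurable
  have "AE \<omega> in P. \<forall>i\<in>{1..N}. ((\<lambda>t. \<omega> t i / t) \<longlongrightarrow> 0) at_top \<and> ((\<lambda>t. \<omega> t i / t) \<longlongrightarrow> 0) at_bot"
    by (intro AE_finite_allI two_sided_BM_sublinear BM prob_space_axioms) auto
  then have "AE \<omega> in P. \<omega> \<in> sublinear_paths N"
    using AE_space by eventually_elim (simp add: sublinear_paths_def space)
  then show "measure P (sublinear_paths N) = 1"
    using sets by (simp add: prob_eq_1)
qed

lemma sublinear_pathsD:
  assumes "\<omega> \<in> sublinear_paths N" "i \<in> {1..N}"
  shows "((\<lambda>s. \<omega> s i / s) \<longlongrightarrow> 0) at_top" "((\<lambda>s. \<omega> s i / s) \<longlongrightarrow> 0) at_bot"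
  using bspec[OF conjunct2[OF CollectD[OF assms(1)[unfolded sublinear_paths_def]]] assms(2)] by simp_all

text \<open>For the shifted path, (w(t+s) - w(t)) / s = w(t+s) / (t+s) * (1 + t/s) - w(t) / s. The
  limit is computed along an abstract filter, which serves both ends of the time axis.\<close>

lemma wiener_shift_sublinear:
  assumes "\<omega> \<in> sublinear_paths N"
  shows "wiener_shift t \<omega> \<in> sublinear_paths N"
proof -
  have C0: "\<omega> \<in> C0_paths N" using assms by (simp add: sublinear_paths_def)
  have lim: "((\<lambda>s. (\<omega> (t + s) i - \<omega> t i) / s) \<longlongrightarrow> 0) F"
    if F: "filterlim (\<lambda>s. t + s) F F" "((\<lambda>s. inverse s) \<longlongrightarrow> 0) F" "\<forall>\<^sub>F s in F. s \<noteq> 0 \<and> t + s \<noteq> 0"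
      and g: "((\<lambda>s. \<omega> s i / s) \<longlongrightarrow> 0) F" for F i
  proof (rule Lim_transform_eventually)
    have "((\<lambda>s. \<omega> (t + s) i / (t + s)) \<longlongrightarrow> 0) F"
      by (rule filterlim_compose[OF g F(1)])
    then have "((\<lambda>s. \<omega> (t + s) i / (t + s) * (1 + t * inverse s) - \<omega> t i * inverse s) \<longlongrightarrow>
        0 * (1 + t * 0) - \<omega> t i * 0) F"
      by (intro tendsto_intros F(2))
    then show "((\<lambda>s. \<omega> (t + s) i / (t + s) * (1 + t * inverse s) - \<omega> t i * inverse s) \<longlongrightarrow> 0) F"
      by simp
    show "\<forall>\<^sub>F s in F. \<omega> (t + s) i / (t + s) * (1 + t * inverse s) - \<omega> t i * inverse s =
        (\<omega> (t + s) i - \<omega> t i) / s"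
      using F(3)
    proof eventually_elim
      case (elim s)
      then have "1 + t * inverse s = (t + s) / s" by (simp add: field_simps)
      then have "\<omega> (t + s) i / (t + s) * (1 + t * inverse s) = \<omega> (t + s) i / s"
        using elim by simp
      then show ?case by (simp only: diff_divide_distrib divide_inverse[of "\<omega> t i"])
    qed
  qed
  have shift_inverse: "filterlim (\<lambda>s. t + s) at_top at_top" "filterlim (\<lambda>s. t + s) at_bot at_bot"
    "((\<lambda>s. inverse s) \<longlongrightarrow> (0::real)) at_top" "((\<lambda>s. inverse s) \<longlongrightarrow> (0::real)) at_bot"
    by real_asymp+
  have top: "\<forall>\<^sub>F s in at_top. s \<noteq> 0 \<and> t + s \<noteq> 0"
    using eventually_gt_at_top[of "max 0 (- t)"] by eventually_elim auto
  have bot: "\<forall>\<^sub>F s in at_bot. s \<noteq> 0 \<and> t + s \<noteq> 0"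
    using eventually_gt_at_bot[of "min 0 (- t)"] by eventually_elim auto
  have "wiener_shift t \<omega> \<in> C0_paths N"
  proof -
    have "continuous_on UNIV (\<lambda>s. \<omega> (t + s) i - \<omega> t i)" for i
      by (intro continuous_on_diff continuous_on_const
          continuous_on_compose2[OF C0_paths_continuous[OF C0, of UNIV i]] continuous_on_add continuous_on_id) simp
    then show ?thesis using C0 by (simp add: C0_paths_def wiener_shift_def)
  qed
  moreover have "((\<lambda>s. (\<omega> (t + s) i - \<omega> t i) / s) \<longlongrightarrow> 0) at_top" if "i \<in> {1..N}" for i
    by (rule lim[OF shift_inverse(1,3) top sublinear_pathsD(1)[OF assms that]])
  moreover have "((\<lambda>s. (\<omega> (t + s) i - \<omega> t i) / s) \<longlongrightarrow> 0) at_bot" if "i \<in> {1..N}" for i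
    by (rule lim[OF shift_inverse(2,4) bot sublinear_pathsD(2)[OF assms that]])
  ultimately show ?thesis
    by (simp add: sublinear_paths_def wiener_shift_def)
qed

lemma wiener_shift_image_sublinear: "wiener_shift t ` sublinear_paths N = sublinear_paths N"
proof
  show "wiener_shift t ` sublinear_paths N \<subseteq> sublinear_paths N"
    by (auto intro: wiener_shift_sublinear)
  show "sublinear_paths N \<subseteq> wiener_shift t ` sublinear_paths N"
  proof
    fix \<omega> assume \<omega>: "\<omega> \<in> sublinear_paths N"
    then have "\<omega> = wiener_shift t (wiener_shift (- t) \<omega>)"
      by (auto simp: wiener_shift_def sublinear_paths_def C0_paths_def fun_eq_iff)
    then show "\<omega> \<in> wiener_shift t ` sublinear_paths N"
      using wiener_shift_sublinear[OF \<omega>] by blast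
  qed
qed

section \<open>The backward-forward system\<close>

text \<open>The driving term \<open>g\<close> is merely continuous, so \<open>v\<close> need not be
  differentiable. Splitting off \<open>g\<close> leaves a differentiable function whose derivative
  is \<beta> v, and the fundamental theorem gives the integral equation.\<close>

lemma scalar_backward_equation:
  fixes g :: "real \<Rightarrow> real"
  assumes cont: "continuous_on {a..0} g" and s: "s \<in> {a..0}"
    and v: "\<And>s. v s = exp (s * \<beta>) * x + g s - \<beta> * integral {s..0} (\<lambda>\<tau>. exp ((s - \<tau>) * \<beta>) * g \<tau>)"
  shows "((\<lambda>r. \<beta> * v r) has_integral (x - v s + g s)) {s..0}"
proof -
  define G where "G r = integral {r..0} (\<lambda>\<tau>. exp (- \<tau> * \<beta>) * g \<tau>)" for r
  define F where "F r = exp (r * \<beta>) * (x - \<beta> * G r)" for r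
  have vF: "v r = F r + g r" for r
  proof -
    have "integral {r..0} (\<lambda>\<tau>. exp ((r - \<tau>) * \<beta>) * g \<tau>) = exp (r * \<beta>) * G r"
      unfolding G_def integral_mult_right[symmetric] mult.assoc[symmetric] exp_add[symmetric]
      by (simp add: left_diff_distrib)
    then show ?thesis by (simp add: v F_def algebra_simps)
  qed
  have cont': "continuous_on {s..0} (\<lambda>\<tau>. exp (- \<tau> * \<beta>) * g \<tau>)"
    using s by (intro continuous_intros continuous_on_subset[OF cont]) auto
  have "(F has_real_derivative \<beta> * v r) (at r within {s..0})" if r: "r \<in> {s..0}" for r
  proof -
    have "(G has_real_derivative - (exp (- r * \<beta>) * g r)) (at r within {s..0})"
      using integral_has_vector_derivative'[OF cont' r]
      unfolding G_def has_real_derivative_iff_has_vector_derivative .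
    then have "(F has_real_derivative \<beta> * F r + exp (r * \<beta>) * (\<beta> * (exp (- r * \<beta>) * g r))) (at r within {s..0})"
      unfolding F_def by (auto intro!: derivative_eq_intros simp: algebra_simps)
    also have "exp (r * \<beta>) * (\<beta> * (exp (- r * \<beta>) * g r)) = (exp (r * \<beta>) * exp (- r * \<beta>)) * (\<beta> * g r)"
      by simp
    also have "exp (r * \<beta>) * exp (- r * \<beta>) = 1"
      by (simp flip: exp_add)
    finally show ?thesis by (simp add: vF distrib_left)
  qed
  then have "((\<lambda>r. \<beta> * v r) has_integral (F 0 - F s)) {s..0}"
    using s by (intro fundamental_theorem_of_calculus)
      (auto simp: has_real_derivative_iff_has_vector_derivative[symmetric])
  moreover have "F 0 = x" by (simp add: F_def G_def)
  ultimately show ?thesis by (simp add: vF)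
qed

text \<open>The integrating factor makes \<open>exp (- \<beta> * r) * d r\<close> constant, and the
  equation at time 0 makes the constant zero.\<close>

lemma scalar_backward_unique:
  fixes d :: "real \<Rightarrow> real"
  assumes cont: "continuous_on {a..0} d"
    and eq: "\<And>s. s \<in> {a..0} \<Longrightarrow> d s = - integral {s..0} (\<lambda>r. \<beta> * d r)"
    and s: "s \<in> {a..0}"
  shows "d s = 0"
proof -
  have cont': "continuous_on {a..0} (\<lambda>r. \<beta> * d r)"
    by (intro continuous_intros cont)
  have deriv: "(d has_real_derivative \<beta> * d r) (at r within {a..0})" if r: "r \<in> {a..0}" for r
  proof -
    have "((\<lambda>s. - integral {s..0} (\<lambda>r. \<beta> * d r)) has_vector_derivative \<beta> * d r) (at r within {a..0})"
      using has_vector_derivative_minus[OF integral_has_vector_derivative'[OF cont' r]] by simp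
    then have "(d has_vector_derivative \<beta> * d r) (at r within {a..0})"
      by (rule has_vector_derivative_transform[OF r, rotated]) (rule eq)
    then show ?thesis by (simp add: has_real_derivative_iff_has_vector_derivative)
  qed
  have "((\<lambda>r. exp (- \<beta> * r) * d r) has_real_derivative 0) (at r within {a..0})" if r: "r \<in> {a..0}" for r
    using deriv[OF r] by (auto intro!: derivative_eq_intros simp: algebra_simps)
  then obtain c where c: "\<And>r. r \<in> {a..0} \<Longrightarrow> exp (- \<beta> * r) * d r = c"
    using has_field_derivative_zero_constant[of "{a..0}" "\<lambda>r. exp (- \<beta> * r) * d r"] by auto
  have "d 0 = 0" using eq[of 0] s by simp
  then have "exp (- \<beta> * s) * d s = 0" using c[OF s] c[of 0] s by auto
  then show ?thesis by simp
qed

context spectral_op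
begin

lemma inner_noise_path:
  assumes "\<And>i. i \<notin> {1..N} \<Longrightarrow> \<sigma> i = 0" "1 \<le> n"
  shows "inner (noise_path \<sigma> e N \<omega> t) (e n) = \<sigma> n * \<omega> t n"
  using assms by (simp add: noise_path_def inner_sum_left orth1 if_distrib cong: if_cong)

lemma noise_path_in_D: "noise_path \<sigma> e N \<omega> t \<in> D"
  unfolding noise_path_def
  by (intro subspace_sum[OF subspace_D] subspace_scale[OF subspace_D]) (simp add: eigen)

lemma Lc_power:
  assumes "x \<in> Hc e m"
  shows "(Lc L e m ^^ k) x = (\<Sum>i=1..m. (b i ^ k * inner x (e i)) *\<^sub>R e i)"
proof (induction k)
  case 0
  show ?case
    using assms by (intro vec_eqI1) (simp add: inner_sum_left orth1 mem_Hc if_distrib cong: if_cong)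
next
  case (Suc k)
  let ?y = "\<Sum>i=1..m. (b i ^ k * inner x (e i)) *\<^sub>R e i"
  have "?y \<in> D"
    by (intro subspace_sum[OF subspace_D] subspace_scale[OF subspace_D]) (simp add: eigen)
  then show ?case
    unfolding funpow.simps comp_apply Suc.IH
    by (intro vec_eqI1) (simp add: Lc_def inner_Pc inner_L inner_sum_left orth1 if_distrib cong: if_cong)
qed

lemma exp_Lc_eq:
  assumes "x \<in> Hc e m"
  shows "exp_Lc L e m t x = (\<Sum>i=1..m. (exp (t * b i) * inner x (e i)) *\<^sub>R e i)"
proof -
  have "(\<lambda>k. (t ^ k / fact k) *\<^sub>R ((Lc L e m ^^ k) x)) sums (\<Sum>i=1..m. (exp (t * b i) * inner x (e i)) *\<^sub>R e i)"
  proof -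
    have "(\<lambda>k. ((t * b i) ^ k /\<^sub>R fact k * inner x (e i)) *\<^sub>R e i) sums ((exp (t * b i) * inner x (e i)) *\<^sub>R e i)" for i
      by (intro sums_scaleR_left sums_mult2 exp_converges)
    then have "(\<lambda>k. \<Sum>i=1..m. ((t * b i) ^ k /\<^sub>R fact k * inner x (e i)) *\<^sub>R e i) sums
        (\<Sum>i=1..m. (exp (t * b i) * inner x (e i)) *\<^sub>R e i)"
      by (rule sums_sum)
    then show ?thesis
      unfolding Lc_power[OF assms] scaleR_sum_right
      by (simp add: power_mult_distrib divide_inverse mult_ac)
  qed
  then show ?thesis unfolding exp_Lc_def by (rule sums_unique[symmetric])
qed

end

text \<open>\<open>discrete\<close> is the form in which the compact embedding enters, and
  \<open>X\<close> is the space on which \<open>B\<close> is bilinear. The three non-resonance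
  conditions share one support condition and are therefore stated together.\<close>

locale backward_forward = stable_op e D L b m + driving_path \<omega> b \<sigma>
  for e :: "nat \<Rightarrow> 'h::{real_inner,banach}" and D L b m \<omega> \<sigma> +
  fixes N :: nat and B :: "'h \<Rightarrow> 'h \<Rightarrow> 'h" and X :: "'h set"
  assumes sigma_off: "\<And>i. i \<notin> {1..N} \<Longrightarrow> \<sigma> i = 0"
    and path_zero: "\<And>i. \<omega> 0 i = 0"
    and discrete: "\<And>C. finite {n. 1 \<le> n \<and> \<bar>b n\<bar> \<le> C}"
    and bilinear: "\<And>x. x \<in> X \<Longrightarrow> linear_op X (B x) \<and> linear_op X (\<lambda>y. B y x)"
    and eigenvectors_in_X: "\<And>i. 1 \<le> i \<Longrightarrow> e i \<in> X"
    and nonresonance: "\<And>i1 i2 n. \<lbrakk>i1 \<in> {1..m}; i2 \<in> {1..m}; m < n; inner (B (e i1) (e i2)) (e n) \<noteq> 0\<rbrakk> \<Longrightarrow>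
      0 < b i1 + b i2 - b n \<and> (\<sigma> i1 \<noteq> 0 \<longrightarrow> 0 < b i2 - b n) \<and> (\<sigma> i2 \<noteq> 0 \<longrightarrow> 0 < b i1 - b n)"
begin

abbreviation W :: "real \<Rightarrow> 'h" where "W \<equiv> noise_path \<sigma> e N \<omega>"

lemma inner_W: "1 \<le> n \<Longrightarrow> inner (W t) (e n) = \<sigma> n * \<omega> t n"
  by (rule inner_noise_path[OF sigma_off])

lemma W_zero: "W 0 = 0"
  by (simp add: noise_path_def path_zero)

lemma Pc_W: "Pc e m (W s) = (\<Sum>i=1..m. (\<sigma> i * \<omega> s i) *\<^sub>R e i)"
  unfolding Pc_def by (intro sum.cong) (auto simp: inner_W)

section \<open>The backward equation in the critical modes\<close>

definition uc_coord :: "'h \<Rightarrow> nat \<Rightarrow> real \<Rightarrow> real" where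
  "uc_coord \<xi> i = center_coord (inner \<xi> (e i)) i"

lemma continuous_uc_coord: "continuous_on {..0} (uc_coord \<xi> i)"
  unfolding uc_coord_def by (rule continuous_center_coord)

lemma uc_eq:
  assumes "\<xi> \<in> Hc e m"
  shows "uc L e m W \<xi> s = (\<Sum>i=1..m. uc_coord \<xi> i s *\<^sub>R e i)"
proof -
  have "exp_Lc L e m (s - \<tau>) (Lc L e m (Pc e m (W \<tau>))) =
      (\<Sum>i=1..m. (\<sigma> i * b i * (exp ((s - \<tau>) * b i) * \<omega> \<tau> i)) *\<^sub>R e i)" for \<tau>
  proof -
    have P: "Pc e m (W \<tau>) \<in> Hc e m" by (simp add: mem_Hc inner_Pc)
    have LP: "Lc L e m (Pc e m (W \<tau>)) \<in> Hc e m" by (simp add: mem_Hc Lc_def inner_Pc)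
    have "inner (Lc L e m (Pc e m (W \<tau>))) (e i) = b i * (\<sigma> i * \<omega> \<tau> i)" if "i \<in> {1..m}" for i
      using that subsetD[OF Hc_subset_D P] by (simp add: Lc_def inner_Pc inner_L inner_W)
    then show ?thesis
      unfolding exp_Lc_eq[OF LP] by (intro sum.cong) (simp_all add: mult_ac)
  qed
  moreover have "((\<lambda>\<tau>. \<Sum>i=1..m. (\<sigma> i * b i * (exp ((s - \<tau>) * b i) * \<omega> \<tau> i)) *\<^sub>R e i) has_integral
      (\<Sum>i=1..m. (\<sigma> i * b i * conv b \<omega> i s) *\<^sub>R e i)) {s..0}"
    unfolding conv_def
    by (intro has_integral_sum has_integral_scaleR_left has_integral_mult_right integrable_integral
      integrable_continuous_interval conv_integrand_continuous path_continuous) simp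
  ultimately have "integral {s..0} (\<lambda>\<tau>. exp_Lc L e m (s - \<tau>) (Lc L e m (Pc e m (W \<tau>)))) =
      (\<Sum>i=1..m. (\<sigma> i * b i * conv b \<omega> i s) *\<^sub>R e i)"
    by (simp add: integral_unique)
  then show ?thesis
    unfolding uc_def exp_Lc_eq[OF assms] Pc_W
    by (simp add: uc_coord_def center_coord_def scaleR_add_left scaleR_diff_left sum.distrib sum_subtractf)
qed

lemma inner_uc:
  assumes "\<xi> \<in> Hc e m" "i \<in> {1..m}"
  shows "inner (uc L e m W \<xi> s) (e i) = uc_coord \<xi> i s"
  using assms(2) by (simp add: uc_eq[OF assms(1)] inner_sum_left orth1 if_distrib cong: if_cong)

lemma uc_in_Hc: "\<xi> \<in> Hc e m \<Longrightarrow> uc L e m W \<xi> s \<in> Hc e m"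
  by (simp add: mem_Hc uc_eq inner_sum_left orth1 if_distrib cong: if_cong)

lemma continuous_uc: "\<xi> \<in> Hc e m \<Longrightarrow> continuous_on {..0} (uc L e m W \<xi>)"
  by (simp only: uc_eq cong: continuous_on_cong) (intro continuous_intros continuous_uc_coord)

text \<open>\<open>L\<close> itself may be unbounded, but on \<open>Hc e m\<close> it is a finite
  sum of eigenvalue terms.\<close>

lemma continuous_Lc:
  assumes "continuous_on T u" "u ` T \<subseteq> Hc e m"
  shows "continuous_on T (\<lambda>r. Lc L e m (u r))"
proof -
  have "continuous_on T (\<lambda>r. \<Sum>i=1..m. (b i * inner (u r) (e i)) *\<^sub>R e i)"
    by (intro continuous_intros assms(1))
  moreover have "(\<Sum>i=1..m. (b i * inner (u r) (e i)) *\<^sub>R e i) = Lc L e m (u r)" if "r \<in> T" for r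
    using Lc_power[of "u r" m 1] assms(2) that by auto
  ultimately show ?thesis by (simp cong: continuous_on_cong)
qed

lemma inner_Lc: "x \<in> Hc e m \<Longrightarrow> i \<in> {1..m} \<Longrightarrow> inner (Lc L e m x) (e i) = b i * inner x (e i)"
  using Hc_subset_D[of m] by (auto simp: Lc_def inner_Pc inner_L)

lemma inner_integral_Lc:
  fixes u :: "real \<Rightarrow> 'h"
  assumes "continuous_on {a..0} u" "u ` {a..0} \<subseteq> Hc e m" "s \<in> {a..0}" "i \<in> {1..m}"
  shows "inner (integral {s..0} (\<lambda>r. Lc L e m (u r))) (e i) = integral {s..0} (\<lambda>r. b i * inner (u r) (e i))"
proof -
  have "continuous_on {s..0} (\<lambda>r. Lc L e m (u r))"
    using assms by (intro continuous_Lc continuous_on_subset[OF assms(1)]) (auto simp: image_subset_iff)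
  then have "((\<lambda>r. Lc L e m (u r)) has_integral integral {s..0} (\<lambda>r. Lc L e m (u r))) {s..0}"
    by (intro integrable_integral integrable_continuous_interval)
  from has_integral_linear[OF this bounded_linear_inner_left, of "e i"]
  have "((\<lambda>r. inner (Lc L e m (u r)) (e i)) has_integral inner (integral {s..0} (\<lambda>r. Lc L e m (u r))) (e i)) {s..0}"
    by (simp add: o_def)
  then have "((\<lambda>r. b i * inner (u r) (e i)) has_integral inner (integral {s..0} (\<lambda>r. Lc L e m (u r))) (e i)) {s..0}"
  proof (rule has_integral_eq[rotated])
    fix t assume "t \<in> {s..0}"
    then have "u t \<in> Hc e m" using assms(2,3) by (auto simp: image_subset_iff)
    then show "inner (Lc L e m (u t)) (e i) = b i * inner (u t) (e i)" by (rule inner_Lc[OF _ assms(4)])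
  qed
  then show ?thesis by (rule integral_unique[symmetric])
qed

lemma integral_Lc_in_Hc:
  fixes u :: "real \<Rightarrow> 'h"
  assumes "continuous_on {a..0} u" "u ` {a..0} \<subseteq> Hc e m" "s \<in> {a..0}"
  shows "integral {s..0} (\<lambda>r. Lc L e m (u r)) \<in> Hc e m"
  unfolding mem_Hc
proof (intro allI impI)
  fix n assume "m < n"
  have "continuous_on {s..0} (\<lambda>r. Lc L e m (u r))"
    using assms by (intro continuous_Lc continuous_on_subset[OF assms(1)]) (auto simp: image_subset_iff)
  then have "((\<lambda>r. Lc L e m (u r)) has_integral integral {s..0} (\<lambda>r. Lc L e m (u r))) {s..0}"
    by (intro integrable_integral integrable_continuous_interval)
  from has_integral_linear[OF this bounded_linear_inner_left, of "e n"]
  have "((\<lambda>r. 0) has_integral inner (integral {s..0} (\<lambda>r. Lc L e m (u r))) (e n)) {s..0}"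
    using \<open>m < n\<close> by (simp add: o_def Lc_def inner_Pc)
  then show "inner (integral {s..0} (\<lambda>r. Lc L e m (u r))) (e n) = 0"
    by (simp add: has_integral_is_0 has_integral_unique[OF _ has_integral_0])
qed

lemma uc_integral_equation:
  assumes xi: "\<xi> \<in> Hc e m" and i: "i \<in> {1..m}" and s: "s \<le> 0"
  shows "((\<lambda>r. b i * uc_coord \<xi> i r) has_integral (inner \<xi> (e i) - uc_coord \<xi> i s + \<sigma> i * \<omega> s i)) {s..0}"
proof (rule scalar_backward_equation)
  show "continuous_on {s..0} (\<lambda>r. \<sigma> i * \<omega> r i)"
    by (intro continuous_intros path_continuous')
  show "uc_coord \<xi> i r = exp (r * b i) * inner \<xi> (e i) + \<sigma> i * \<omega> r i -
      b i * integral {r..0} (\<lambda>\<tau>. exp ((r - \<tau>) * b i) * (\<sigma> i * \<omega> \<tau> i))" for r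
    by (simp add: uc_coord_def center_coord_def conv_def mult.left_commute[of _ "\<sigma> i"])
qed (use s in simp)

text \<open>Coordinatewise, the difference of a solution and the explicit formula solves the
  homogeneous scalar equation and vanishes. Conversely the formula solves each scalar equation,
  while all modes above \<open>m\<close> are zero on both sides.\<close>

lemma backward_solution_iff:
  assumes xi: "\<xi> \<in> Hc e m" and "0 < T"
  shows "backward_solution L e m W T \<xi> u \<longleftrightarrow> (\<forall>s\<in>{-T..0}. u s = uc L e m W \<xi> s)"
proof
  assume u: "backward_solution L e m W T \<xi> u"
  then have cont: "continuous_on {-T..0} u" and img: "u ` {-T..0} \<subseteq> Hc e m"
    and eq: "\<And>s. s \<in> {-T..0} \<Longrightarrow> \<xi> - u s = integral {s..0} (\<lambda>r. Lc L e m (u r)) - Pc e m (W s)"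
    by (auto simp: backward_solution_def W_zero Pc_def)
  show "\<forall>s\<in>{-T..0}. u s = uc L e m W \<xi> s"
  proof
    fix s assume s: "s \<in> {-T..0}"
    have "inner (u s) (e i) = uc_coord \<xi> i s" if i: "i \<in> {1..m}" for i
    proof -
      have "inner (u s) (e i) - uc_coord \<xi> i s = 0"
      proof (rule scalar_backward_unique[OF _ _ s])
        show "continuous_on {-T..0} (\<lambda>s. inner (u s) (e i) - uc_coord \<xi> i s)"
          by (intro continuous_intros cont continuous_on_subset[OF continuous_uc_coord]) auto
        fix r assume r: "r \<in> {-T..0}"
        have cont_r: "continuous_on {r..0} u" using r by (intro continuous_on_subset[OF cont]) auto
        have "inner \<xi> (e i) - inner (u r) (e i) =
            inner (integral {r..0} (\<lambda>t. Lc L e m (u t)) - Pc e m (W r)) (e i)"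
          by (simp add: eq[OF r, symmetric] inner_diff_left)
        also have "\<dots> = integral {r..0} (\<lambda>t. b i * inner (u t) (e i)) - \<sigma> i * \<omega> r i"
          unfolding inner_diff_left inner_integral_Lc[OF cont img r i] using i by (simp add: inner_Pc inner_W)
        finally have 1: "integral {r..0} (\<lambda>t. b i * inner (u t) (e i)) =
            inner \<xi> (e i) - inner (u r) (e i) + \<sigma> i * \<omega> r i" by simp
        have "integral {r..0} (\<lambda>t. b i * (inner (u t) (e i) - uc_coord \<xi> i t)) =
            integral {r..0} (\<lambda>t. b i * inner (u t) (e i)) - integral {r..0} (\<lambda>t. b i * uc_coord \<xi> i t)"
          unfolding right_diff_distrib
          by (intro integral_diff integrable_continuous_interval continuous_intros cont_r
            continuous_on_subset[OF continuous_uc_coord]) auto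
        then show "inner (u r) (e i) - uc_coord \<xi> i r =
            - integral {r..0} (\<lambda>t. b i * (inner (u t) (e i) - uc_coord \<xi> i t))"
          using 1 integral_unique[OF uc_integral_equation[OF xi i, of r]] r by simp
      qed
      then show ?thesis by simp
    qed
    moreover have "u s \<in> Hc e m" using img s by blast
    ultimately show "u s = uc L e m W \<xi> s"
      using uc_in_Hc[OF xi, of s] by (intro vec_eqI1) (metis inner_uc[OF xi] mem_Hc atLeastAtMost_iff not_le)
  qed
next
  assume u: "\<forall>s\<in>{-T..0}. u s = uc L e m W \<xi> s"
  have cont: "continuous_on {-T..0} u"
    by (rule continuous_on_eq[OF continuous_on_subset[OF continuous_uc[OF xi]]]) (use u in auto)
  have img: "u ` {-T..0} \<subseteq> Hc e m" using u uc_in_Hc[OF xi] by auto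
  have u0: "u 0 = \<xi>"
  proof (rule vec_eqI1)
    fix n :: nat assume "1 \<le> n"
    have "u 0 \<in> Hc e m" using img \<open>0 < T\<close> by auto
    then show "inner (u 0) (e n) = inner \<xi> (e n)"
      using xi u \<open>0 < T\<close> \<open>1 \<le> n\<close> inner_uc[OF xi, of n 0]
      by (cases "n \<le> m") (auto simp: mem_Hc uc_coord_def center_coord_def path_zero conv_def)
  qed
  have "\<xi> - u s = integral {s..0} (\<lambda>r. Lc L e m (u r)) + (Pc e m (W 0) - Pc e m (W s))"
    if s: "s \<in> {-T..0}" for s
  proof (rule vec_eqI1)
    fix n :: nat assume n: "1 \<le> n"
    show "inner (\<xi> - u s) (e n) = inner (integral {s..0} (\<lambda>r. Lc L e m (u r)) + (Pc e m (W 0) - Pc e m (W s))) (e n)"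
    proof (cases "n \<le> m")
      case True
      then have n: "n \<in> {1..m}" using n by simp
      have "integral {s..0} (\<lambda>r. b n * inner (u r) (e n)) = integral {s..0} (\<lambda>r. b n * uc_coord \<xi> n r)"
        using u s n by (intro integral_cong) (auto simp: inner_uc[OF xi])
      also have "\<dots> = inner \<xi> (e n) - uc_coord \<xi> n s + \<sigma> n * \<omega> s n"
        using s by (intro integral_unique uc_integral_equation[OF xi n]) simp
      finally show ?thesis
        using u s n unfolding inner_add_left inner_integral_Lc[OF cont img s n]
        by (simp add: inner_diff_left W_zero inner_Pc inner_W inner_uc[OF xi n])
    next
      case False
      then show ?thesis
        using integral_Lc_in_Hc[OF cont img s] img s xi n
        by (auto simp: mem_Hc inner_add_left inner_diff_left inner_Pc image_subset_iff)
    qed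
  qed
  then show "backward_solution L e m W T \<xi> u"
    unfolding backward_solution_def using cont img u0 by blast
qed

section \<open>The noise contribution\<close>

lemma Ps_W_in_D: "Ps e m (W \<tau>) \<in> D"
  unfolding Ps_def using Hc_subset_D[of m]
  by (intro subspace_diff[OF subspace_D] noise_path_in_D) (auto simp: mem_Hc inner_Pc)

lemma Ps_in_Hs: "Ps e m x \<in> Hs e m"
  by (simp add: Hs_def)

lemma inner_exp_Ls:
  "0 \<le> t \<Longrightarrow> x \<in> Hs e m \<Longrightarrow> 1 \<le> n \<Longrightarrow> inner (exp_Ls D L e m t x) (e n) = exp (t * b n) * inner x (e n)"
  unfolding exp_Ls_eq by (rule inner_semigroup)

text \<open>Beyond \<open>N\<close> the right-hand side vanishes with the amplitude, so the upper
  summation bound disappears in coordinates. This includes the case of an empty sum, N \<le>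
  m.\<close>

lemma inner_stable_sum:
  "1 \<le> n \<Longrightarrow> inner (\<Sum>k=m+1..N. (\<sigma> k * c k) *\<^sub>R e k) (e n) = (if n \<le> m then 0 else \<sigma> n * c n)"
  by (auto simp: inner_sum_left orth1 sigma_off if_distrib cong: if_cong)

lemma h_noise_integrand_eq:
  assumes "\<tau> \<le> 0"
  shows "h_noise_integrand D L e m W \<tau> = (\<Sum>n=m+1..N. (\<sigma> n * (b n * Z_integrand b \<omega> n \<tau>)) *\<^sub>R e n)"
proof (rule vec_eqI1)
  fix n :: nat assume n: "1 \<le> n"
  note P = Ps_W_in_D[of \<tau>] Ps_in_Hs[of "W \<tau>"]
  have "inner (h_noise_integrand D L e m W \<tau>) (e n) = exp (- \<tau> * b n) * (b n * inner (Ps e m (W \<tau>)) (e n))"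
    unfolding h_noise_integrand_def Ls_eq[OF P]
    using assms n L_in_Hs[OF P] P by (simp add: inner_exp_Ls inner_L)
  then show "inner (h_noise_integrand D L e m W \<tau>) (e n) =
      inner (\<Sum>n=m+1..N. (\<sigma> n * (b n * Z_integrand b \<omega> n \<tau>)) *\<^sub>R e n) (e n)"
    unfolding inner_stable_sum[OF n] using n by (simp add: inner_Ps inner_W Z_integrand_def)
qed

lemma Z_integrand_decaying: "m < n \<Longrightarrow> exp_decaying (Z_integrand b \<omega> n)"
  using growth_rate_decaying[OF growth_rate_mult[OF growth_rate_exp path_growth], of "- b n" n] stable[of n]
  by (simp add: Z_integrand_def[abs_def] mult.commute)

lemma continuous_Z_integrand: "continuous_on T (Z_integrand b \<omega> n)"
  unfolding Z_integrand_def by (intro continuous_intros path_continuous')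

lemma Z_integrand_integrable: "m < n \<Longrightarrow> Z_integrand b \<omega> n integrable_on {..0}"
  by (intro exp_decaying_integrable continuous_Z_integrand Z_integrand_decaying)

lemma has_integral_noise:
  "(h_noise_integrand D L e m W has_integral (\<Sum>n=m+1..N. Z_coeff b \<sigma> \<omega> n *\<^sub>R e n)) {..0}"
proof -
  have "((\<lambda>\<tau>. \<Sum>n=m+1..N. (\<sigma> n * (b n * Z_integrand b \<omega> n \<tau>)) *\<^sub>R e n) has_integral
      (\<Sum>n=m+1..N. (\<sigma> n * (b n * integral {..0} (Z_integrand b \<omega> n))) *\<^sub>R e n)) {..0}"
    by (intro has_integral_sum has_integral_scaleR_left has_integral_mult_right integrable_integral
      Z_integrand_integrable) auto
  then have "(h_noise_integrand D L e m W has_integral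
      (\<Sum>n=m+1..N. (\<sigma> n * (b n * integral {..0} (Z_integrand b \<omega> n))) *\<^sub>R e n)) {..0}"
    by (rule has_integral_eq[rotated]) (simp add: h_noise_integrand_eq)
  then show ?thesis by (simp add: Z_coeff_def mult.assoc)
qed

lemma noise_limit:
  "((\<lambda>a. integral {a..0} (h_noise_integrand D L e m W)) \<longlongrightarrow> (\<Sum>n=m+1..N. Z_coeff b \<sigma> \<omega> n *\<^sub>R e n)) at_bot"
proof (rule Lim_transform_eventually)
  have "((\<lambda>a. \<Sum>n=m+1..N. (\<sigma> n * (b n * integral {a..0} (Z_integrand b \<omega> n))) *\<^sub>R e n) \<longlongrightarrow>
      (\<Sum>n=m+1..N. (\<sigma> n * (b n * integral {..0} (Z_integrand b \<omega> n))) *\<^sub>R e n)) at_bot"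
  proof (intro tendsto_intros)
    fix n assume "n \<in> {m+1..N}"
    then obtain C \<delta> where "0 < \<delta>" "\<forall>\<tau>\<le>0. \<bar>Z_integrand b \<omega> n \<tau>\<bar> \<le> C * exp (\<delta> * \<tau>)"
      using Z_integrand_decaying[of n] by (auto simp: exp_decaying_def)
    then show "((\<lambda>a. integral {a..0} (Z_integrand b \<omega> n)) \<longlongrightarrow> integral {..0} (Z_integrand b \<omega> n)) at_bot"
      by (intro exp_dominated_integral(2)[OF continuous_Z_integrand]) auto
  qed
  then show "((\<lambda>a. \<Sum>n=m+1..N. (\<sigma> n * (b n * integral {a..0} (Z_integrand b \<omega> n))) *\<^sub>R e n) \<longlongrightarrow>
      (\<Sum>n=m+1..N. Z_coeff b \<sigma> \<omega> n *\<^sub>R e n)) at_bot"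
    by (simp add: Z_coeff_def mult.assoc)
  have "integral {a..0} (h_noise_integrand D L e m W) =
      (\<Sum>n=m+1..N. (\<sigma> n * (b n * integral {a..0} (Z_integrand b \<omega> n))) *\<^sub>R e n)" for a
  proof (rule integral_unique)
    have "((\<lambda>\<tau>. \<Sum>n=m+1..N. (\<sigma> n * (b n * Z_integrand b \<omega> n \<tau>)) *\<^sub>R e n) has_integral
        (\<Sum>n=m+1..N. (\<sigma> n * (b n * integral {a..0} (Z_integrand b \<omega> n))) *\<^sub>R e n)) {a..0}"
      by (intro has_integral_sum has_integral_scaleR_left has_integral_mult_right integrable_integral
        integrable_continuous_interval continuous_Z_integrand) auto
    then show "(h_noise_integrand D L e m W has_integral
        (\<Sum>n=m+1..N. (\<sigma> n * (b n * integral {a..0} (Z_integrand b \<omega> n))) *\<^sub>R e n)) {a..0}"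
      by (rule has_integral_eq[rotated]) (simp add: h_noise_integrand_eq)
  qed
  then show "\<forall>\<^sub>F a in at_bot. (\<Sum>n=m+1..N. (\<sigma> n * (b n * integral {a..0} (Z_integrand b \<omega> n))) *\<^sub>R e n) =
      integral {a..0} (h_noise_integrand D L e m W)" by simp
qed

section \<open>The nonlinear contribution, one pair of critical modes at a time\<close>

definition pair_integrand :: "'h \<Rightarrow> nat \<Rightarrow> nat \<Rightarrow> real \<Rightarrow> 'h" where
  "pair_integrand \<xi> i1 i2 \<tau> =
    (uc_coord \<xi> i1 \<tau> * uc_coord \<xi> i2 \<tau>) *\<^sub>R exp_Ls D L e m (- \<tau>) (Ps e m (B (e i1) (e i2)))"

lemma continuous_pair_integrand: "continuous_on {..0} (pair_integrand \<xi> i1 i2)"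
proof -
  have "continuous_on {..0} (\<lambda>\<tau>. spectral_semigroup (- \<tau>) (Ps e m (B (e i1) (e i2))))"
    by (rule continuous_on_compose2[OF continuous_semigroup[OF Ps_in_Hs]]) (auto intro: continuous_intros)
  then show ?thesis
    unfolding pair_integrand_def exp_Ls_eq by (intro continuous_intros continuous_uc_coord)
qed

text \<open>Since the eigenvalues accumulate only at \<open>- \<infinity>\<close>, the slowest decaying mode in the support
  of \<open>B(e\<^bsub>i1\<^esub>, e\<^bsub>i2\<^esub>)\<close> exists, and the non-resonance conditions at this single mode bound
  the whole integrand.\<close>

lemma pair_integrand_dominated:
  assumes i: "i1 \<in> {1..m}" "i2 \<in> {1..m}"
  shows "\<exists>C \<delta>. 0 < \<delta> \<and> (\<forall>\<tau>\<le>0. norm (pair_integrand \<xi> i1 i2 \<tau>) \<le> C * exp (\<delta> * \<tau>))"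
proof -
  define g where "g = Ps e m (B (e i1) (e i2))"
  have gH: "g \<in> Hs e m" by (simp add: g_def Ps_in_Hs)
  define S where "S = {n. m < n \<and> inner g (e n) \<noteq> 0}"
  show ?thesis
  proof (cases "S = {}")
    case True
    then have "inner g (e n) = inner 0 (e n)" if "1 \<le> n" for n
      using that gH by (cases "n \<le> m") (auto simp: S_def mem_Hs)
    then have "g = 0" by (rule vec_eqI1)
    moreover have "exp_Ls D L e m (- \<tau>) 0 = 0" if "\<tau> \<le> 0" for \<tau>
      using that by (intro vec_eqI1) (simp add: inner_exp_Ls subspace_0[OF subspace_Hs])
    ultimately show ?thesis
      by (intro exI[of _ 0] exI[of _ 1]) (simp add: pair_integrand_def flip: g_def)
  next
    case False
    then obtain n0 where n0: "n0 \<in> S" by blast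
    \<comment> \<open>Eigenvalues above \<open>m\<close> are negative, so those at least
      \<open>b n0\<close> have modulus at most that of \<open>b n0\<close>, and discreteness
      applies. The largest of them is the slowest rate in \<open>S\<close>.\<close>
    have "finite {n\<in>S. b n0 \<le> b n}"
    proof (rule finite_subset[OF _ discrete[of "\<bar>b n0\<bar>"]])
      show "{n\<in>S. b n0 \<le> b n} \<subseteq> {n. 1 \<le> n \<and> \<bar>b n\<bar> \<le> \<bar>b n0\<bar>}"
        using stable by (force simp: S_def)
    qed
    then have "finite (b ` {n\<in>S. b n0 \<le> b n})" "b ` {n\<in>S. b n0 \<le> b n} \<noteq> {}"
      using n0 by auto
    from Max_in[OF this] obtain k where k: "k \<in> S" "b k = Max (b ` {n\<in>S. b n0 \<le> b n})" "b n0 \<le> b k"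
      by auto
    have max: "b n \<le> b k" if "n \<in> S" for n
    proof (cases "b n0 \<le> b n")
      case True
      then show ?thesis
        using that \<open>finite (b ` {n\<in>S. b n0 \<le> b n})\<close> unfolding k(2) by (intro Max_ge) auto
    qed (use k(3) in simp)
    have "m < k" using k(1) by (simp add: S_def)
    moreover have "inner (B (e i1) (e i2)) (e k) \<noteq> 0"
      using k(1) \<open>m < k\<close> by (auto simp: S_def g_def inner_Ps split: if_splits)
    ultimately have "exp_decaying (\<lambda>\<tau>. exp (- \<tau> * b k) * (uc_coord \<xi> i1 \<tau> * uc_coord \<xi> i2 \<tau>))"
      unfolding uc_coord_def using nonresonance[OF i, of k] stable[of k]
      by (intro center_coord_product_decaying) auto
    then obtain C \<delta> where "0 < \<delta>" and
      C: "\<And>\<tau>. \<tau> \<le> 0 \<Longrightarrow> \<bar>exp (- \<tau> * b k) * (uc_coord \<xi> i1 \<tau> * uc_coord \<xi> i2 \<tau>)\<bar> \<le> C * exp (\<delta> * \<tau>)"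
      unfolding exp_decaying_def by blast
    have "norm (pair_integrand \<xi> i1 i2 \<tau>) \<le> (C * norm g) * exp (\<delta> * \<tau>)" if \<tau>: "\<tau> \<le> 0" for \<tau>
    proof -
      \<comment> \<open>On the support of \<open>g\<close> the slowest mode bounds every multiplier,
        and off the support the coordinates are 0; Parseval then bounds the norm.\<close>
      have "norm (exp_Ls D L e m (- \<tau>) g) \<le> exp (- \<tau> * b k) * norm g"
      proof (rule norm_le_coord)
        fix j
        show "\<bar>inner (exp_Ls D L e m (- \<tau>) g) (e (Suc j))\<bar> \<le> exp (- \<tau> * b k) * \<bar>inner g (e (Suc j))\<bar>"
        proof (cases "Suc j \<in> S")
          case True
          then have "- \<tau> * b (Suc j) \<le> - \<tau> * b k" using max \<tau> by (intro mult_left_mono) auto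
          then show ?thesis
            using \<tau> gH by (simp add: inner_exp_Ls abs_mult mult_right_mono)
        next
          case False
          then have "inner g (e (Suc j)) = 0"
            using gH by (cases "Suc j \<le> m") (auto simp: S_def mem_Hs)
          then show ?thesis using \<tau> gH by (simp add: inner_exp_Ls)
        qed
      qed simp
      then have "norm (pair_integrand \<xi> i1 i2 \<tau>) \<le>
          \<bar>uc_coord \<xi> i1 \<tau> * uc_coord \<xi> i2 \<tau>\<bar> * (exp (- \<tau> * b k) * norm g)"
        unfolding pair_integrand_def g_def[symmetric] norm_scaleR by (rule mult_left_mono) simp
      also have "\<dots> = \<bar>exp (- \<tau> * b k) * (uc_coord \<xi> i1 \<tau> * uc_coord \<xi> i2 \<tau>)\<bar> * norm g"
        by (simp add: abs_mult)
      also have "\<dots> \<le> (C * exp (\<delta> * \<tau>)) * norm g"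
        by (intro mult_right_mono C \<tau>) simp
      finally show ?thesis by (simp add: mult_ac)
    qed
    then show ?thesis using \<open>0 < \<delta>\<close> by blast
  qed
qed

lemma pair_integrand_integral:
  assumes i: "i1 \<in> {1..m}" "i2 \<in> {1..m}"
  shows "pair_integrand \<xi> i1 i2 integrable_on {..0}"
    "((\<lambda>a. integral {a..0} (pair_integrand \<xi> i1 i2)) \<longlongrightarrow> integral {..0} (pair_integrand \<xi> i1 i2)) at_bot"
  using pair_integrand_dominated[OF i, of \<xi>] exp_dominated_integral[OF continuous_pair_integrand[of \<xi> i1 i2]]
  by blast+

definition expansion_coeff :: "'h \<Rightarrow> nat \<Rightarrow> nat \<Rightarrow> nat \<Rightarrow> real" where
  "expansion_coeff \<xi> n i1 i2 = A_coeff b \<sigma> \<omega> n i1 i2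
     + B_coeff b \<sigma> \<omega> n i1 i2 * inner \<xi> (e i1)
     + C_coeff b \<sigma> \<omega> n i1 i2 * inner \<xi> (e i2)
     + D_coeff b n i1 i2 * inner \<xi> (e i1) * inner \<xi> (e i2)"

lemma inner_pair_integral:
  assumes i: "i1 \<in> {1..m}" "i2 \<in> {1..m}" and n: "1 \<le> n"
  shows "inner (integral {..0} (pair_integrand \<xi> i1 i2)) (e n) =
    (if n \<le> m then 0 else expansion_coeff \<xi> n i1 i2 * inner (B (e i1) (e i2)) (e n))"
proof -
  let ?g = "inner (Ps e m (B (e i1) (e i2))) (e n)"
  have "((\<lambda>\<tau>. inner (pair_integrand \<xi> i1 i2 \<tau>) (e n)) has_integral
      inner (integral {..0} (pair_integrand \<xi> i1 i2)) (e n)) {..0}"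
    using has_integral_linear[OF integrable_integral[OF pair_integrand_integral(1)[OF i]]
      bounded_linear_inner_left] by (simp add: o_def)
  then have 1: "((\<lambda>\<tau>. exp (- \<tau> * b n) * (uc_coord \<xi> i1 \<tau> * uc_coord \<xi> i2 \<tau>) * ?g) has_integral
      inner (integral {..0} (pair_integrand \<xi> i1 i2)) (e n)) {..0}"
    by (rule has_integral_eq[rotated]) (use n in \<open>simp add: pair_integrand_def inner_exp_Ls Ps_in_Hs\<close>)
  show ?thesis
  \<comment> \<open>For a mode that the nonlinearity does not meet, the scalar integral may diverge,
    but the factor 0 annihilates both sides. The modes up to \<open>m\<close> fall under this
    case.\<close>
  proof (cases "?g = 0")
    case True
    then have "inner (integral {..0} (pair_integrand \<xi> i1 i2)) (e n) = 0"
      using has_integral_unique[OF 1] by simp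
    then show ?thesis using True n by (simp add: inner_Ps split: if_splits)
  next
    case False
    then have n': "m < n" and g: "inner (B (e i1) (e i2)) (e n) \<noteq> 0" "?g = inner (B (e i1) (e i2)) (e n)"
      using n by (auto simp: inner_Ps split: if_splits)
    have "((\<lambda>\<tau>. exp (- \<tau> * b n) * (uc_coord \<xi> i1 \<tau> * uc_coord \<xi> i2 \<tau>)) has_integral
        expansion_coeff \<xi> n i1 i2) {..0}"
      unfolding uc_coord_def expansion_coeff_def
      using nonresonance[OF i n' g(1)] stable[OF n'] by (intro has_integral_center_coord_product) auto
    from has_integral_unique[OF 1 has_integral_mult_left[OF this, of ?g]]
    show ?thesis using n' g(2) by simp
  qed
qed

text \<open>Bilinearity turns the nonlinear integrand into finitely many products of a scalar
  function with the orbit of one fixed vector, so that integrability and limits need be settled only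
  for a single pair.\<close>

lemma h_nonlinear_integrand_eq:
  assumes xi: "\<xi> \<in> Hc e m" and "\<tau> \<le> 0"
  shows "h_nonlinear_integrand D L e m B W \<xi> \<tau> = (\<Sum>i1=1..m. \<Sum>i2=1..m. pair_integrand \<xi> i1 i2 \<tau>)"
proof (rule vec_eqI1)
  fix n :: nat assume n: "1 \<le> n"
  let ?c = "\<lambda>i. uc_coord \<xi> i \<tau>"
  have eX: "e i \<in> X" if "i \<in> {1..m}" for i using that eigenvectors_in_X by simp
  \<comment> \<open>Bilinearity is available on \<open>X\<close> only, so the argument held fixed
    while the other is expanded must first be placed there.\<close>
  have uX: "(\<Sum>i=1..m. ?c i *\<^sub>R e i) \<in> X"
  proof (cases "m = 0")
    case True
    have "subspace X" using bilinear[OF eigenvectors_in_X[of 1]] by (simp add: linear_op_def)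
    then show ?thesis using True by (simp add: subspace_0)
  next
    case False
    have "subspace X" using bilinear[OF eigenvectors_in_X[of 1]] by (simp add: linear_op_def)
    then show ?thesis using eX by (intro subspace_sum subspace_scale)
  qed
  have "B (uc L e m W \<xi> \<tau>) (uc L e m W \<xi> \<tau>) = (\<Sum>i1=1..m. ?c i1 *\<^sub>R B (e i1) (\<Sum>i=1..m. ?c i *\<^sub>R e i))"
    unfolding uc_eq[OF xi] using bilinear[OF uX] eX by (intro linear_op_sum[where A = "\<lambda>y. B y _"]) auto
  also have "\<dots> = (\<Sum>i1=1..m. ?c i1 *\<^sub>R (\<Sum>i2=1..m. ?c i2 *\<^sub>R B (e i1) (e i2)))"
    using bilinear eX by (intro sum.cong refl arg_cong[where f = "scaleR _"] linear_op_sum) auto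
  finally have "inner (B (uc L e m W \<xi> \<tau>) (uc L e m W \<xi> \<tau>)) (e n) =
      (\<Sum>i1=1..m. \<Sum>i2=1..m. ?c i1 * ?c i2 * inner (B (e i1) (e i2)) (e n))"
    by (simp add: inner_sum_left sum_distrib_left mult.assoc)
  then show "inner (h_nonlinear_integrand D L e m B W \<xi> \<tau>) (e n) =
      inner (\<Sum>i1=1..m. \<Sum>i2=1..m. pair_integrand \<xi> i1 i2 \<tau>) (e n)"
    using n \<open>\<tau> \<le> 0\<close>
    by (simp add: h_nonlinear_integrand_def pair_integrand_def inner_exp_Ls Ps_in_Hs inner_Ps
      inner_sum_left sum_distrib_left mult_ac)
qed

lemma has_integral_nonlinear:
  assumes xi: "\<xi> \<in> Hc e m"
  shows "(h_nonlinear_integrand D L e m B W \<xi> has_integral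
    (\<Sum>i1=1..m. \<Sum>i2=1..m. integral {..0} (pair_integrand \<xi> i1 i2))) {..0}"
proof -
  have "((\<lambda>\<tau>. \<Sum>i1=1..m. \<Sum>i2=1..m. pair_integrand \<xi> i1 i2 \<tau>) has_integral
      (\<Sum>i1=1..m. \<Sum>i2=1..m. integral {..0} (pair_integrand \<xi> i1 i2))) {..0}"
    by (intro has_integral_sum integrable_integral pair_integrand_integral(1)) auto
  then show ?thesis
    by (rule has_integral_eq[rotated]) (simp add: h_nonlinear_integrand_eq[OF xi])
qed

lemma nonlinear_limit:
  assumes xi: "\<xi> \<in> Hc e m"
  shows "((\<lambda>a. integral {a..0} (h_nonlinear_integrand D L e m B W \<xi>)) \<longlongrightarrow>
    (\<Sum>i1=1..m. \<Sum>i2=1..m. integral {..0} (pair_integrand \<xi> i1 i2))) at_bot"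
proof (rule Lim_transform_eventually)
  show "((\<lambda>a. \<Sum>i1=1..m. \<Sum>i2=1..m. integral {a..0} (pair_integrand \<xi> i1 i2)) \<longlongrightarrow>
      (\<Sum>i1=1..m. \<Sum>i2=1..m. integral {..0} (pair_integrand \<xi> i1 i2))) at_bot"
    by (intro tendsto_sum pair_integrand_integral(2)) auto
  have "integral {a..0} (h_nonlinear_integrand D L e m B W \<xi>) =
      (\<Sum>i1=1..m. \<Sum>i2=1..m. integral {a..0} (pair_integrand \<xi> i1 i2))" for a
  proof (rule integral_unique)
    have "((\<lambda>\<tau>. \<Sum>i1=1..m. \<Sum>i2=1..m. pair_integrand \<xi> i1 i2 \<tau>) has_integral
        (\<Sum>i1=1..m. \<Sum>i2=1..m. integral {a..0} (pair_integrand \<xi> i1 i2))) {a..0}"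
      by (intro has_integral_sum integrable_integral integrable_continuous_interval
        continuous_on_subset[OF continuous_pair_integrand]) auto
    then show "(h_nonlinear_integrand D L e m B W \<xi> has_integral
        (\<Sum>i1=1..m. \<Sum>i2=1..m. integral {a..0} (pair_integrand \<xi> i1 i2))) {a..0}"
      by (rule has_integral_eq[rotated]) (simp add: h_nonlinear_integrand_eq[OF xi])
  qed
  then show "\<forall>\<^sub>F a in at_bot. (\<Sum>i1=1..m. \<Sum>i2=1..m. integral {a..0} (pair_integrand \<xi> i1 i2)) =
      integral {a..0} (h_nonlinear_integrand D L e m B W \<xi>)" by simp
qed

section \<open>The pullback limit and its Fourier series\<close>

lemma h1_eq:
  assumes "\<xi> \<in> Hc e m"
  shows "h1 D L e m B W \<xi> = (\<Sum>n=m+1..N. Z_coeff b \<sigma> \<omega> n *\<^sub>R e n)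
    + (\<Sum>i1=1..m. \<Sum>i2=1..m. integral {..0} (pair_integrand \<xi> i1 i2))"
  unfolding h1_def using has_integral_noise has_integral_nonlinear[OF assms] by (simp add: integral_unique)

text \<open>The n-th coordinate is the amplitude times
  \<open>Z_integrand b \<omega> n (- T)\<close>, whose decay is already known, and only finitely
  many modes are forced.\<close>

lemma boundary_term_limit: "((\<lambda>T. exp_Ls D L e m T (Ps e m (W (- T)))) \<longlongrightarrow> 0) at_top"
proof (rule Lim_transform_eventually)
  have "((\<lambda>T. \<Sum>n=m+1..N. (\<sigma> n * Z_integrand b \<omega> n (- T)) *\<^sub>R e n) \<longlongrightarrow> (\<Sum>n=m+1..N. (\<sigma> n * 0) *\<^sub>R e n)) at_top"
  proof (intro tendsto_intros)
    fix n assume "n \<in> {m+1..N}"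
    then have "(Z_integrand b \<omega> n \<longlongrightarrow> 0) at_bot"
      by (intro exp_decaying_tendsto_0 Z_integrand_decaying) simp
    then show "((\<lambda>T. Z_integrand b \<omega> n (- T)) \<longlongrightarrow> 0) at_top"
      by (rule filterlim_compose[OF _ filterlim_uminus_at_bot_at_top])
  qed
  then show "((\<lambda>T. \<Sum>n=m+1..N. (\<sigma> n * Z_integrand b \<omega> n (- T)) *\<^sub>R e n) \<longlongrightarrow> 0) at_top" by simp
  show "\<forall>\<^sub>F T in at_top. (\<Sum>n=m+1..N. (\<sigma> n * Z_integrand b \<omega> n (- T)) *\<^sub>R e n) =
      exp_Ls D L e m T (Ps e m (W (- T)))"
    using eventually_ge_at_top[of 0]
  proof eventually_elim
    case (elim T)
    show ?case
    proof (rule vec_eqI1)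
      fix n :: nat assume n: "1 \<le> n"
      show "inner (\<Sum>n=m+1..N. (\<sigma> n * Z_integrand b \<omega> n (- T)) *\<^sub>R e n) (e n) =
          inner (exp_Ls D L e m T (Ps e m (W (- T)))) (e n)"
        unfolding inner_stable_sum[OF n] using elim n
        by (simp add: inner_exp_Ls Ps_in_Hs inner_Ps inner_W Z_integrand_def)
    qed
  qed
qed

text \<open>The substitution \<tau> = r - T moves both integrals to \<open>{- T..0}\<close>. The
  endpoint term of the integration by parts at time 0 vanishes with \<open>W 0\<close>.\<close>

lemma us_at_eq:
  assumes "0 \<le> T"
  shows "us_at D L e m B W \<xi> T = - exp_Ls D L e m T (Ps e m (W (- T)))
    + integral {- T..0} (h_noise_integrand D L e m W)
    + integral {- T..0} (h_nonlinear_integrand D L e m B W \<xi>)"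
proof -
  have "exp_Ls D L e m T 0 = 0"
    using assms by (intro vec_eqI1) (simp add: inner_exp_Ls subspace_0[OF subspace_Hs])
  moreover have "Ps e m (W 0) = 0" by (simp add: W_zero Ps_def Pc_def)
  moreover have "integral {0..T} (\<lambda>r. F (r - T)) = integral {- T..0} F" for F :: "real \<Rightarrow> 'h"
    using integral_shift_real_ivl[of "- T" "- T" 0 F] by simp
  from this[of "h_noise_integrand D L e m W"] this[of "h_nonlinear_integrand D L e m B W \<xi>"]
  have "integral {0..T} (\<lambda>r. exp_Ls D L e m (T - r) (Ls L e m (Ps e m (W (r - T))))) =
      integral {- T..0} (h_noise_integrand D L e m W)"
    "integral {0..T} (\<lambda>r. exp_Ls D L e m (T - r) (Ps e m (B (uc L e m W \<xi> (r - T)) (uc L e m W \<xi> (r - T))))) =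
      integral {- T..0} (h_nonlinear_integrand D L e m B W \<xi>)"
    by (simp_all add: h_noise_integrand_def h_nonlinear_integrand_def)
  ultimately show ?thesis
    unfolding us_at_def forward_solution_def by simp
qed

lemma us_at_limit:
  assumes xi: "\<xi> \<in> Hc e m"
  shows "((\<lambda>T. us_at D L e m B W \<xi> T) \<longlongrightarrow> h1 D L e m B W \<xi>) at_top"
proof (rule Lim_transform_eventually)
  have "((\<lambda>T. - exp_Ls D L e m T (Ps e m (W (- T)))
      + integral {- T..0} (h_noise_integrand D L e m W)
      + integral {- T..0} (h_nonlinear_integrand D L e m B W \<xi>)) \<longlongrightarrow> - 0 + (\<Sum>n=m+1..N. Z_coeff b \<sigma> \<omega> n *\<^sub>R e n)
      + (\<Sum>i1=1..m. \<Sum>i2=1..m. integral {..0} (pair_integrand \<xi> i1 i2))) at_top"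
    by (intro tendsto_add tendsto_minus boundary_term_limit
      filterlim_compose[OF noise_limit filterlim_uminus_at_bot_at_top]
      filterlim_compose[OF nonlinear_limit[OF xi] filterlim_uminus_at_bot_at_top])
  then show "((\<lambda>T. - exp_Ls D L e m T (Ps e m (W (- T)))
      + integral {- T..0} (h_noise_integrand D L e m W)
      + integral {- T..0} (h_nonlinear_integrand D L e m B W \<xi>)) \<longlongrightarrow> h1 D L e m B W \<xi>) at_top"
    by (simp add: h1_eq[OF xi])
  show "\<forall>\<^sub>F T in at_top. - exp_Ls D L e m T (Ps e m (W (- T)))
      + integral {- T..0} (h_noise_integrand D L e m W)
      + integral {- T..0} (h_nonlinear_integrand D L e m B W \<xi>) = us_at D L e m B W \<xi> T"
    using eventually_ge_at_top[of 0] by eventually_elim (simp add: us_at_eq)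
qed

text \<open>The limit has no coordinates in the first \<open>m\<close> modes, so dropping these
  terms leaves its Fourier series unchanged; this is the offset \<open>m + 1 + k\<close>.\<close>

lemma nonlinear_expansion:
  "(\<lambda>k. \<Sum>i1=1..m. \<Sum>i2=1..m. (expansion_coeff \<xi> (m + 1 + k) i1 i2 *
      inner (B (e i1) (e i2)) (e (m + 1 + k))) *\<^sub>R e (m + 1 + k)) sums
    (\<Sum>i1=1..m. \<Sum>i2=1..m. integral {..0} (pair_integrand \<xi> i1 i2))"
proof -
  define I where "I = (\<Sum>i1=1..m. \<Sum>i2=1..m. integral {..0} (pair_integrand \<xi> i1 i2))"
  have inner_I: "inner I (e n) = (if n \<le> m then 0 else
      \<Sum>i1=1..m. \<Sum>i2=1..m. expansion_coeff \<xi> n i1 i2 * inner (B (e i1) (e i2)) (e n))" if "1 \<le> n" for n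
    using that by (simp add: I_def inner_sum_left inner_pair_integral)
  have "(\<lambda>k. inner I (e (Suc (k + m))) *\<^sub>R e (Suc (k + m))) sums I"
    unfolding sums_iff_shift[of "\<lambda>k. inner I (e (Suc k)) *\<^sub>R e (Suc k)"]
    using fourier[of I] by (simp add: inner_I)
  moreover have "inner I (e (Suc (k + m))) *\<^sub>R e (Suc (k + m)) =
      (\<Sum>i1=1..m. \<Sum>i2=1..m. (expansion_coeff \<xi> (m + 1 + k) i1 i2 *
        inner (B (e i1) (e i2)) (e (m + 1 + k))) *\<^sub>R e (m + 1 + k))" for k
    by (simp add: inner_I scaleR_sum_left add.commute)
  ultimately show ?thesis unfolding I_def by (simp only:)
qed

end

text \<open>Integrability is asserted beside every improper integral, and convergence through
  \<open>sums\<close>, because \<open>integral\<close> takes the default value 0 on non-integrable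
  functions and an equation alone would not express convergence.\<close>

theorem theorem3p1:
  fixes J :: "'k::{real_inner,banach} \<Rightarrow> 'h::{real_inner,banach}"
    and A :: "'h \<Rightarrow> 'h" and \<alpha> :: real
    and Bl :: "real \<Rightarrow> 'h \<Rightarrow> 'h" and B :: "'h \<Rightarrow> 'h \<Rightarrow> 'h"
    and lam :: real and e :: "nat \<Rightarrow> 'h" and \<beta> :: "nat \<Rightarrow> real \<Rightarrow> real"
    and N m :: nat and \<sigma> :: "nat \<Rightarrow> real" and P :: "(real \<Rightarrow> nat \<Rightarrow> real) measure"
    and H1 H\<alpha> :: "'h set" and norm\<alpha> :: "'h \<Rightarrow> real" and L :: "'h \<Rightarrow> 'h"
    and b :: "nat \<Rightarrow> real" and W :: "(real \<Rightarrow> nat \<Rightarrow> real) \<Rightarrow> real \<Rightarrow> 'h"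
  assumes H1_def: "H1 = range J"
    and H\<alpha>_def: "H\<alpha> = frac_space H1 A \<alpha>"
    and norm\<alpha>_def: "norm\<alpha> = frac_norm H1 A \<alpha>"
    and L_def: "L = perturbed_op A Bl lam"
    and b_def: "b = (\<lambda>k. \<beta> k lam)"
    and W_def: "W = noise_path \<sigma> e N"
    and "compact_dense_embedding J"
    and "sectorial H1 A" and "\<forall>z\<in>op_spectrum H1 (\<lambda>x. - A x). Re z < 0"
    and "0 \<le> \<alpha>" and "\<alpha> < 1" and "H1 \<subseteq> H\<alpha>"
    and "continuous_bounded_family H\<alpha> norm\<alpha> Bl"
    and "self_adjoint_op H1 L" and "orthonormal_basis e"
    and "\<forall>k\<ge>1. e k \<in> H1 \<and> L (e k) = b k *\<^sub>R e k"
    and "continuous_bilinear_nonlinearity H\<alpha> norm\<alpha> B"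
    and "\<forall>i\<in>{1..N}. \<sigma> i > 0" and "\<forall>i. i \<notin> {1..N} \<longrightarrow> \<sigma> i = 0"
    and "wiener_measure N P"
    and "\<forall>\<omega>\<in>sublinear_paths N. uniquely_solvable H\<alpha> norm\<alpha> H1 L B (W \<omega>)"
    and "\<forall>n>m. b n < 0"
    and "\<forall>i1\<in>{1..m}. \<forall>i2\<in>{1..m}. \<forall>n>m. inner (B (e i1) (e i2)) (e n) \<noteq> 0 \<longrightarrow>
           b i1 + b i2 - b n > 0"
    and "\<forall>i1\<in>{1..m}. \<forall>i2\<in>{1..m}. \<forall>n>m. inner (B (e i1) (e i2)) (e n) \<noteq> 0 \<and> \<sigma> i1 \<noteq> 0 \<longrightarrow>
           b i2 - b n > 0"
    and "\<forall>i1\<in>{1..m}. \<forall>i2\<in>{1..m}. \<forall>n>m. inner (B (e i1) (e i2)) (e n) \<noteq> 0 \<and> \<sigma> i2 \<noteq> 0 \<longrightarrow>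
           b i1 - b n > 0"
  shows "sublinear_paths N \<in> sets P \<and> measure P (sublinear_paths N) = 1 \<and>
    (\<forall>t. wiener_shift t ` sublinear_paths N = sublinear_paths N) \<and>
    (\<forall>\<xi>\<in>Hc e m. \<forall>\<omega>\<in>sublinear_paths N.
       (\<forall>T>0. \<forall>u. backward_solution L e m (W \<omega>) T \<xi> u \<longleftrightarrow>
          (\<forall>s\<in>{-T..0}. u s = uc L e m (W \<omega>) \<xi> s)) \<and>
       h_noise_integrand H1 L e m (W \<omega>) integrable_on {..0} \<and>
       h_nonlinear_integrand H1 L e m B (W \<omega>) \<xi> integrable_on {..0} \<and>
       ((\<lambda>T. us_at H1 L e m B (W \<omega>) \<xi> T) \<longlongrightarrow> h1 H1 L e m B (W \<omega>) \<xi>) at_top \<and>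
       (\<forall>n\<in>{m+1..N}. Z_integrand b \<omega> n integrable_on {..0}) \<and>
       (\<forall>i1\<in>{1..m}. \<forall>i2\<in>{1..m}. \<forall>n>m. inner (B (e i1) (e i2)) (e n) \<noteq> 0 \<longrightarrow>
          D_integrand b n i1 i2 integrable_on {..0} \<and>
          D_coeff b n i1 i2 = 1 / (b i1 + b i2 - b n) \<and>
          (\<forall>j\<in>{1..8}. M_prefactor b \<sigma> j i1 i2 \<noteq> 0 \<longrightarrow>
             M_integrand b \<omega> j n i1 i2 integrable_on {..0})) \<and>
       (\<exists>S. (\<lambda>k. let n = m + 1 + k in
               \<Sum>i1=1..m. \<Sum>i2=1..m.
                 ((A_coeff b \<sigma> \<omega> n i1 i2
                   + B_coeff b \<sigma> \<omega> n i1 i2 * inner \<xi> (e i1)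
                   + C_coeff b \<sigma> \<omega> n i1 i2 * inner \<xi> (e i2)
                   + D_coeff b n i1 i2 * inner \<xi> (e i1) * inner \<xi> (e i2))
                  * inner (B (e i1) (e i2)) (e n)) *\<^sub>R e n) sums S \<and>
          h1 H1 L e m B (W \<omega>) \<xi> = (\<Sum>n=m+1..N. Z_coeff b \<sigma> \<omega> n *\<^sub>R e n) + S))"
proof -
  note J = assms(7) and self_adjoint = assms(14) and basis = assms(15) and eigen = assms(16)
    and bilinear = assms(17) and sigma_off = assms(19) and wiener = assms(20) and stable = assms(22)
    and resonance = assms(23-25)
  \<comment> \<open>Probability and analysis separate here: for one fixed sublinear path all
    remaining claims about the system are deterministic.\<close>
  have "backward_forward e H1 L b m \<omega> \<sigma> N B H\<alpha>" if \<omega>: "\<omega> \<in> sublinear_paths N" for \<omega>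
  proof -
    have C0: "\<omega> \<in> C0_paths N" using \<omega> by (simp add: sublinear_paths_def)
    interpret spectral_op e H1 L b
      using basis self_adjoint eigen by unfold_locales auto
    interpret stable_op e H1 L b m
      using stable by unfold_locales auto
    interpret driving_path \<omega> b \<sigma>
    proof
      show "continuous_on UNIV (\<lambda>t. \<omega> t i)" for i by (rule C0_paths_continuous[OF C0])
      show "growth_rate 0 (\<lambda>t. \<omega> t i)" for i
      proof (cases "i \<in> {1..N}")
        case True
        then show ?thesis
          by (intro growth_rate_sublinear C0_paths_continuous[OF C0] sublinear_pathsD(2)[OF \<omega>])
      next
        case False
        \<comment> \<open>Sublinearity is imposed only on the coordinates in \<open>{1..N}\<close>;
          the others are identically zero.\<close>
        then have "(\<lambda>t. \<omega> t i) = (\<lambda>_. 0)" using C0 by (auto simp: C0_paths_def)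
        then show ?thesis by (simp add: growth_rate_def) (metis less_eq_real_def mult_zero_left)
      qed
    qed
    show ?thesis
    proof
      show "\<sigma> i = 0" if "i \<notin> {1..N}" for i using sigma_off that by blast
      show "\<omega> 0 i = 0" for i using C0 by (simp add: C0_paths_def)
      show "finite {n. 1 \<le> n \<and> \<bar>b n\<bar> \<le> C}" for C
        by (rule eigenvalues_discrete[OF J H1_def])
      show "linear_op H\<alpha> (B x) \<and> linear_op H\<alpha> (\<lambda>y. B y x)" if "x \<in> H\<alpha>" for x
        using bilinear that by (simp add: continuous_bilinear_nonlinearity_def)
      show "e i \<in> H\<alpha>" if "1 \<le> i" for i
        using eigen assms(12) that by blast
      show "0 < b i1 + b i2 - b n \<and> (\<sigma> i1 \<noteq> 0 \<longrightarrow> 0 < b i2 - b n) \<and> (\<sigma> i2 \<noteq> 0 \<longrightarrow> 0 < b i1 - b n)"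
        if "i1 \<in> {1..m}" "i2 \<in> {1..m}" "m < n" "inner (B (e i1) (e i2)) (e n) \<noteq> 0" for i1 i2 n
        using resonance that by blast
    qed
  qed
  note bf = this
  show ?thesis
  proof (intro conjI ballI)
    show "sublinear_paths N \<in> sets P" "measure P (sublinear_paths N) = 1"
      using sublinear_paths_full_measure[OF wiener] by simp_all
    show "\<forall>t. wiener_shift t ` sublinear_paths N = sublinear_paths N"
      by (simp add: wiener_shift_image_sublinear)
  next
    fix \<xi> \<omega> assume xi: "\<xi> \<in> Hc e m" and \<omega>: "\<omega> \<in> sublinear_paths N"
    interpret backward_forward e H1 L b m \<omega> \<sigma> N B H\<alpha> by (rule bf[OF \<omega>])
    show "\<forall>T>0. \<forall>u. backward_solution L e m (W \<omega>) T \<xi> u \<longleftrightarrow>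
          (\<forall>s\<in>{-T..0}. u s = uc L e m (W \<omega>) \<xi> s)"
      unfolding W_def using backward_solution_iff[OF xi] by blast
    show "h_noise_integrand H1 L e m (W \<omega>) integrable_on {..0}"
      unfolding W_def using has_integral_noise by blast
    show "h_nonlinear_integrand H1 L e m B (W \<omega>) \<xi> integrable_on {..0}"
      unfolding W_def using has_integral_nonlinear[OF xi] by blast
    show "((\<lambda>T. us_at H1 L e m B (W \<omega>) \<xi> T) \<longlongrightarrow> h1 H1 L e m B (W \<omega>) \<xi>) at_top"
      unfolding W_def by (rule us_at_limit[OF xi])
    show "Z_integrand b \<omega> n integrable_on {..0}" if "n \<in> {m+1..N}" for n
      using that by (intro Z_integrand_integrable) simp
    fix i1 i2 assume i: "i1 \<in> {1..m}" "i2 \<in> {1..m}"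
    show "\<forall>n>m. inner (B (e i1) (e i2)) (e n) \<noteq> 0 \<longrightarrow>
          D_integrand b n i1 i2 integrable_on {..0} \<and>
          D_coeff b n i1 i2 = 1 / (b i1 + b i2 - b n) \<and>
          (\<forall>j\<in>{1..8}. M_prefactor b \<sigma> j i1 i2 \<noteq> 0 \<longrightarrow>
             M_integrand b \<omega> j n i1 i2 integrable_on {..0})"
    proof (intro allI impI conjI ballI)
      fix n assume n: "m < n" "inner (B (e i1) (e i2)) (e n) \<noteq> 0"
      note nr = nonresonance[OF i n]
      show "D_integrand b n i1 i2 integrable_on {..0}"
        using nr by (intro exp_decaying_integrable continuous_D_integrand D_integrand_decaying) simp
      show "D_coeff b n i1 i2 = 1 / (b i1 + b i2 - b n)"
        using nr by (intro D_coeff_eq) simp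
      fix j assume "M_prefactor b \<sigma> j i1 i2 \<noteq> 0"
      then show "M_integrand b \<omega> j n i1 i2 integrable_on {..0}"
        using nr stable n(1)
        by (intro exp_decaying_integrable continuous_M_integrand M_integrand_decaying) auto
    qed
  next
    fix \<xi> \<omega> assume xi: "\<xi> \<in> Hc e m" and \<omega>: "\<omega> \<in> sublinear_paths N"
    interpret backward_forward e H1 L b m \<omega> \<sigma> N B H\<alpha> by (rule bf[OF \<omega>])
    show "\<exists>S. (\<lambda>k. let n = m + 1 + k in
               \<Sum>i1=1..m. \<Sum>i2=1..m.
                 ((A_coeff b \<sigma> \<omega> n i1 i2
                   + B_coeff b \<sigma> \<omega> n i1 i2 * inner \<xi> (e i1)
                   + C_coeff b \<sigma> \<omega> n i1 i2 * inner \<xi> (e i2)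
                   + D_coeff b n i1 i2 * inner \<xi> (e i1) * inner \<xi> (e i2))
                  * inner (B (e i1) (e i2)) (e n)) *\<^sub>R e n) sums S \<and>
          h1 H1 L e m B (W \<omega>) \<xi> = (\<Sum>n=m+1..N. Z_coeff b \<sigma> \<omega> n *\<^sub>R e n) + S"
      unfolding W_def Let_def
      using nonlinear_expansion[of \<xi>, unfolded expansion_coeff_def] h1_eq[OF xi] by blast
  qed
qed

end
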